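(* As $n\to\infty$, $$\max_{a+b+c\le 3n}\ \max_{\alpha\vdash a}\ \max_{\beta\vdash b}\ \max_{\gamma\vdash c}\ \overline{g}(\alpha,\beta,\gamma)\;=\;\sqrt{n!}\;e^{O(n)},$$ where the outer maximum is over nonnegative integers $a,b,c$ with $a+b+c\le 3n$; i.e. there is a constant $C>0$ such that this maximum lies between $\sqrt{n!}\,e^{-Cn}$ and $\sqrt{n!}\,e^{Cn}$ for all $n\ge1$.
   Context: For partitions $\lambda,\mu,\nu\vdash n$, the Kronecker coefficient is $g(\lambda,\mu,\nu)=\frac{1}{n!}\sum_{\sigma\in S_n}\chi^\lambda(\sigma)\chi^\mu(\sigma)\chi^\nu(\sigma)$, where $\chi^\lambda$ is the irreducible character of $S_n$ indexed by $\lambda$. For a partition $\alpha=(\alpha_1,\alpha_2,\ldots)$ and $n\ge|\alpha|+\alpha_1$, write $\alpha[n]:=(n-|\alpha|,\alpha_1,\alpha_2,\ldots)\vdash n$. The reduced Kronecker coefficient is $\overline{g}(\alpha,\beta,\gamma):=\lim_{n\to\infty}g(\alpha[n],\beta[n],\gamma[n])$ (this sequence is eventually constant). *)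

theory Defs
  imports Complex_Main "HOL-Combinatorics.Permutations" "HOL-Library.Function_Algebras"
begin

section \<open>Partitions\<close>

text \<open>A partition is the weakly decreasing list of its nonzero parts.\<close>

definition is_partition :: "nat list \<Rightarrow> nat \<Rightarrow> bool"  (infix "\<turnstile>\<^sub>p" 50) where
  "lam \<turnstile>\<^sub>p n \<longleftrightarrow> sorted_wrt (\<ge>) lam \<and> 0 \<notin> set lam \<and> sum_list lam = n"

definition cells :: "nat list \<Rightarrow> (nat \<times> nat) set" where
  "cells lam = {(i, j). i < length lam \<and> j < lam ! i}"


section \<open>Specht modules and irreducible characters of the symmetric group\<close>

text \<open>The group \<open>S\<^sub>n\<close> consists of the permutations of \<open>{..<n}\<close>.
  Functions \<open>'a \<Rightarrow> real\<close> form a real vector space under the pointwise operations.\<close>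

global_interpretation fun_space:
  vector_space "\<lambda>(c::real) (f :: 'a \<Rightarrow> real) x. c * f x"
  by standard (auto simp: fun_eq_iff plus_fun_def algebra_simps)

definition is_tableau :: "nat list \<Rightarrow> (nat \<times> nat \<Rightarrow> nat) \<Rightarrow> bool" where
  "is_tableau lam t \<longleftrightarrow> bij_betw t (cells lam) {..<sum_list lam}"

text \<open>The tabloid \<open>{t}\<close>, i.e. the class of the tableau \<open>t\<close> up to reordering entries within rows,
  is encoded by the function sending each entry to the index of its row
  (and everything outside \<open>{..<n}\<close> to \<open>0\<close>).\<close>

definition tabloid :: "nat list \<Rightarrow> (nat \<times> nat \<Rightarrow> nat) \<Rightarrow> (nat \<Rightarrow> nat)" where
  "tabloid lam t = (\<lambda>x. if x < sum_list lam then fst (inv_into (cells lam) t x) else 0)"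

text \<open>The column stabilizer of \<open>t\<close>.\<close>

definition col_stab :: "nat list \<Rightarrow> (nat \<times> nat \<Rightarrow> nat) \<Rightarrow> (nat \<Rightarrow> nat) set" where
  "col_stab lam t = {p. p permutes {..<sum_list lam} \<and>
     (\<forall>(i, j) \<in> cells lam. \<exists>i'. (i', j) \<in> cells lam \<and> p (t (i, j)) = t (i', j))}"

text \<open>Elements of the permutation module on tabloids are coefficient functions on tabloids; the
  polytabloid of \<open>t\<close> is the sum of \<open>sign p \<cdot> {p t}\<close> over the column stabilizer.\<close>

definition polytabloid :: "nat list \<Rightarrow> (nat \<times> nat \<Rightarrow> nat) \<Rightarrow> ((nat \<Rightarrow> nat) \<Rightarrow> real)" where
  "polytabloid lam t =
     (\<lambda>r. \<Sum>p\<in>col_stab lam t. if tabloid lam (p \<circ> t) = r then of_int (sign p) else 0)"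

definition specht :: "nat list \<Rightarrow> ((nat \<Rightarrow> nat) \<Rightarrow> real) set" where
  "specht lam = fun_space.span {polytabloid lam t | t. is_tableau lam t}"

text \<open>A permutation \<open>s\<close> sends the tabloid \<open>{t}\<close> to \<open>{s t}\<close>, that is, the row function \<open>r\<close> to
  \<open>r \<circ> s\<^sup>-\<^sup>1\<close>; on coefficient functions this becomes precomposition with \<open>r \<mapsto> r \<circ> s\<close>.\<close>

definition perm_act :: "(nat \<Rightarrow> nat) \<Rightarrow> ((nat \<Rightarrow> nat) \<Rightarrow> real) \<Rightarrow> ((nat \<Rightarrow> nat) \<Rightarrow> real)" where
  "perm_act s f = (\<lambda>r. f (r \<circ> s))"

text \<open>Trace of a linear endomorphism \<open>T\<close> of a finite-dimensional subspace \<open>V\<close>: the sum of the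
  diagonal coefficients of \<open>T\<close> with respect to a basis (the choice of which does not matter).\<close>

definition trace_on :: "('a \<Rightarrow> real) set \<Rightarrow> (('a \<Rightarrow> real) \<Rightarrow> ('a \<Rightarrow> real)) \<Rightarrow> real" where
  "trace_on V T =
     (let B = (SOME B. fun_space.independent B \<and> fun_space.span B = V)
      in \<Sum>b\<in>B. fun_space.representation B (T b) b)"

text \<open>The irreducible character indexed by \<open>lam\<close>. Working over the reals is harmless: the complex
  Specht module, which is the complex irreducible representation indexed by \<open>lam\<close>, is the
  complexification of the real one, so the two have the same character.\<close>

definition irr_char :: "nat list \<Rightarrow> (nat \<Rightarrow> nat) \<Rightarrow> real" where
  "irr_char lam s = trace_on (specht lam) (perm_act s)"


section \<open>Kronecker and reduced Kronecker coefficients\<close>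

text \<open>Only meant for three partitions of the same number.\<close>

definition kronecker :: "nat list \<Rightarrow> nat list \<Rightarrow> nat list \<Rightarrow> real" where
  "kronecker lam mu nu =
     (\<Sum>s | s permutes {..<sum_list lam}. irr_char lam s * irr_char mu s * irr_char nu s)
       / fact (sum_list lam)"

text \<open>The partition \<open>\<alpha>[n]\<close>; meaningful for \<open>n \<ge> |\<alpha>| + \<alpha>\<^sub>1\<close> (and \<open>n > 0\<close>), which is all that
  matters in the limit below.\<close>

definition pad :: "nat list \<Rightarrow> nat \<Rightarrow> nat list" where
  "pad \<alpha> n = (n - sum_list \<alpha>) # \<alpha>"

definition reduced_kronecker :: "nat list \<Rightarrow> nat list \<Rightarrow> nat list \<Rightarrow> real" where
  "reduced_kronecker \<alpha> \<beta> \<gamma> = lim (\<lambda>n. kronecker (pad \<alpha> n) (pad \<beta> n) (pad \<gamma> n))"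

definition max_reduced_kronecker :: "nat \<Rightarrow> real" where
  "max_reduced_kronecker n =
     Max {reduced_kronecker \<alpha> \<beta> \<gamma> | a b c \<alpha> \<beta> \<gamma>.
            a + b + c \<le> 3 * n \<and> \<alpha> \<turnstile>\<^sub>p a \<and> \<beta> \<turnstile>\<^sub>p b \<and> \<gamma> \<turnstile>\<^sub>p c}"

end

theory Submission
  imports Defs "HOL-Combinatorics.Cycles" "HOL-Analysis.Convex"
begin

text \<open>Let \<open>\<chi>\<^sub>\<alpha>\<close> be the character of \<open>\<alpha>[N]\<close>, with \<open>N\<close> large, and \<open>\<pi>\<^sub>\<alpha>\<close> the permutation character on
  tabloids of this shape. By Burnside's lemma the averages of \<open>\<pi>\<^sub>\<alpha> \<pi>\<^sub>\<beta> \<pi>\<^sub>\<gamma>\<close> do not depend on \<open>N\<close>, and by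
  triangularity neither do the coefficients that express \<open>\<chi>\<^sub>\<alpha>\<close> in terms of the \<open>\<pi>\<^sub>\<beta>\<close>; so the Kronecker
  coefficients stabilize.

  Lower bound: for \<open>\<alpha> = (1\<^sup>n)\<close> the values of \<open>\<pi> = \<pi>\<^sub>\<alpha>\<close> are \<open>0\<close> or at least \<open>n!\<close>, and \<open>\<pi>\<close> has mean \<open>1\<close>, so
  \<open>\<pi>\<^sup>3\<close> has mean at least \<open>n!\<^sup>2\<close>. On the other hand \<open>\<pi>\<close> is a combination of exponentially many \<open>\<chi>\<^sub>\<beta>\<close> with
  \<open>|\<beta>| \<le> n\<close>, whose squared coefficients sum to at most \<open>2\<^sup>n n!\<close>. Expanding the cube, some coefficient
  \<open>g\<close> is at least \<open>n!\<^sup>2 / (n!\<^sup>3\<^sup>/\<^sup>2 e\<^sup>O\<^sup>(\<^sup>n\<^sup>))\<close>.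

  Upper bound: if \<open>b + c \<le> 2 n\<close>, then by Cauchy-Schwarz \<open>g\<^sup>4\<close> is at most the product of the fourth
  moments of \<open>\<chi>\<^sub>\<beta>\<close> and \<open>\<chi>\<^sub>\<gamma>\<close>. Here \<open>\<chi>\<^sub>\<beta>\<close> is contained in the character induced from the character of \<open>\<beta>\<close>
  on \<open>S\<^sub>b \<times> S\<^sub>N\<^sub>-\<^sub>b\<close>, and the fourth moment of the latter is at most \<open>b! e\<^sup>O\<^sup>(\<^sup>b\<^sup>)\<close>: the squares of the
  character of \<open>\<beta>\<close> are bounded by \<open>b!\<close> and have mean \<open>1\<close>, and the moments of the number of invariant
  \<open>b\<close>-subsets grow exponentially in \<open>b\<close>.\<close>

section \<open>Orthogonal projections and traces\<close>

text \<open>The characters are traces over a basis picked by \<open>SOME\<close>, so nothing can be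
  computed from the definition directly. Every Specht module is therefore replaced by the matrix of
  the orthogonal projection onto it: the trace becomes a finite sum of matrix entries, the
  multiplicity of the trivial character becomes a sum of squares, and Schur-type arguments become
  statements about invariant kernels. Nonnegativity of multiplicities and orthonormality both come
  from there. In the upper bound, a + b + c \<le> 3n makes some two of the three sizes add up to at
  most 2n, because the three pairwise sums have mean at most 2n; the remaining character has mean
  square 1 and costs nothing. With b and c the chosen sizes, b! c! \<le> (2n)! \<le> 4^n (n!)^2, so
  that g^4 is at most (n!)^2 up to an exponential factor.\<close>

text \<open>The reproducing kernel of V for the standard inner product of functions on X, that is,
  the matrix of the orthogonal projection onto V. It is determined by V, which a basis is not, so
  symmetries of V pass to it.\<close>

definition proj_kernel :: "'a set \<Rightarrow> ('a \<Rightarrow> real) set \<Rightarrow> ('a \<Rightarrow> 'a \<Rightarrow> real) \<Rightarrow> bool" where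
  "proj_kernel X V P \<longleftrightarrow> (\<forall>x y. P x y = P y x) \<and> (\<forall>x y. x \<notin> X \<longrightarrow> P x y = 0) \<and>
     (\<forall>x. P x \<in> V) \<and> (\<forall>v\<in>V. \<forall>x. (\<Sum>y\<in>X. P x y * v y) = v x)"

lemma sum_fun_eq: "(\<Sum>i\<in>I. f i) = (\<lambda>x. \<Sum>i\<in>I. f i x :: 'b :: comm_monoid_add)"
  by (induction I rule: infinite_finite_induct) (auto simp: fun_eq_iff)

lemma span_lincomb:
  assumes "\<And>i. i \<in> I \<Longrightarrow> f i \<in> fun_space.span S"
  shows "(\<lambda>x. \<Sum>i\<in>I. c i * f i x) \<in> fun_space.span S"
proof -
  have "(\<Sum>i\<in>I. (\<lambda>x. c i * f i x)) \<in> fun_space.span S"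
    by (intro fun_space.span_sum fun_space.span_scale assms)
  thus ?thesis by (simp add: sum_fun_eq)
qed

text \<open>Gram-Schmidt on kernels: adjoining a generator v adds the rank-one projection onto the
  component u of v orthogonal to the old span, and adds nothing when u vanishes.\<close>

lemma proj_kernel_exists:
  assumes X: "finite X" and "finite S" and "\<And>v x. v \<in> S \<Longrightarrow> x \<notin> X \<Longrightarrow> v x = 0"
  shows "\<exists>P. proj_kernel X (fun_space.span S) P"
  using assms(2,3)
proof (induction S rule: finite_induct)
  case empty
  have "proj_kernel X (fun_space.span {}) (\<lambda>x y. 0)"
    by (auto simp: proj_kernel_def zero_fun_def)
  thus ?case by (intro exI)
next
  case (insert v S)
  then obtain P where "proj_kernel X (fun_space.span S) P" by auto
  hence sym: "P x y = P y x" and supp: "x \<notin> X \<Longrightarrow> P x y = 0" and range: "P x \<in> fun_space.span S"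
    and fix_P: "w \<in> fun_space.span S \<Longrightarrow> (\<Sum>y\<in>X. P x y * w y) = w x" for x y w
    unfolding proj_kernel_def by blast+
  define Pv where "Pv = (\<lambda>x. \<Sum>y\<in>X. v y * P y x)"
  have Pv: "Pv \<in> fun_space.span S"
    unfolding Pv_def by (intro span_lincomb range)
  define u where "u = v - Pv"
  have supp_S: "w x = 0" if "w \<in> fun_space.span S" "x \<notin> X" for w x
    using fix_P[OF that(1), of x] supp[OF that(2)] by simp
  have u_span: "u \<in> fun_space.span (insert v S)"
    unfolding u_def
  proof (rule fun_space.span_diff)
    show "v \<in> fun_space.span (insert v S)" by (simp add: fun_space.span_base)
    show "Pv \<in> fun_space.span (insert v S)"
      using Pv fun_space.span_mono[of S "insert v S"] by blast
  qed
  have Pu: "(\<Sum>y\<in>X. P x y * u y) = 0" for x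
    using fix_P[OF Pv, of x] sym
    by (simp add: u_def right_diff_distrib sum_subtractf Pv_def mult.commute)
  have orth: "(\<Sum>x\<in>X. u x * w x) = 0" if w: "w \<in> fun_space.span S" for w
  proof -
    have "(\<Sum>x\<in>X. u x * w x) = (\<Sum>x\<in>X. \<Sum>y\<in>X. u x * (P x y * w y))"
      using fix_P[OF w] by (simp flip: sum_distrib_left)
    also have "\<dots> = (\<Sum>y\<in>X. \<Sum>x\<in>X. u x * (P x y * w y))" by (rule sum.swap)
    also have "\<dots> = (\<Sum>y\<in>X. w y * (\<Sum>x\<in>X. P y x * u x))"
      by (simp add: sum_distrib_left sym mult_ac)
    finally show ?thesis by (simp add: Pu)
  qed
  define N where "N = (\<Sum>x\<in>X. u x * u x)"
  show ?case
  proof (cases "N = 0")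
    case True
    have "u x = 0" for x
    proof (cases "x \<in> X")
      case True
      thus ?thesis using \<open>N = 0\<close> X unfolding N_def
        by (subst (asm) sum_nonneg_eq_0_iff) auto
    next
      case False
      thus ?thesis using insert.prems supp_S[OF Pv] by (simp add: u_def)
    qed
    hence "v = Pv" by (auto simp: u_def fun_eq_iff)
    hence "fun_space.span (insert v S) = fun_space.span S"
      using Pv by (simp add: fun_space.span_redundant)
    thus ?thesis using \<open>proj_kernel X _ P\<close> by auto
  next
    case False
    have ux: "u x = 0" if "x \<notin> X" for x
      using that insert.prems supp_S[OF Pv] by (simp add: u_def)
    define P' where "P' = (\<lambda>x y. P x y + u x * u y / N)"
    have "proj_kernel X (fun_space.span (insert v S)) P'"
      unfolding proj_kernel_def
    proof (intro conjI allI ballI impI)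
      fix x y show "P' x y = P' y x" by (simp add: P'_def sym mult.commute)
    next
      fix x y assume "x \<notin> X" thus "P' x y = 0" by (simp add: P'_def supp ux)
    next
      fix x
      have "P' x = P x + (\<lambda>y. (u x / N) * u y)" by (auto simp: P'_def fun_eq_iff)
      moreover have "P x \<in> fun_space.span (insert v S)"
        using range fun_space.span_mono[of S "insert v S"] by blast
      ultimately show "P' x \<in> fun_space.span (insert v S)"
        using fun_space.span_add fun_space.span_scale u_span by metis
    next
      fix w x assume "w \<in> fun_space.span (insert v S)"
      then obtain k where k: "w - (\<lambda>x. k * v x) \<in> fun_space.span S"
        by (auto simp: fun_space.span_breakdown_eq)
      \<comment> \<open>Splitting w along u instead of v separates the two parts of the new kernel:
        P fixes \<open>w1\<close> and kills u.\<close>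
      define w1 where "w1 = (w - (\<lambda>x. k * v x)) + (\<lambda>x. k * Pv x)"
      have w1: "w1 \<in> fun_space.span S"
        unfolding w1_def by (intro fun_space.span_add k fun_space.span_scale Pv)
      have w: "w y = w1 y + k * u y" for y by (simp add: w1_def u_def algebra_simps)
      have "(\<Sum>y\<in>X. P' x y * w y)
          = (\<Sum>y\<in>X. P x y * w1 y) + k * (\<Sum>y\<in>X. P x y * u y) + u x / N * (\<Sum>y\<in>X. u y * w1 y)
            + u x / N * k * (\<Sum>y\<in>X. u y * u y)"
        unfolding P'_def w
        by (simp add: sum_distrib_left sum.distrib[symmetric]) (simp add: algebra_simps add_divide_distrib)
      also have "\<dots> = w1 x + k * u x"
        using False by (simp add: fix_P[OF w1] Pu orth[OF w1] flip: N_def)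
      finally show "(\<Sum>y\<in>X. P' x y * w y) = w x" by (simp add: w)
    qed
    thus ?thesis by (intro exI)
  qed
qed

lemma proj_kernel_idem:
  assumes "proj_kernel X V P"
  shows "(\<Sum>y\<in>X. P x y * P y z) = P x z"
proof -
  have "(\<Sum>y\<in>X. P x y * P z y) = P z x"
    using assms unfolding proj_kernel_def by blast
  moreover have "P z y = P y z" for y z using assms unfolding proj_kernel_def by blast
  ultimately show ?thesis by simp
qed

text \<open>The transported kernel reproduces V as well, and pairing two reproducing kernels of V
  with each other shows that they agree.\<close>

lemma proj_kernel_invariant:
  assumes P: "proj_kernel X V P" and s: "bij_betw s X X" and t: "bij_betw t X X"
    and ts: "\<And>x. x \<in> X \<Longrightarrow> t (s x) = x"
    and V: "\<And>v. v \<in> V \<Longrightarrow> (\<lambda>x. v (s x)) \<in> V" "\<And>v. v \<in> V \<Longrightarrow> (\<lambda>x. v (t x)) \<in> V"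
    and x: "x \<in> X" and y: "y \<in> X"
  shows "P (s x) (s y) = P x y"
proof -
  have sym: "P x y = P y x" for x y using P unfolding proj_kernel_def by blast
  have fixP: "(\<Sum>y\<in>X. P x y * v y) = v x" if "v \<in> V" for v x
    using P that unfolding proj_kernel_def by blast
  have PV: "P x \<in> V" for x using P unfolding proj_kernel_def by blast
  have fixQ: "(\<Sum>y\<in>X. P (s x) (s y) * v y) = v x" if "v \<in> V" "x \<in> X" for v x
  proof -
    have "(\<Sum>y\<in>X. P (s x) (s y) * v y) = (\<Sum>y\<in>X. P (s x) (s y) * v (t (s y)))"
      using ts by simp
    also have "\<dots> = (\<Sum>y\<in>X. P (s x) y * v (t y))"
      by (rule sum.reindex_bij_betw[OF s])
    also have "\<dots> = v (t (s x))" by (rule fixP) (use V that in auto)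
    finally show ?thesis using that ts by simp
  qed
  have "(\<Sum>z\<in>X. P (s x) (s z) * P y z) = P y x"
    by (rule fixQ) (use PV x in auto)
  moreover have "(\<Sum>z\<in>X. P y z * P (s x) (s z)) = P (s x) (s y)"
    by (rule fixP[of "\<lambda>z. P (s x) (s z)"]) (use PV V in auto)
  ultimately show ?thesis using sym by (simp add: mult.commute)
qed

text \<open>Every v in V is the combination of the rows \<open>P y\<close> with coefficients
  \<open>v y\<close>, so the coordinates of v come from those of the rows. After exchanging the
  sums, the basis expansion of each row collapses, and the unspecified basis disappears.\<close>

lemma trace_on_proj_kernel:
  assumes X: "finite X" and S: "finite S" and P: "proj_kernel X (fun_space.span S) P"
    and T: "\<And>v. v \<in> fun_space.span S \<Longrightarrow> (\<lambda>x. v (\<phi> x)) \<in> fun_space.span S"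
  shows "trace_on (fun_space.span S) (\<lambda>v x. v (\<phi> x)) = (\<Sum>x\<in>X. P (\<phi> x) x)"
proof -
  let ?V = "fun_space.span S"
  define B where "B = (SOME B. fun_space.independent B \<and> fun_space.span B = ?V)"
  have "\<exists>B. fun_space.independent B \<and> fun_space.span B = ?V"
    by (metis fun_space.maximal_independent_subset fun_space.span_eq fun_space.span_span
        fun_space.span_mono subset_antisym fun_space.span_base subsetI)
  hence "fun_space.independent B \<and> fun_space.span B = ?V"
    unfolding B_def by (rule someI_ex)
  hence B: "fun_space.independent B" and spB: "fun_space.span B = ?V" by auto
  have finB: "finite B"
    using fun_space.independent_span_bound[OF S B] spB fun_space.span_base by blast
  let ?r = "fun_space.representation B"
  have sym: "P x y = P y x" for x y using P unfolding proj_kernel_def by blast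
  have PV: "P x \<in> fun_space.span B" for x using P unfolding proj_kernel_def spB by blast
  have rep: "?r v b = (\<Sum>y\<in>X. v y * ?r (P y) b)" if v: "v \<in> ?V" for v b
  proof -
    have "v = (\<Sum>y\<in>X. (\<lambda>x. v y * P y x))"
      using P v unfolding proj_kernel_def sum_fun_eq by (auto simp: fun_eq_iff sym mult.commute)
    hence "?r v b = ?r (\<Sum>y\<in>X. (\<lambda>x. v y * P y x)) b" by simp
    also have "\<dots> = (\<Sum>y\<in>X. v y * ?r (P y) b)"
      by (simp add: fun_space.representation_sum[OF B] fun_space.span_scale PV
          fun_space.representation_scale[OF B])
    finally show ?thesis .
  qed
  have "trace_on ?V (\<lambda>v x. v (\<phi> x)) = (\<Sum>b\<in>B. ?r (\<lambda>x. b (\<phi> x)) b)"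
    by (simp add: trace_on_def B_def Let_def)
  also have "\<dots> = (\<Sum>b\<in>B. \<Sum>y\<in>X. b (\<phi> y) * ?r (P y) b)"
    by (intro sum.cong refl rep T) (use spB fun_space.span_base in blast)
  also have "\<dots> = (\<Sum>y\<in>X. \<Sum>b\<in>B. ?r (P y) b * b (\<phi> y))"
    by (subst sum.swap) (simp add: mult.commute)
  also have "\<dots> = (\<Sum>y\<in>X. P y (\<phi> y))"
  proof (intro sum.cong refl)
    fix y
    have "(\<Sum>b\<in>B. (\<lambda>x. ?r (P y) b * b x)) = P y"
      by (rule fun_space.sum_representation_eq[OF B PV finB]) auto
    from fun_cong[OF this, of "\<phi> y"]
    show "(\<Sum>b\<in>B. ?r (P y) b * b (\<phi> y)) = P y (\<phi> y)"
      by (simp add: sum_fun_eq)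
  qed
  finally show ?thesis by (simp add: sym)
qed


section \<open>Averaging over a finite permutation group\<close>

locale perm_group =
  fixes G :: "(nat \<Rightarrow> nat) set"
  assumes finite_G: "finite G" and id_G: "id \<in> G"
    and comp_G: "s \<in> G \<Longrightarrow> t \<in> G \<Longrightarrow> s \<circ> t \<in> G"
    and inv_G: "s \<in> G \<Longrightarrow> inv s \<in> G" and bij_G: "s \<in> G \<Longrightarrow> bij s"
begin

lemma card_G: "card G > 0"
  using finite_G id_G by (auto simp: card_gt_0_iff)

lemma left_mult_bij: "s \<in> G \<Longrightarrow> bij_betw (\<lambda>t. s \<circ> t) G G"
  by (rule bij_betw_byWitness[where f' = "\<lambda>t. inv s \<circ> t"])
     (use bij_G in \<open>auto simp: comp_G inv_G o_assoc[symmetric] fun_eq_iff bij_is_inj bij_is_surj surj_f_inv_f\<close>)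

lemma right_mult_bij: "s \<in> G \<Longrightarrow> bij_betw (\<lambda>t. t \<circ> s) G G"
  by (rule bij_betw_byWitness[where f' = "\<lambda>t. t \<circ> inv s"])
     (use bij_G in \<open>auto simp: comp_G inv_G o_assoc[symmetric] fun_eq_iff bij_is_inj bij_is_surj surj_f_inv_f\<close>)

lemma inv_bij: "bij_betw inv G G"
  by (rule bij_betw_byWitness[where f' = inv]) (auto simp: inv_G inv_inv_eq bij_G)

end

lemma perm_group_permutes: "finite A \<Longrightarrow> perm_group {s. s permutes A}"
  by unfold_locales
     (auto simp: permutes_id permutes_compose permutes_inv permutes_bij finite_permutations)

text \<open>\<open>P\<close> is the matrix of an invariant orthogonal projection of a permutation module, so \<open>chr\<close> is the
  character of its range, \<open>avg\<close> projects onto the invariants of the range, and \<open>mult\<close>, the trace of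
  \<open>avg\<close>, is their dimension.\<close>

locale perm_rep = perm_group +
  fixes act :: "(nat \<Rightarrow> nat) \<Rightarrow> 'z \<Rightarrow> 'z" and Z :: "'z set" and P :: "'z \<Rightarrow> 'z \<Rightarrow> real"
  assumes finite_Z: "finite Z"
    and act_in: "s \<in> G \<Longrightarrow> z \<in> Z \<Longrightarrow> act s z \<in> Z"
    and act_comp: "s \<in> G \<Longrightarrow> t \<in> G \<Longrightarrow> z \<in> Z \<Longrightarrow> act (s \<circ> t) z = act t (act s z)"
    and act_id: "z \<in> Z \<Longrightarrow> act id z = z"
    and P_sym: "z \<in> Z \<Longrightarrow> w \<in> Z \<Longrightarrow> P z w = P w z"
    and P_idem: "z \<in> Z \<Longrightarrow> w \<in> Z \<Longrightarrow> (\<Sum>y\<in>Z. P z y * P y w) = P z w"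
    and P_inv: "s \<in> G \<Longrightarrow> z \<in> Z \<Longrightarrow> w \<in> Z \<Longrightarrow> P (act s z) (act s w) = P z w"
begin

definition chr :: "(nat \<Rightarrow> nat) \<Rightarrow> real" where
  "chr s = (\<Sum>z\<in>Z. P (act s z) z)"

definition avg :: "'z \<Rightarrow> 'z \<Rightarrow> real" where
  "avg z w = (\<Sum>s\<in>G. P (act s z) w) / card G"

definition mult :: real where
  "mult = (\<Sum>s\<in>G. chr s) / card G"

lemma act_inv: "s \<in> G \<Longrightarrow> z \<in> Z \<Longrightarrow> act (inv s) (act s z) = z" "s \<in> G \<Longrightarrow> z \<in> Z \<Longrightarrow> act s (act (inv s) z) = z"
proof -
  assume s: "s \<in> G" and z: "z \<in> Z"
  have "inv s \<circ> s = id" "s \<circ> inv s = id"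
    using bij_G[OF s] by (auto simp: fun_eq_iff bij_is_inj bij_is_surj surj_f_inv_f)
  thus "act (inv s) (act s z) = z" "act s (act (inv s) z) = z"
    using act_comp[OF s inv_G[OF s] z] act_comp[OF inv_G[OF s] s z] act_id[OF z] by auto
qed

lemma act_bij: "s \<in> G \<Longrightarrow> bij_betw (act s) Z Z"
  by (rule bij_betw_byWitness[where f' = "act (inv s)"]) (auto simp: act_inv act_in inv_G)

lemma P_shift: "s \<in> G \<Longrightarrow> z \<in> Z \<Longrightarrow> w \<in> Z \<Longrightarrow> P (act s z) w = P z (act (inv s) w)"
  using P_inv[of s z "act (inv s) w"] by (simp add: act_inv act_in inv_G)

lemma avg_sym: assumes "z \<in> Z" "w \<in> Z" shows "avg z w = avg w z"
proof -
  have "(\<Sum>s\<in>G. P (act s z) w) = (\<Sum>s\<in>G. P (act (inv s) w) z)"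
    using assms by (intro sum.cong refl) (simp add: P_shift, simp add: P_sym act_in inv_G)
  also have "\<dots> = (\<Sum>s\<in>G. P (act s w) z)" by (rule sum.reindex_bij_betw[OF inv_bij])
  finally show ?thesis by (simp add: avg_def)
qed

lemma avg_act: assumes "z \<in> Z" "w \<in> Z" "s \<in> G" shows "avg (act s z) w = avg z w"
proof -
  have "(\<Sum>t\<in>G. P (act t (act s z)) w) = (\<Sum>t\<in>G. P (act (s \<circ> t) z) w)"
    using assms by (simp add: act_comp)
  also have "\<dots> = (\<Sum>t\<in>G. P (act t z) w)"
    by (rule sum.reindex_bij_betw[OF left_mult_bij[OF assms(3)]])
  finally show ?thesis by (simp add: avg_def)
qed

lemma avg_fix:
  assumes K: "\<And>z. z \<in> Z \<Longrightarrow> (\<Sum>w\<in>Z. P z w * K w) = K z"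
    and inv: "\<And>s z. s \<in> G \<Longrightarrow> z \<in> Z \<Longrightarrow> K (act s z) = K z" and z: "z \<in> Z"
  shows "(\<Sum>w\<in>Z. avg z w * K w) = K z"
proof -
  have "(\<Sum>w\<in>Z. avg z w * K w) = (\<Sum>s\<in>G. \<Sum>w\<in>Z. P (act s z) w * K w) / card G"
    by (simp add: avg_def sum_divide_distrib sum_distrib_right, subst sum.swap) simp
  also have "\<dots> = K z" using card_G by (simp add: K act_in inv z)
  finally show ?thesis .
qed

lemma P_avg: assumes "z \<in> Z" "w \<in> Z" shows "(\<Sum>y\<in>Z. P z y * avg y w) = avg z w"
proof -
  have "(\<Sum>y\<in>Z. P z y * avg y w) = (\<Sum>y\<in>Z. P z y * avg w y)"
    using assms by (intro sum.cong) (auto simp: avg_sym)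
  also have "\<dots> = (\<Sum>s\<in>G. \<Sum>y\<in>Z. P (act s w) y * P y z) / card G"
    using assms
    by (simp add: avg_def sum_divide_distrib sum_distrib_left, subst sum.swap)
       (auto intro!: sum.cong simp: P_sym)
  also have "\<dots> = avg w z" using assms by (simp add: P_idem act_in avg_def)
  finally show ?thesis using assms avg_sym by simp
qed

text \<open>Each column of \<open>avg\<close> is an invariant vector in the range of P, and
  \<open>avg\<close> fixes such vectors.\<close>

lemma avg_idem: assumes "z \<in> Z" "w \<in> Z" shows "(\<Sum>y\<in>Z. avg z y * avg y w) = avg z w"
  by (rule avg_fix) (use assms in \<open>auto simp: P_avg avg_act\<close>)

lemma mult_eq: "mult = (\<Sum>z\<in>Z. avg z z)"
  by (simp add: mult_def avg_def chr_def sum_divide_distrib, subst sum.swap) simp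

text \<open>The trace of a symmetric idempotent matrix is its squared Hilbert-Schmidt norm. All
  nonnegativity of multiplicities rests on this.\<close>

lemma mult_eq_sum_squares: "mult = (\<Sum>z\<in>Z. \<Sum>w\<in>Z. (avg z w)\<^sup>2)"
  unfolding mult_eq power2_eq_square
  by (intro sum.cong refl, subst avg_idem[symmetric]) (auto intro!: sum.cong simp: avg_sym)

lemma mult_nonneg: "mult \<ge> 0"
  unfolding mult_eq_sum_squares by (intro sum_nonneg) auto

text \<open>A nonzero invariant vector K of the range is fixed by \<open>avg\<close>, and by
  Cauchy-Schwarz a matrix with a nonzero fixed vector has Hilbert-Schmidt norm at least 1.\<close>

lemma mult_ge_1:
  assumes K: "\<And>z. z \<in> Z \<Longrightarrow> (\<Sum>w\<in>Z. P z w * K w) = K z"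
    and inv: "\<And>s z. s \<in> G \<Longrightarrow> z \<in> Z \<Longrightarrow> K (act s z) = K z" and z: "z \<in> Z" "K z \<noteq> 0"
  shows "mult \<ge> 1"
proof -
  define N where "N = (\<Sum>w\<in>Z. (K w)\<^sup>2)"
  have N: "N > 0" unfolding N_def using z finite_Z by (intro sum_pos2[of _ z]) auto
  have "N = (\<Sum>z\<in>Z. (\<Sum>w\<in>Z. avg z w * K w)\<^sup>2)"
    unfolding N_def by (intro sum.cong refl) (simp add: avg_fix[of K] K inv)
  also have "\<dots> \<le> (\<Sum>z\<in>Z. (\<Sum>w\<in>Z. (avg z w)\<^sup>2) * N)"
    unfolding N_def by (intro sum_mono Cauchy_Schwarz_ineq_sum)
  also have "\<dots> = mult * N" by (simp add: mult_eq_sum_squares sum_distrib_right)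
  finally show ?thesis using N by (simp add: mult.commute)
qed

lemma mult_eq_0:
  assumes "\<And>K. (\<And>z. z \<in> Z \<Longrightarrow> (\<Sum>w\<in>Z. P z w * K w) = K z) \<Longrightarrow>
     (\<And>s z. s \<in> G \<Longrightarrow> z \<in> Z \<Longrightarrow> K (act s z) = K z) \<Longrightarrow> (\<forall>z\<in>Z. K z = 0)"
  shows "mult = 0"
proof -
  have "avg z w = 0" if "z \<in> Z" "w \<in> Z" for z w
    using assms[of "\<lambda>z. avg z w"] that by (auto simp: P_avg avg_act)
  thus ?thesis by (simp add: mult_eq)
qed

text \<open>The columns of \<open>avg\<close> are invariant vectors of the range, hence multiples of
  L, so \<open>avg\<close> has rank at most one. The trace of its square is then the square of its
  trace, which leaves only the values 0 and 1.\<close>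

lemma mult_le_1:
  assumes "\<And>K. (\<And>z. z \<in> Z \<Longrightarrow> (\<Sum>w\<in>Z. P z w * K w) = K z) \<Longrightarrow>
     (\<And>s z. s \<in> G \<Longrightarrow> z \<in> Z \<Longrightarrow> K (act s z) = K z) \<Longrightarrow> \<exists>c. \<forall>z\<in>Z. K z = c * L z"
  shows "mult \<le> 1"
proof -
  have "\<exists>c. \<forall>z\<in>Z. avg z w = c * L z" if "w \<in> Z" for w
    using assms[of "\<lambda>z. avg z w"] that by (auto simp: P_avg avg_act)
  then obtain c where c: "\<And>z w. z \<in> Z \<Longrightarrow> w \<in> Z \<Longrightarrow> avg z w = c w * L z" by metis
  define m where "m = mult"
  have m: "m = (\<Sum>z\<in>Z. c z * L z)" by (simp add: m_def mult_eq c)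
  have "m = (\<Sum>z\<in>Z. \<Sum>w\<in>Z. avg z w * avg w z)"
    unfolding m_def mult_eq by (simp add: avg_idem)
  also have "\<dots> = (\<Sum>z\<in>Z. \<Sum>w\<in>Z. (c z * L z) * (c w * L w))"
    by (intro sum.cong refl) (simp add: c mult_ac)
  also have "\<dots> = m * m" by (simp add: m sum_product)
  finally have "m = 0 \<or> m = 1" by auto
  thus ?thesis by (auto simp: m_def)
qed

end

text \<open>The tensor product with the diagonal action. It turns averages of products of characters
  into multiplicities.\<close>

lemma perm_rep_prod:
  assumes "perm_rep G a X P" "perm_rep G b Y R"
  shows "perm_rep G (\<lambda>s (x, y). (a s x, b s y)) (X \<times> Y) (\<lambda>(x, y) (x', y'). P x x' * R y y')"
proof -
  interpret A: perm_rep G a X P by fact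
  interpret B: perm_rep G b Y R by fact
  show ?thesis
  proof
    fix z w assume "z \<in> X \<times> Y" "w \<in> X \<times> Y"
    then obtain x y x' y' where [simp]: "z = (x, y)" "w = (x', y')" and *: "x \<in> X" "y \<in> Y" "x' \<in> X" "y' \<in> Y"
      by auto
    have "(\<Sum>(v, u)\<in>X \<times> Y. (P x v * R y u) * (P v x' * R u y'))
        = (\<Sum>v\<in>X. P x v * P v x') * (\<Sum>u\<in>Y. R y u * R u y')"
      unfolding sum_product sum.cartesian_product[symmetric] by (simp add: mult_ac)
    also have "\<dots> = P x x' * R y y'" using * by (simp add: A.P_idem B.P_idem)
    finally show "(\<Sum>v\<in>X \<times> Y. (case z of (x, y) \<Rightarrow> \<lambda>(x', y'). P x x' * R y y') v *
           (case v of (x, y) \<Rightarrow> \<lambda>(x', y'). P x x' * R y y') w) =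
         (case z of (x, y) \<Rightarrow> \<lambda>(x', y'). P x x' * R y y') w"
      by (simp add: case_prod_unfold)
  qed (auto simp: A.finite_Z B.finite_Z A.act_in B.act_in A.act_comp B.act_comp A.act_id B.act_id
      A.P_sym B.P_sym A.P_inv B.P_inv)
qed

lemma chr_prod:
  assumes "perm_rep G a X P" "perm_rep G b Y R"
  shows "perm_rep.chr (\<lambda>s (x, y). (a s x, b s y)) (X \<times> Y) (\<lambda>(x, y) (x', y'). P x x' * R y y') s
    = perm_rep.chr a X P s * perm_rep.chr b Y R s"
  unfolding perm_rep.chr_def[OF assms(1)] perm_rep.chr_def[OF assms(2)]
      perm_rep.chr_def[OF perm_rep_prod[OF assms]] sum_product sum.cartesian_product
  by (simp add: case_prod_unfold)

section \<open>Specht modules as ranges of projections\<close>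

abbreviation Sym :: "nat \<Rightarrow> (nat \<Rightarrow> nat) set" where
  "Sym n \<equiv> {s. s permutes {..<n}}"

text \<open>The row functions of shape \<open>lam\<close>, described by the number of entries in each row so that invariance
  under permutations and orbit counts need no tableaux.\<close>

definition tabloids :: "nat list \<Rightarrow> (nat \<Rightarrow> nat) set" where
  "tabloids lam = {r. (\<forall>x\<ge>sum_list lam. r x = 0) \<and>
     image_mset r (mset_set {..<sum_list lam}) = image_mset fst (mset_set (cells lam))}"

lemma finite_cells [simp]: "finite (cells lam)"
proof (rule finite_subset)
  show "cells lam \<subseteq> (SIGMA i:{..<length lam}. {..<lam ! i})" by (auto simp: cells_def)
qed auto

lemma card_cells_rows: "card {c \<in> cells lam. fst c < k} = sum_list (take k lam)"
proof -
  have "{c \<in> cells lam. fst c < k} = (SIGMA i:{..<min k (length lam)}. {..<lam ! i})"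
    by (auto simp: cells_def)
  hence "card {c \<in> cells lam. fst c < k} = (\<Sum>i<min k (length lam). lam ! i)" by simp
  also have "\<dots> = sum_list (take k lam)"
    by (auto simp: sum_list_sum_nth min.commute lessThan_atLeast0 intro!: sum.cong)
  finally show ?thesis .
qed

lemma card_cells [simp]: "card (cells lam) = sum_list lam"
proof -
  have "{c \<in> cells lam. fst c < length lam} = cells lam" by (auto simp: cells_def)
  with card_cells_rows[of lam "length lam"] show ?thesis by simp
qed

lemma finite_tabloids [simp]: "finite (tabloids lam)"
proof (rule finite_subset)
  let ?n = "sum_list lam"
  have "r x \<in> fst ` cells lam" if "r \<in> tabloids lam" "x < ?n" for r x
  proof -
    have eq: "image_mset r (mset_set {..<?n}) = image_mset fst (mset_set (cells lam))"
      using that by (simp add: tabloids_def)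
    have "r x \<in># image_mset r (mset_set {..<?n})" using that by simp
    thus ?thesis unfolding eq by simp
  qed
  thus "tabloids lam \<subseteq> {f. \<forall>x. (x \<in> {..<?n} \<longrightarrow> f x \<in> fst ` cells lam) \<and> (x \<notin> {..<?n} \<longrightarrow> f x = 0)}"
    by (auto simp: tabloids_def)
  show "finite {f. \<forall>x. (x \<in> {..<?n} \<longrightarrow> f x \<in> fst ` cells lam) \<and> (x \<notin> {..<?n} \<longrightarrow> f x = 0)}"
    by (rule finite_set_of_finite_funs) auto
qed

lemma image_mset_permutes:
  assumes "s permutes A"
  shows "image_mset (f \<circ> s) (mset_set A) = image_mset f (mset_set A)"
proof -
  have "image_mset s (mset_set A) = mset_set A"
    using assms image_mset_mset_set[of s A] by (simp add: permutes_inj_on permutes_image)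
  thus ?thesis by (simp flip: multiset.map_comp)
qed

lemma tabloids_comp: "r \<in> tabloids lam \<Longrightarrow> s permutes {..<sum_list lam} \<Longrightarrow> r \<circ> s \<in> tabloids lam"
  unfolding tabloids_def by (auto simp: image_mset_permutes permutes_not_in)

lemma card_tabloid_rows:
  assumes "r \<in> tabloids lam"
  shows "card {x. x < sum_list lam \<and> r x < k} = sum_list (take k lam)"
proof -
  have "card {x. x < sum_list lam \<and> r x < k}
      = size (filter_mset (\<lambda>i. i < k) (image_mset r (mset_set {..<sum_list lam})))"
    by (simp add: filter_mset_image_mset)
  also have "\<dots> = size (filter_mset (\<lambda>i. i < k) (image_mset fst (mset_set (cells lam))))"
    using assms by (simp add: tabloids_def)
  also have "\<dots> = card {c \<in> cells lam. fst c < k}" by (simp add: filter_mset_image_mset)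
  finally show ?thesis by (simp add: card_cells_rows)
qed

section \<open>Tableaux, column stabilizers and polytabloids\<close>

locale tableau =
  fixes lam :: "nat list" and t :: "nat \<times> nat \<Rightarrow> nat"
  assumes tab: "is_tableau lam t"
begin

abbreviation "n \<equiv> sum_list lam"

abbreviation "pos \<equiv> inv_into (cells lam) t"

definition col :: "nat \<Rightarrow> nat" where
  "col a = snd (pos a)"

lemma bij_t: "bij_betw t (cells lam) {..<n}"
  using tab by (simp add: is_tableau_def)

lemma bij_pos: "bij_betw pos {..<n} (cells lam)"
  by (rule bij_betw_inv_into[OF bij_t])

lemma pos_t: "c \<in> cells lam \<Longrightarrow> pos (t c) = c"
  using bij_t by (simp add: bij_betw_def)

lemma t_pos: "a < n \<Longrightarrow> t (pos a) = a"
  using bij_t by (simp add: bij_betw_inv_into_right)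

lemma pos_in: "a < n \<Longrightarrow> pos a \<in> cells lam"
  using bij_pos by (auto simp: bij_betw_def)

lemma t_less: "c \<in> cells lam \<Longrightarrow> t c < n"
  using bij_t by (auto simp: bij_betw_def)

lemma col_stab_eq: "col_stab lam t = {p. p permutes {..<n} \<and> (\<forall>a<n. col (p a) = col a)}"
proof (intro equalityI subsetI)
  fix p assume p: "p \<in> col_stab lam t"
  have "col (p a) = col a" if a: "a < n" for a
  proof -
    obtain i j where ij: "pos a = (i, j)" by force
    with pos_in[OF a] p obtain i' where "(i', j) \<in> cells lam" "p (t (i, j)) = t (i', j)"
      by (auto simp: col_stab_def)
    with ij t_pos[OF a] show ?thesis by (simp add: col_def pos_t)
  qed
  thus "p \<in> {p. p permutes {..<n} \<and> (\<forall>a<n. col (p a) = col a)}" using p by (auto simp: col_stab_def)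
next
  fix p assume p: "p \<in> {p. p permutes {..<n} \<and> (\<forall>a<n. col (p a) = col a)}"
  have "\<exists>i'. (i', j) \<in> cells lam \<and> p (t (i, j)) = t (i', j)" if "(i, j) \<in> cells lam" for i j
  proof -
    have lt: "t (i, j) < n" using that t_less by auto
    hence lt': "p (t (i, j)) < n" using p permutes_in_image[of p "{..<n}" "t (i, j)"] by simp
    have "snd (pos (p (t (i, j)))) = j" using p lt that by (simp add: col_def pos_t)
    thus ?thesis using pos_in[OF lt'] t_pos[OF lt'] by (metis prod.collapse)
  qed
  thus "p \<in> col_stab lam t" using p by (auto simp: col_stab_def)
qed

lemma perm_group_col_stab: "perm_group (col_stab lam t)"
proof
  show "finite (col_stab lam t)"
    by (rule finite_subset[OF _ finite_permutations[of "{..<n}"]]) (auto simp: col_stab_def)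
  fix s assume s: "s \<in> col_stab lam t"
  have "col (inv s a) = col a" if "a < n" for a
  proof -
    have "inv s a < n" using s that permutes_in_image[OF permutes_inv, of s "{..<n}" a]
      by (auto simp: col_stab_eq)
    hence "col (s (inv s a)) = col (inv s a)" using s by (auto simp: col_stab_eq)
    moreover have "s (inv s a) = a" using s by (auto simp: col_stab_eq permutes_inverses)
    ultimately show ?thesis by simp
  qed
  thus "inv s \<in> col_stab lam t" using s by (auto simp: col_stab_eq permutes_inv)
  show "bij s" using s by (auto simp: col_stab_eq permutes_bij)
  fix u assume u: "u \<in> col_stab lam t"
  have "u a < n" if "a < n" for a
    using u that permutes_in_image[of u "{..<n}" a] by (auto simp: col_stab_eq)
  thus "s \<circ> u \<in> col_stab lam t"
    using s u by (auto simp: col_stab_eq permutes_compose)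
qed (auto simp: col_stab_eq permutes_id)

lemma col_stab_permutes: "p \<in> col_stab lam t \<Longrightarrow> p permutes {..<n}"
  by (simp add: col_stab_def)

lemma tableau_comp: assumes "s permutes {..<n}" shows "tableau lam (s \<circ> t)"
  using assms bij_betw_trans[OF bij_t permutes_imp_bij]
  by unfold_locales (simp add: is_tableau_def)

lemma pos_comp: assumes "s permutes {..<n}" "a < n"
  shows "inv_into (cells lam) (s \<circ> t) a = pos (inv s a)"
proof -
  interpret T: tableau lam "s \<circ> t" by (rule tableau_comp) fact
  have *: "inv s a < n" using assms permutes_in_image[OF permutes_inv, of s "{..<n}" a] by simp
  have "(s \<circ> t) (pos (inv s a)) = a" using t_pos[OF *] assms by (simp add: permutes_inverses)
  thus ?thesis using T.pos_t[OF pos_in[OF *]] by simp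
qed

lemma tabloid_comp: assumes "s permutes {..<n}"
  shows "tabloid lam (s \<circ> t) = tabloid lam t \<circ> inv s"
proof
  fix x
  have "inv s x < n \<longleftrightarrow> x < n"
    using permutes_in_image[OF permutes_inv[OF assms], of x] by simp
  thus "tabloid lam (s \<circ> t) x = (tabloid lam t \<circ> inv s) x"
    using pos_comp[OF assms] by (simp add: tabloid_def)
qed

lemma tabloid_in: "tabloid lam t \<in> tabloids lam"
proof -
  have "image_mset (tabloid lam t) (mset_set {..<n}) = image_mset (fst \<circ> pos) (mset_set {..<n})"
    by (rule image_mset_cong) (auto simp: tabloid_def)
  also have "\<dots> = image_mset fst (image_mset pos (mset_set {..<n}))"
    by (simp add: multiset.map_comp)
  also have "image_mset pos (mset_set {..<n}) = mset_set (cells lam)"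
    using bij_pos by (simp add: bij_betw_def image_mset_mset_set)
  finally show ?thesis by (simp add: tabloids_def tabloid_def)
qed

text \<open>The signed column sum of James, acting on functions of tabloids; applied to the
  indicator of \<open>tabloid lam t\<close> it gives the polytabloid.\<close>

definition antisym :: "((nat \<Rightarrow> nat) \<Rightarrow> real) \<Rightarrow> (nat \<Rightarrow> nat) \<Rightarrow> real" where
  "antisym f x = (\<Sum>p\<in>col_stab lam t. of_int (sign p) * f (x \<circ> p))"

lemma tabloid_comp_eq_iff: assumes "p permutes {..<n}"
  shows "tabloid lam (p \<circ> t) = r \<longleftrightarrow> r \<circ> p = tabloid lam t"
proof -
  have "inv p \<circ> p = id" "p \<circ> inv p = id" using assms by (auto simp: permutes_inv_o)
  thus ?thesis unfolding tabloid_comp[OF assms] by (metis comp_id o_assoc)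
qed

lemma polytabloid_eq_antisym:
  "polytabloid lam t r = antisym (\<lambda>x. if x = tabloid lam t then 1 else 0) r"
  unfolding polytabloid_def antisym_def
  by (intro sum.cong refl) (use tabloid_comp_eq_iff col_stab_permutes in auto)

lemma polytabloid_supp: assumes "r \<notin> tabloids lam" shows "polytabloid lam t r = 0"
proof -
  have "r \<circ> p \<noteq> tabloid lam t" if "p \<in> col_stab lam t" for p
  proof
    assume "r \<circ> p = tabloid lam t"
    hence "tabloid lam (p \<circ> t) = r" using tabloid_comp_eq_iff col_stab_permutes that by blast
    moreover have "tabloid lam (p \<circ> t) \<in> tabloids lam"
      using tableau.tabloid_in tableau_comp col_stab_permutes that by blast
    ultimately show False using assms by simp
  qed
  thus ?thesis by (simp add: polytabloid_eq_antisym antisym_def)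
qed

lemma antisym_shift:
  assumes q: "q \<in> col_stab lam t"
  shows "antisym f (x \<circ> q) = of_int (sign q) * antisym f x"
proof -
  interpret C: perm_group "col_stab lam t" by (rule perm_group_col_stab)
  have perm: "permutation p" if "p \<in> col_stab lam t" for p
    using col_stab_permutes[OF that] permutes_imp_permutation by blast
  have "antisym f x = (\<Sum>p\<in>col_stab lam t. of_int (sign (q \<circ> p)) * f (x \<circ> (q \<circ> p)))"
    unfolding antisym_def by (rule sum.reindex_bij_betw[OF C.left_mult_bij[OF q], symmetric])
  also have "\<dots> = (\<Sum>p\<in>col_stab lam t. of_int (sign q) * (of_int (sign p) * f (x \<circ> q \<circ> p)))"
    by (intro sum.cong refl) (simp add: sign_compose perm q o_assoc)
  also have "\<dots> = of_int (sign q) * antisym f (x \<circ> q)"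
    by (simp add: antisym_def sum_distrib_left)
  finally show ?thesis by (cases q rule: sign_cases) auto
qed

text \<open>The transposition of a and b is an odd element of the column stabilizer that fixes
  x.\<close>

lemma antisym_eq_0:
  assumes "a < n" "b < n" "a \<noteq> b" "col a = col b" "x a = x b"
  shows "antisym f x = 0"
proof -
  define \<tau> where "\<tau> = Transposition.transpose a b"
  have \<tau>: "\<tau> \<in> col_stab lam t"
    using assms by (auto simp: col_stab_eq \<tau>_def permutes_swap_id Transposition.transpose_def)
  have "x \<circ> \<tau> = x" using assms by (auto simp: \<tau>_def Transposition.transpose_def fun_eq_iff)
  hence "antisym f x = of_int (sign \<tau>) * antisym f x" using antisym_shift[OF \<tau>, of f x] by simp
  moreover have "sign \<tau> = -1" using assms by (simp add: \<tau>_def sign_swap_id)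
  ultimately show ?thesis by simp
qed

text \<open>Row and column determine a cell, so only the identity preserves both the columns and the
  tabloid of t. In particular polytabloids are nonzero.\<close>

lemma polytabloid_tabloid: "polytabloid lam t (tabloid lam t) = 1"
proof -
  have "p = id" if p: "p \<in> col_stab lam t" and eq: "tabloid lam t \<circ> p = tabloid lam t" for p
  proof
    fix a
    show "p a = id a"
    proof (cases "a < n")
      case True
      hence pa: "p a < n" using col_stab_permutes[OF p] permutes_in_image[of p "{..<n}" a] by auto
      have "fst (pos (p a)) = fst (pos a)"
        using fun_cong[OF eq, of a] True pa by (simp add: tabloid_def)
      moreover have "snd (pos (p a)) = snd (pos a)" using p True by (simp add: col_stab_eq col_def)
      ultimately have "pos (p a) = pos a" by (simp add: prod_eq_iff)
      thus ?thesis using t_pos True pa by (metis id_apply)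
    next
      case False
      thus ?thesis using col_stab_permutes[OF p] by (simp add: permutes_not_in)
    qed
  qed
  hence "polytabloid lam t (tabloid lam t) = (\<Sum>p\<in>col_stab lam t. if p = id then 1 else 0)"
    unfolding polytabloid_eq_antisym antisym_def
    by (intro sum.cong refl) (auto simp: sign_id)
  also have "\<dots> = 1"
    using perm_group_col_stab by (simp add: perm_group_def sum.delta)
  finally show ?thesis .
qed

end

lemma exists_tableau: "\<exists>t. tableau lam t"
proof -
  obtain t where "bij_betw t (cells lam) {..<sum_list lam}"
    using finite_same_card_bij[of "cells lam" "{..<sum_list lam}"] by auto
  hence "tableau lam t" by unfold_locales (simp add: is_tableau_def)
  thus ?thesis by (intro exI)
qed

lemma col_stab_comp:
  assumes "tableau lam t" "s permutes {..<sum_list lam}"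
  shows "bij_betw (\<lambda>p. s \<circ> p \<circ> inv s) (col_stab lam t) (col_stab lam (s \<circ> t))"
proof -
  have *: "s' \<circ> p \<circ> inv s' \<in> col_stab lam (s' \<circ> t')"
    if T: "tableau lam t'" and s': "s' permutes {..<sum_list lam}" and p: "p \<in> col_stab lam t'" for p s' t'
  proof -
    interpret tableau lam t' by fact
    interpret T: tableau lam "s' \<circ> t'" by (rule tableau_comp) fact
    have lt: "u a < n \<longleftrightarrow> a < n" if "u permutes {..<n}" for u a
      using permutes_in_image[OF that, of a] by simp
    have c: "T.col a = col (inv s' a)" if "a < n" for a
      using pos_comp[OF s' that] by (simp add: T.col_def col_def)
    show ?thesis
      using p s' lt[OF s'] lt[OF permutes_inv[OF s']] lt[of p]
      by (auto simp: T.col_stab_eq col_stab_eq c permutes_inverses permutes_compose permutes_inv)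
  qed
  interpret tableau lam t by fact
  have i: "inv s permutes {..<n}" "inv (inv s) = s"
    using assms(2) by (auto simp: permutes_inv permutes_inv_inv)
  have s: "inv s \<circ> s = id" "s \<circ> inv s = id" using assms by (auto simp: permutes_inv_o)
  have "inv s \<circ> (s \<circ> t) = t" using s by (simp add: o_assoc)
  with *[OF tableau_comp[OF assms(2)] i(1)] i(2)
  have **: "inv s \<circ> p \<circ> s \<in> col_stab lam t" if "p \<in> col_stab lam (s \<circ> t)" for p
    using that by simp
  show ?thesis
  proof (rule bij_betw_byWitness[where f' = "\<lambda>p. inv s \<circ> p \<circ> s"])
    have "inv s \<circ> (s \<circ> p \<circ> inv s) \<circ> s = p" "s \<circ> (inv s \<circ> p \<circ> s) \<circ> inv s = p" for p
      using s by (metis comp_id id_comp o_assoc)+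
    thus "\<forall>p\<in>col_stab lam t. inv s \<circ> (s \<circ> p \<circ> inv s) \<circ> s = p"
      "\<forall>p\<in>col_stab lam (s \<circ> t). s \<circ> (inv s \<circ> p \<circ> s) \<circ> inv s = p" by auto
  qed (use * ** assms in auto)
qed

lemma sign_conj:
  assumes "s permutes {..<n}" "p permutes {..<n :: nat}"
  shows "sign (s \<circ> p \<circ> inv s) = sign p"
proof -
  have "permutation s" "permutation p" "permutation (inv s)"
    using assms permutes_imp_permutation permutes_inv by blast+
  thus ?thesis
    by (simp add: sign_compose permutation_compose sign_inverse sign_idempotent mult.commute mult.left_commute)
qed

lemma perm_act_polytabloid:
  assumes "tableau lam t" "s permutes {..<sum_list lam}"
  shows "perm_act s (polytabloid lam t) = polytabloid lam (s \<circ> t)"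
proof
  fix r
  interpret tableau lam t by fact
  have s: "inv s \<circ> s = id" "s \<circ> inv s = id" using assms by (auto simp: permutes_inv_o)
  have "polytabloid lam (s \<circ> t) r = (\<Sum>p\<in>col_stab lam t.
     if tabloid lam (s \<circ> p \<circ> inv s \<circ> (s \<circ> t)) = r then of_int (sign (s \<circ> p \<circ> inv s)) else 0)"
    unfolding polytabloid_def by (rule sum.reindex_bij_betw[OF col_stab_comp[OF assms], symmetric])
  also have "\<dots> = (\<Sum>p\<in>col_stab lam t. if tabloid lam (p \<circ> t) = r \<circ> s then of_int (sign p) else 0)"
  proof (rule sum.cong[OF refl])
    fix p assume p: "p \<in> col_stab lam t"
    have "s \<circ> p \<circ> inv s \<circ> (s \<circ> t) = s \<circ> (p \<circ> t)" using s by (metis comp_id o_assoc)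
    moreover have "tabloid lam (s \<circ> (p \<circ> t)) = tabloid lam (p \<circ> t) \<circ> inv s"
      using tableau.tabloid_comp[OF tableau_comp[OF col_stab_permutes[OF p]] assms(2)] .
    moreover have "tabloid lam (p \<circ> t) \<circ> inv s = r \<longleftrightarrow> tabloid lam (p \<circ> t) = r \<circ> s"
      using s by (metis comp_id o_assoc)
    ultimately show "(if tabloid lam (s \<circ> p \<circ> inv s \<circ> (s \<circ> t)) = r
        then of_int (sign (s \<circ> p \<circ> inv s)) else 0 :: real) =
      (if tabloid lam (p \<circ> t) = r \<circ> s then of_int (sign p) else 0)"
      using sign_conj[OF assms(2) col_stab_permutes[OF p]] by simp
  qed
  finally show "perm_act s (polytabloid lam t) r = polytabloid lam (s \<circ> t) r"
    by (simp add: perm_act_def polytabloid_def)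
qed

section \<open>The Specht module and its invariant projection\<close>

lemma specht_eq: "specht lam = fun_space.span {polytabloid lam t | t. tableau lam t}"
  by (simp add: specht_def tableau_def)

text \<open>There are infinitely many tableaux, because t is arbitrary outside the cells. The
  polytabloid depends only on the column stabilizer and the tabloid, and these range over finite
  sets.\<close>

lemma finite_polytabloids: "finite {polytabloid lam t | t. tableau lam t}"
proof (rule finite_subset)
  let ?F = "\<lambda>(C, r0) r. \<Sum>p\<in>C. if r \<circ> p = r0 then of_int (sign p) else 0 :: real"
  show "{polytabloid lam t | t. tableau lam t} \<subseteq> ?F ` (Pow (Sym (sum_list lam)) \<times> tabloids lam)"
  proof safe
    fix t assume "tableau lam t"
    then interpret tableau lam t .
    have "polytabloid lam t = ?F (col_stab lam t, tabloid lam t)"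
      unfolding polytabloid_def
      by (auto simp: tabloid_comp_eq_iff col_stab_permutes intro!: sum.cong ext)
    moreover have "(col_stab lam t, tabloid lam t) \<in> Pow (Sym (sum_list lam)) \<times> tabloids lam"
      using tabloid_in col_stab_permutes by auto
    ultimately show "polytabloid lam t \<in> ?F ` (Pow (Sym (sum_list lam)) \<times> tabloids lam)" by blast
  qed
  show "finite (?F ` (Pow (Sym (sum_list lam)) \<times> tabloids lam))"
    by (intro finite_imageI finite_cartesian_product) (auto simp: finite_permutations)
qed

lemma perm_act_specht:
  assumes s: "s permutes {..<sum_list lam}" and v: "v \<in> specht lam"
  shows "(\<lambda>r. v (r \<circ> s)) \<in> specht lam"
proof -
  let ?T = "{v. (\<lambda>r. v (r \<circ> s)) \<in> specht lam}"
  have "specht lam \<subseteq> ?T"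
    unfolding specht_eq
  proof (rule fun_space.span_minimal)
    show "{polytabloid lam t | t. tableau lam t} \<subseteq>
      {v. (\<lambda>r. v (r \<circ> s)) \<in> fun_space.span {polytabloid lam t | t. tableau lam t}}"
    proof safe
      fix t assume t: "tableau lam t"
      have "(\<lambda>r. polytabloid lam t (r \<circ> s)) = polytabloid lam (s \<circ> t)"
        using perm_act_polytabloid[OF t s] by (simp add: perm_act_def)
      thus "(\<lambda>r. polytabloid lam t (r \<circ> s)) \<in> fun_space.span {polytabloid lam t | t. tableau lam t}"
        using tableau.tableau_comp[OF t s] by (auto intro: fun_space.span_base)
    qed
    show "fun_space.subspace {v. (\<lambda>r. v (r \<circ> s)) \<in> fun_space.span {polytabloid lam t | t. tableau lam t}}"
    proof (rule fun_space.subspaceI; clarify)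
      let ?S = "fun_space.span {polytabloid lam t | t. tableau lam t}"
      show "(\<lambda>r. (0 :: (nat \<Rightarrow> nat) \<Rightarrow> real) (r \<circ> s)) \<in> ?S"
        using fun_space.span_zero[of "{polytabloid lam t | t. tableau lam t}"] by (simp add: zero_fun_def)
      fix u v :: "(nat \<Rightarrow> nat) \<Rightarrow> real" and c :: real
      assume u: "(\<lambda>r. u (r \<circ> s)) \<in> ?S"
      show "(\<lambda>r. c * u (r \<circ> s)) \<in> ?S"
        using fun_space.span_scale[OF u] .
      assume v: "(\<lambda>r. v (r \<circ> s)) \<in> ?S"
      show "(\<lambda>r. (u + v) (r \<circ> s)) \<in> ?S"
        using fun_space.span_add[OF u v] by (simp add: plus_fun_def)
    qed
  qed
  thus ?thesis using v by auto
qed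

definition specht_proj :: "nat list \<Rightarrow> (nat \<Rightarrow> nat) \<Rightarrow> (nat \<Rightarrow> nat) \<Rightarrow> real" where
  "specht_proj lam = (SOME P. proj_kernel (tabloids lam) (specht lam) P)"

lemma proj_kernel_specht: "proj_kernel (tabloids lam) (specht lam) (specht_proj lam)"
  unfolding specht_proj_def specht_eq
proof (rule someI_ex[where P = "proj_kernel (tabloids lam) (fun_space.span {polytabloid lam t | t. tableau lam t})"])
  show "\<exists>P. proj_kernel (tabloids lam) (fun_space.span {polytabloid lam t | t. tableau lam t}) P"
    by (rule proj_kernel_exists[OF finite_tabloids finite_polytabloids])
       (use tableau.polytabloid_supp in blast)
qed

lemma irr_char_eq:
  assumes "s permutes {..<sum_list lam}"
  shows "irr_char lam s = (\<Sum>x\<in>tabloids lam. specht_proj lam (x \<circ> s) x)"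
  unfolding irr_char_def perm_act_def specht_eq
  by (rule trace_on_proj_kernel[OF finite_tabloids finite_polytabloids proj_kernel_specht[unfolded specht_eq]])
     (use perm_act_specht[OF assms, unfolded specht_eq] in blast)

lemma specht_proj_invariant:
  assumes s: "s permutes {..<sum_list lam}" and x: "x \<in> tabloids lam" and y: "y \<in> tabloids lam"
  shows "specht_proj lam (x \<circ> s) (y \<circ> s) = specht_proj lam x y"
proof -
  have i: "inv s permutes {..<sum_list lam}" using s by (rule permutes_inv)
  have o: "r \<circ> s \<circ> inv s = r" "r \<circ> inv s \<circ> s = r" for r :: "nat \<Rightarrow> nat"
    using permutes_inv_o[OF s] by (metis comp_id o_assoc)+
  have "bij_betw (\<lambda>r. r \<circ> s) (tabloids lam) (tabloids lam)"
    by (rule bij_betw_byWitness[where f' = "\<lambda>r. r \<circ> inv s"]) (auto simp: o tabloids_comp s i)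
  moreover have "bij_betw (\<lambda>r. r \<circ> inv s) (tabloids lam) (tabloids lam)"
    by (rule bij_betw_byWitness[where f' = "\<lambda>r. r \<circ> s"]) (auto simp: o tabloids_comp s i)
  ultimately show ?thesis
    using proj_kernel_invariant[OF proj_kernel_specht, of "\<lambda>r. r \<circ> s" lam "\<lambda>r. r \<circ> inv s" x y]
      perm_act_specht s i o x y by blast
qed

text \<open>An element of G only has to act on the tabloids like some permutation of their entries.
  This admits subgroups of a larger symmetric group, which act through a quotient.\<close>

lemma perm_rep_specht:
  assumes "perm_group G"
    and G: "\<And>s. s \<in> G \<Longrightarrow> \<exists>s'. s' permutes {..<sum_list lam} \<and> (\<forall>x\<in>tabloids lam. x \<circ> s = x \<circ> s')"
  shows "perm_rep G (\<lambda>s x. x \<circ> s) (tabloids lam) (specht_proj lam)"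
proof -
  interpret perm_group G by fact
  show ?thesis
  proof
    show "specht_proj lam (z \<circ> s) (w \<circ> s) = specht_proj lam z w"
      if "s \<in> G" "z \<in> tabloids lam" "w \<in> tabloids lam" for s z w
      using G[OF that(1)] that specht_proj_invariant by metis
    show "z \<circ> s \<in> tabloids lam" if "s \<in> G" "z \<in> tabloids lam" for s z
      using G[OF that(1)] that tabloids_comp by metis
    show "specht_proj lam z w = specht_proj lam w z" for z w
      using proj_kernel_specht unfolding proj_kernel_def by blast
    show "(\<Sum>y\<in>tabloids lam. specht_proj lam z y * specht_proj lam y w) = specht_proj lam z w" for z w
      by (rule proj_kernel_idem[OF proj_kernel_specht])
  qed (auto simp: o_assoc)
qed

lemma perm_rep_specht_Sym:
  "sum_list lam = n \<Longrightarrow> perm_rep (Sym n) (\<lambda>s x. x \<circ> s) (tabloids lam) (specht_proj lam)"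
  by (intro perm_rep_specht perm_group_permutes) auto

lemma perm_rep_tabloids:
  assumes "sum_list lam = n"
  shows "perm_rep (Sym n) (\<lambda>s x. x \<circ> s) (tabloids lam) (\<lambda>x y. if x = y then 1 else 0)"
proof -
  interpret perm_group "Sym n" by (rule perm_group_permutes) simp
  have "x = y" if "x \<circ> s = y \<circ> s" "s permutes {..<n}" for x y :: "nat \<Rightarrow> nat" and s
    using that permutes_inv_o[of s "{..<n}"] by (metis comp_id o_assoc)
  thus ?thesis
    by unfold_locales
       (auto simp: assms tabloids_comp o_assoc if_distrib[of "\<lambda>x. x * _"] cong: if_cong)
qed


section \<open>James' lemma and orthonormality of the characters\<close>

definition dominates :: "nat list \<Rightarrow> nat list \<Rightarrow> bool" where
  "dominates mu lam \<longleftrightarrow> (\<forall>k. sum_list (take k lam) \<le> sum_list (take k mu))"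

lemma dominates_antisym:
  assumes "dominates mu lam" "dominates lam mu" "0 \<notin> set lam" "0 \<notin> set mu"
  shows "lam = mu"
  using assms
proof (induction lam arbitrary: mu)
  case Nil
  thus ?case
  proof (cases mu)
    case (Cons m ms)
    thus ?thesis using Nil by (auto simp: dominates_def dest!: spec[of _ "Suc 0"])
  qed simp
next
  case (Cons l ls)
  show ?case
  proof (cases mu)
    case Nil
    thus ?thesis using Cons.prems by (auto simp: dominates_def dest!: spec[of _ "Suc 0"])
  next
    case [simp]: (Cons m ms)
    have eq: "sum_list (take k (l # ls)) = sum_list (take k mu)" for k
      using Cons.prems(1,2) by (auto simp: dominates_def intro: antisym)
    have "l = m" using eq[of "Suc 0"] by simp
    moreover have "sum_list (take k ls) = sum_list (take k ms)" for k
      using eq[of "Suc k"] \<open>l = m\<close> by simp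
    hence "ls = ms" using Cons.IH[of ms] Cons.prems by (auto simp: dominates_def)
    ultimately show ?thesis by simp
  qed
qed

lemma column_eq:
  assumes "mu \<turnstile>\<^sub>p n"
  shows "{i. (i, j) \<in> cells mu} = {..<card {i. (i, j) \<in> cells mu}}"
proof -
  let ?A = "{i. (i, j) \<in> cells mu}"
  have fin: "finite ?A" by (rule finite_subset[of _ "{..<length mu}"]) (auto simp: cells_def)
  have down: "i' \<in> ?A" if "i \<in> ?A" "i' < i" for i i'
    using that assms sorted_wrt_nth_less[of "(\<ge>)" mu i' i]
    by (auto simp: cells_def is_partition_def)
  have "{..<i} \<subseteq> ?A \<and> i \<in> ?A" if "i \<in> ?A" for i using down that by auto
  hence "i < card ?A" if "i \<in> ?A" for i
    using that card_mono[OF fin, of "{..i}"] down by (force simp: le_less)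
  moreover have "i \<in> ?A" if "i < card ?A" for i
  proof (rule ccontr)
    assume "i \<notin> ?A"
    hence "?A \<subseteq> {..<i}" using down by (auto simp: not_less_iff_gr_or_eq) (metis linorder_neqE_nat)
    thus False using that card_mono[of "{..<i}" ?A] by simp
  qed
  ultimately show ?thesis by blast
qed

context tableau
begin

lemma columns_count:
  assumes lam: "lam \<turnstile>\<^sub>p n" and inj: "\<And>a b. a < n \<Longrightarrow> b < n \<Longrightarrow> a \<noteq> b \<Longrightarrow> col a = col b \<Longrightarrow> x a \<noteq> x b"
  defines "h \<equiv> \<lambda>j. card {i. (i, j) \<in> cells lam}"
  shows "card {a. a < n \<and> x a < k} = (\<Sum>j<n. card {a. a < n \<and> col a = j \<and> x a < k})"
    and "sum_list (take k lam) = (\<Sum>j<n. min k (h j))"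
    and "card {a. a < n \<and> col a = j \<and> x a < k} \<le> min k (h j)"
    and "card {a. a < n \<and> col a = j} = h j"
proof -
  have nth_le: "lam ! i \<le> n" if "i < length lam" for i
    using that by (simp add: elem_le_sum_list)
  have col_less: "col a < n" if "a < n" for a
    using pos_in[OF that] nth_le by (auto simp: cells_def col_def case_prod_unfold intro: less_le_trans)
  have "{a. a < n \<and> x a < k} = (\<Union>j<n. {a. a < n \<and> col a = j \<and> x a < k})"
    using col_less by auto
  hence "card {a. a < n \<and> x a < k} = card (\<Union>j<n. {a. a < n \<and> col a = j \<and> x a < k})"
    by (rule arg_cong)
  also have "\<dots> = (\<Sum>j<n. card {a. a < n \<and> col a = j \<and> x a < k})"
    by (rule card_UN_disjoint) auto
  finally show "card {a. a < n \<and> x a < k} = (\<Sum>j<n. card {a. a < n \<and> col a = j \<and> x a < k})" .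
  have "{c \<in> cells lam. fst c < k} = (\<Union>j<n. (\<lambda>i. (i, j)) ` {i. i < k \<and> (i, j) \<in> cells lam})"
  proof -
    have "j < n" if "(i, j) \<in> cells lam" for i j
      using that nth_le[of i] by (auto simp: cells_def)
    thus ?thesis by (auto simp: image_iff)
  qed
  hence "sum_list (take k lam) = card (\<Union>j<n. (\<lambda>i. (i, j)) ` {i. i < k \<and> (i, j) \<in> cells lam})"
    by (simp flip: card_cells_rows)
  also have "\<dots> = (\<Sum>j<n. card ((\<lambda>i. (i, j)) ` {i. i < k \<and> (i, j) \<in> cells lam}))"
    by (rule card_UN_disjoint) auto
  also have "\<dots> = (\<Sum>j<n. min k (h j))"
  proof (rule sum.cong[OF refl])
    fix j
    have "{i. i < k \<and> (i, j) \<in> cells lam} = {..<k} \<inter> {i. (i, j) \<in> cells lam}" by auto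
    also have "\<dots> = {..<min k (h j)}"
      unfolding h_def by (subst column_eq[OF lam]) (auto simp: min_def)
    finally show "card ((\<lambda>i. (i, j)) ` {i. i < k \<and> (i, j) \<in> cells lam}) = min k (h j)"
      by (simp add: card_image inj_on_def)
  qed
  finally show "sum_list (take k lam) = (\<Sum>j<n. min k (h j))" .
  show h: "card {a. a < n \<and> col a = j} = h j"
  proof -
    have "bij_betw (\<lambda>i. t (i, j)) {i. (i, j) \<in> cells lam} {a. a < n \<and> col a = j}"
      by (rule bij_betw_byWitness[where f' = "\<lambda>a. fst (pos a)"])
         (auto simp: pos_t t_less col_def t_pos pos_in)
    thus ?thesis by (simp add: h_def bij_betw_same_card)
  qed
  have "inj_on x {a. a < n \<and> col a = j \<and> x a < k}"
  proof (rule inj_onI, rule ccontr)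
    fix a b assume "a \<in> {a. a < n \<and> col a = j \<and> x a < k}" "b \<in> {a. a < n \<and> col a = j \<and> x a < k}"
      "x a = x b" "a \<noteq> b"
    thus False using inj[of a b] by simp
  qed
  moreover have "x ` {a. a < n \<and> col a = j \<and> x a < k} \<subseteq> {..<k}" by auto
  ultimately have "card {a. a < n \<and> col a = j \<and> x a < k} \<le> k"
    using card_inj_on_le[of x _ "{..<k}"] by auto
  moreover have "card {a. a < n \<and> col a = j \<and> x a < k} \<le> card {a. a < n \<and> col a = j}"
    by (rule card_mono) auto
  ultimately show "card {a. a < n \<and> col a = j \<and> x a < k} \<le> min k (h j)" by (simp add: h)
qed

text \<open>If no column of \<open>t\<close> contains two entries of the same row of \<open>x\<close>, then a column of length \<open>h\<close> meets
  the first \<open>k\<close> rows of \<open>x\<close> in at most \<open>min k h\<close> entries; summing over the columns gives dominance,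
  and for equal shapes all these estimates are equalities.\<close>

lemma antisym_dominates:
  assumes lam: "lam \<turnstile>\<^sub>p n" and "sum_list mu = n" and x: "x \<in> tabloids mu" and nz: "antisym f x \<noteq> 0"
  shows "dominates lam mu"
proof -
  have "x a \<noteq> x b" if "a < n" "b < n" "a \<noteq> b" "col a = col b" for a b
    using antisym_eq_0[OF that] nz by blast
  note cc = columns_count[where x = x, OF lam this]
  show ?thesis
    unfolding dominates_def
  proof
    fix k
    have "sum_list (take k mu) = card {a. a < n \<and> x a < k}"
      using card_tabloid_rows[OF x, of k] assms(2) by simp
    also have "\<dots> = (\<Sum>j<n. card {a. a < n \<and> col a = j \<and> x a < k})" by (rule cc(1))
    also have "\<dots> \<le> (\<Sum>j<n. min k (card {i. (i, j) \<in> cells lam}))"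
      by (intro sum_mono cc(3))
    also have "\<dots> = sum_list (take k lam)" by (rule cc(2)[symmetric])
    finally show "sum_list (take k mu) \<le> sum_list (take k lam)" .
  qed
qed

text \<open>Either two entries of one column lie in the same row of x, and both sides vanish, or a
  column permutation carries x to the tabloid of t, and the signed sum at x is its value there up to
  the sign. So the signed column sum maps every function into the line spanned by the
  polytabloid.\<close>

lemma antisym_self:
  assumes lam: "lam \<turnstile>\<^sub>p n" and x: "x \<in> tabloids lam"
  shows "antisym f x = antisym f (tabloid lam t) * polytabloid lam t x"
proof (cases "\<exists>a b. a < n \<and> b < n \<and> a \<noteq> b \<and> col a = col b \<and> x a = x b")
  case True
  thus ?thesis using antisym_eq_0 by (auto simp: polytabloid_eq_antisym)
next
  case False
  hence inj: "x a \<noteq> x b" if "a < n" "b < n" "a \<noteq> b" "col a = col b" for a b using that by blast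
  note cc = columns_count[where x = x, OF lam inj]
  define h where "h = (\<lambda>j. card {i. (i, j) \<in> cells lam})"
  define \<psi> where "\<psi> = (\<lambda>a. (x a, col a))"
  have \<psi>_in: "\<psi> a \<in> cells lam" if a: "a < n" for a
  proof -
    \<comment> \<open>With k the height of the column of a, the forced equality says that all
      entries of this column lie in the first k rows of x.\<close>
    define k where "k = h (col a)"
    have "(\<Sum>j<n. card {a. a < n \<and> col a = j \<and> x a < k}) = card {a. a < n \<and> x a < k}"
      by (rule cc(1)[symmetric])
    also have "\<dots> = sum_list (take k lam)" by (rule card_tabloid_rows[OF x])
    also have "\<dots> = (\<Sum>j<n. min k (h j))" unfolding h_def by (rule cc(2))
    finally have "(\<Sum>j<n. card {a. a < n \<and> col a = j \<and> x a < k}) = (\<Sum>j<n. min k (h j))" .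
    moreover have "card {a. a < n \<and> col a = j \<and> x a < k} \<le> min k (h j)" for j
      unfolding h_def by (rule cc(3))
    moreover have "col a < n"
      using pos_in[OF a] by (auto simp: cells_def col_def case_prod_unfold intro: less_le_trans[OF _ elem_le_sum_list])
    ultimately have "card {b. b < n \<and> col b = col a \<and> x b < k} = min k (h (col a))"
      using sum_mono_inv[of "\<lambda>j. card {a. a < n \<and> col a = j \<and> x a < k}" "{..<n}" "\<lambda>j. min k (h j)" "col a"]
      by auto
    also have "\<dots> = card {b. b < n \<and> col b = col a}" by (simp add: k_def h_def cc(4)[of "col a"])
    finally have "{b. b < n \<and> col b = col a \<and> x b < k} = {b. b < n \<and> col b = col a}"
      by (intro card_subset_eq) auto
    hence "x a < h (col a)" using a by (auto simp: k_def)
    hence "x a \<in> {i. (i, col a) \<in> cells lam}" by (subst column_eq[OF lam]) (simp add: h_def)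
    thus ?thesis by (simp add: \<psi>_def)
  qed
  have "inj_on \<psi> {..<n}" using inj by (auto simp: inj_on_def \<psi>_def)
  hence bij: "bij_betw \<psi> {..<n} (cells lam)"
    using \<psi>_in card_image[of \<psi> "{..<n}"] card_subset_eq[of "cells lam" "\<psi> ` {..<n}"]
    unfolding bij_betw_def by auto
  \<comment> \<open>\<open>\<psi>\<close> records the row of an entry in x and its column in t.
    Matching it with the position in t yields a permutation that preserves columns and turns x into
    the tabloid of t.\<close>
  define \<pi> where "\<pi> = (\<lambda>a. if a < n then inv_into {..<n} \<psi> (pos a) else a)"
  have "bij_betw (inv_into {..<n} \<psi> \<circ> pos) {..<n} {..<n}"
    using bij_betw_trans[OF bij_pos bij_betw_inv_into[OF bij]] .
  hence "bij_betw \<pi> {..<n} {..<n}" by (rule bij_betw_cong[THEN iffD1, rotated]) (auto simp: \<pi>_def)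
  hence perm: "\<pi> permutes {..<n}" by (rule bij_imp_permutes) (auto simp: \<pi>_def)
  have \<psi>\<pi>: "\<psi> (\<pi> a) = pos a" if "a < n" for a
    using that bij pos_in by (simp add: \<pi>_def bij_betw_inv_into_right)
  have \<pi>: "\<pi> \<in> col_stab lam t"
    using perm \<psi>\<pi> by (auto simp: col_stab_eq \<psi>_def col_def prod_eq_iff)
  have "x \<circ> \<pi> = tabloid lam t"
  proof
    fix a show "(x \<circ> \<pi>) a = tabloid lam t a"
      using \<psi>\<pi>[of a] x by (auto simp: \<psi>_def tabloid_def prod_eq_iff tabloids_def \<pi>_def)
  qed
  hence "antisym f (tabloid lam t) = of_int (sign \<pi>) * antisym f x" for f
    using antisym_shift[OF \<pi>, of f x] by simp
  from this[of f] this[of "\<lambda>x. if x = tabloid lam t then 1 else 0"]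
  show ?thesis using polytabloid_tabloid
    by (cases \<pi> rule: sign_cases) (auto simp flip: polytabloid_eq_antisym)
qed

text \<open>Invariance moves a column permutation from the second argument of K to the first, so an
  equivariant map sends a polytabloid to a signed column sum, to which the two lemmas above
  apply.\<close>

lemma kernel_polytabloid:
  assumes inv: "\<And>s x y. s permutes {..<n} \<Longrightarrow> x \<in> X \<Longrightarrow> y \<in> tabloids lam \<Longrightarrow> K (x \<circ> s) (y \<circ> s) = K x y"
    and x: "x \<in> X"
  shows "(\<Sum>y\<in>tabloids lam. K x y * polytabloid lam t y) = antisym (\<lambda>x. K x (tabloid lam t)) x"
proof -
  have "(\<Sum>y\<in>tabloids lam. K x y * polytabloid lam t y)
      = (\<Sum>p\<in>col_stab lam t. \<Sum>y\<in>tabloids lam. if tabloid lam (p \<circ> t) = y then K x y * of_int (sign p) else 0)"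
    unfolding polytabloid_def sum_distrib_left
    by (subst sum.swap) (auto intro!: sum.cong)
  also have "\<dots> = (\<Sum>p\<in>col_stab lam t. K x (tabloid lam (p \<circ> t)) * of_int (sign p))"
    by (intro sum.cong refl) (simp add: sum.delta' tableau.tabloid_in tableau_comp col_stab_permutes)
  also have "\<dots> = antisym (\<lambda>x. K x (tabloid lam t)) x"
    unfolding antisym_def
  proof (intro sum.cong refl)
    fix p assume "p \<in> col_stab lam t"
    hence p: "p permutes {..<n}" by (rule col_stab_permutes)
    have "tabloid lam (p \<circ> t) \<circ> p = tabloid lam t" using tabloid_comp_eq_iff[OF p] by blast
    hence "K (x \<circ> p) (tabloid lam t) = K x (tabloid lam (p \<circ> t))"
      using inv[OF p x tableau.tabloid_in[OF tableau_comp[OF p]]] by simp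
    thus "K x (tabloid lam (p \<circ> t)) * of_int (sign p) = of_int (sign p) * K (x \<circ> p) (tabloid lam t)"
      by simp
  qed
  finally show ?thesis .
qed

end

text \<open>By the second hypothesis the values of f are inner products of f with elements of the
  Specht module, and the first makes f orthogonal to its generators.\<close>

lemma kernel_eq_0:
  assumes e: "\<And>t. tableau mu t \<Longrightarrow> (\<Sum>y\<in>tabloids mu. f y * polytabloid mu t y) = 0"
    and f: "\<And>y. y \<in> tabloids mu \<Longrightarrow> (\<Sum>y'\<in>tabloids mu. specht_proj mu y y' * f y') = f y"
    and y: "y \<in> tabloids mu"
  shows "f y = 0"
proof -
  let ?T = "{v. (\<Sum>y\<in>tabloids mu. f y * v y) = 0}"
  have "specht mu \<subseteq> ?T" unfolding specht_eq
  proof (rule fun_space.span_minimal)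
    show "fun_space.subspace ?T"
      by (auto simp: fun_space.subspace_def distrib_left sum.distrib mult.left_commute
          simp flip: sum_distrib_left)
  qed (use e in auto)
  moreover have "specht_proj mu y \<in> specht mu"
    using proj_kernel_specht unfolding proj_kernel_def by blast
  ultimately have "(\<Sum>y'\<in>tabloids mu. f y' * specht_proj mu y y') = 0" by auto
  thus ?thesis using f[OF y] by (simp add: mult.commute)
qed

text \<open>K is the matrix of an equivariant map from the Specht module of mu to the permutation
  module of lam. Without dominance every polytabloid is sent to a signed column sum that
  vanishes.\<close>

lemma kernel_dominates:
  assumes mu: "mu \<turnstile>\<^sub>p n" and lam: "sum_list lam = n"
    and inv: "\<And>s x y. s permutes {..<n} \<Longrightarrow> x \<in> tabloids lam \<Longrightarrow> y \<in> tabloids mu \<Longrightarrow> K (x \<circ> s) (y \<circ> s) = K x y"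
    and f: "\<And>x y. x \<in> tabloids lam \<Longrightarrow> y \<in> tabloids mu \<Longrightarrow> (\<Sum>y'\<in>tabloids mu. specht_proj mu y y' * K x y') = K x y"
    and x: "x \<in> tabloids lam" and y: "y \<in> tabloids mu" and nz: "K x y \<noteq> 0"
  shows "dominates mu lam"
proof (rule ccontr)
  assume nd: "\<not> dominates mu lam"
  have n: "sum_list mu = n" using mu by (simp add: is_partition_def)
  have "K x y = 0"
  proof (rule kernel_eq_0[OF _ f[OF x] y])
    fix t assume "tableau mu t"
    then interpret tableau mu t .
    have "(\<Sum>y\<in>tabloids mu. K x y * polytabloid mu t y) = antisym (\<lambda>x. K x (tabloid mu t)) x"
      by (rule kernel_polytabloid[where X = "tabloids lam"], rule inv) (use x n in auto)
    also have "\<dots> = 0" using antisym_dominates[of lam x] mu lam n x nd by auto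
    finally show "(\<Sum>y\<in>tabloids mu. K x y * polytabloid mu t y) = 0" .
  qed
  with nz show False by simp
qed

text \<open>Schur's lemma with real scalars. K rescales each polytabloid by
  \<open>antisym_self\<close>, and equivariance makes the factor the same for all tableaux, since
  any two differ by a permutation of the entries.\<close>

lemma kernel_scalar:
  assumes mu: "mu \<turnstile>\<^sub>p n"
    and inv: "\<And>s x y. s permutes {..<n} \<Longrightarrow> x \<in> tabloids mu \<Longrightarrow> y \<in> tabloids mu \<Longrightarrow> K (x \<circ> s) (y \<circ> s) = K x y"
    and f: "\<And>x y. x \<in> tabloids mu \<Longrightarrow> y \<in> tabloids mu \<Longrightarrow> (\<Sum>y'\<in>tabloids mu. specht_proj mu y y' * K x y') = K x y"
  shows "\<exists>c. \<forall>x\<in>tabloids mu. \<forall>y\<in>tabloids mu. K x y = c * specht_proj mu x y"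
proof -
  have n: "sum_list mu = n" using mu by (simp add: is_partition_def)
  \<comment> \<open>The factor by which K rescales the polytabloid of t, read off at the tabloid of
    t, where the polytabloid has the value 1.\<close>
  define C where "C = (\<lambda>t. tableau.antisym mu t (\<lambda>x. K x (tabloid mu t)) (tabloid mu t))"
  have C_eq: "C (s \<circ> t) = C t" if t: "tableau mu t" and s: "s permutes {..<n}" for s t
  proof -
    interpret tableau mu t by fact
    have s': "s permutes {..<sum_list mu}" using s n by simp
    interpret T: tableau mu "s \<circ> t" by (rule tableau_comp[OF s'])
    have so: "inv s \<circ> s = id" "s \<circ> inv s = id" using s by (auto simp: permutes_inv_o)
    have "C (s \<circ> t) = (\<Sum>p\<in>col_stab mu t. of_int (sign (s \<circ> p \<circ> inv s)) *
        K (tabloid mu t \<circ> inv s \<circ> (s \<circ> p \<circ> inv s)) (tabloid mu t \<circ> inv s))"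
      unfolding C_def T.antisym_def tabloid_comp[OF s']
      by (rule sum.reindex_bij_betw[OF col_stab_comp[OF t s'], symmetric])
    also have "\<dots> = C t"
      unfolding C_def antisym_def
    proof (intro sum.cong refl)
      fix p assume p: "p \<in> col_stab mu t"
      have "tabloid mu t \<circ> inv s \<circ> (s \<circ> p \<circ> inv s) = (tabloid mu t \<circ> p) \<circ> inv s"
        using so by (metis comp_id o_assoc)
      thus "of_int (sign (s \<circ> p \<circ> inv s)) * K (tabloid mu t \<circ> inv s \<circ> (s \<circ> p \<circ> inv s)) (tabloid mu t \<circ> inv s)
         = of_int (sign p) * K (tabloid mu t \<circ> p) (tabloid mu t)"
        using inv[OF permutes_inv[OF s] tabloids_comp[OF tabloid_in col_stab_permutes[OF p]] tabloid_in]
          sign_conj[OF s' col_stab_permutes[OF p]] by simp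
    qed
    finally show ?thesis .
  qed
  obtain t0 where t0: "tableau mu t0" using exists_tableau by blast
  have C_const: "C t = C t0" if t: "tableau mu t" for t
  proof -
    interpret T: tableau mu t by fact
    interpret T0: tableau mu t0 by fact
    define s where "s = (\<lambda>a. if a < n then t (T0.pos a) else a)"
    have "bij_betw (t \<circ> T0.pos) {..<n} {..<n}"
      using bij_betw_trans[OF T0.bij_pos T.bij_t] n by simp
    hence "bij_betw s {..<n} {..<n}" by (rule bij_betw_cong[THEN iffD1, rotated]) (auto simp: s_def)
    hence s: "s permutes {..<n}" by (rule bij_imp_permutes) (auto simp: s_def)
    interpret S: tableau mu "s \<circ> t0" by (rule T0.tableau_comp) (use s n in simp)
    \<comment> \<open>Outside the cells \<open>s \<circ> t0\<close> and t may differ as functions,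
      so the comparison passes through their tabloids and column stabilizers.\<close>
    have eq: "(s \<circ> t0) c = t c" if "c \<in> cells mu" for c
      using that T0.t_less n T0.pos_t by (auto simp: s_def)
    have pos: "S.pos a = T.pos a" if "a < n" for a
      using that n eq T.pos_in T.t_pos S.pos_t by metis
    hence 1: "tabloid mu (s \<circ> t0) = tabloid mu t" using n by (auto simp: tabloid_def fun_eq_iff)
    have c: "S.col a = T.col a" if "a < n" for a using pos that by (simp add: S.col_def T.col_def)
    have "p a < n" if "p permutes {..<n}" "a < n" for p a using that permutes_in_image[of p "{..<n}" a] by simp
    hence 2: "col_stab mu (s \<circ> t0) = col_stab mu t"
      unfolding S.col_stab_eq T.col_stab_eq using n c by auto
    have "C t = C (s \<circ> t0)"
      unfolding C_def T.antisym_def S.antisym_def 1 2 ..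
    also have "\<dots> = C t0" by (rule C_eq[OF t0 s])
    finally show ?thesis .
  qed
  have "K x y - C t0 * specht_proj mu x y = 0" if x: "x \<in> tabloids mu" and y: "y \<in> tabloids mu" for x y
  proof (rule kernel_eq_0[OF _ _ y])
    fix t assume t: "tableau mu t"
    then interpret tableau mu t .
    have "(\<Sum>y\<in>tabloids mu. K x y * polytabloid mu t y) = antisym (\<lambda>x. K x (tabloid mu t)) x"
      by (rule kernel_polytabloid[where X = "tabloids mu"], rule inv) (use x n in auto)
    also have "\<dots> = C t * polytabloid mu t x"
      unfolding C_def by (rule antisym_self) (use mu n x in auto)
    finally have 1: "(\<Sum>y\<in>tabloids mu. K x y * polytabloid mu t y) = C t0 * polytabloid mu t x"
      using C_const[OF t] by simp
    have "polytabloid mu t \<in> specht mu" unfolding specht_eq using t by (auto intro: fun_space.span_base)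
    hence "(\<Sum>y\<in>tabloids mu. specht_proj mu x y * polytabloid mu t y) = polytabloid mu t x"
      using proj_kernel_specht unfolding proj_kernel_def by blast
    thus "(\<Sum>y\<in>tabloids mu. (K x y - C t0 * specht_proj mu x y) * polytabloid mu t y) = 0"
      by (simp add: left_diff_distrib sum_subtractf 1 mult.assoc flip: sum_distrib_left)
  next
    fix y assume y: "y \<in> tabloids mu"
    have "(\<Sum>z\<in>tabloids mu. specht_proj mu y z * specht_proj mu z x) = specht_proj mu y x"
      by (rule proj_kernel_idem[OF proj_kernel_specht])
    moreover have sym: "specht_proj mu x y = specht_proj mu y x" for x y
      using proj_kernel_specht unfolding proj_kernel_def by blast
    ultimately have "(\<Sum>z\<in>tabloids mu. specht_proj mu y z * specht_proj mu x z) = specht_proj mu x y"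
      unfolding sym[of _ x] by (simp only:)
    hence "C t0 * (\<Sum>z\<in>tabloids mu. specht_proj mu y z * specht_proj mu x z) = C t0 * specht_proj mu x y"
      by (simp only:)
    hence "(\<Sum>z\<in>tabloids mu. specht_proj mu y z * (C t0 * specht_proj mu x z)) = C t0 * specht_proj mu x y"
      by (simp add: sum_distrib_left mult.left_commute)
    thus "(\<Sum>y'\<in>tabloids mu. specht_proj mu y y' * (K x y' - C t0 * specht_proj mu x y'))
        = K x y - C t0 * specht_proj mu x y"
      by (simp add: right_diff_distrib sum_subtractf f[OF x y])
  qed
  thus ?thesis by (intro exI[of _ "C t0"]) auto
qed

lemma sum_rotate: "(\<Sum>a\<in>A. \<Sum>b\<in>B. \<Sum>c\<in>C. f a b c) = (\<Sum>b\<in>B. \<Sum>c\<in>C. \<Sum>a\<in>A. f a b c)"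
  by (rule trans[OF sum.swap], intro sum.cong refl, rule sum.swap)

text \<open>The tensor projection absorbs the projection on either factor, so whatever it fixes is
  fixed by each factor separately. This reduces invariants of a tensor product to kernels.\<close>

lemma prod_kernel_fix:
  assumes "perm_rep G a X P" "perm_rep G b Y R"
    and K: "\<And>z. z \<in> X \<times> Y \<Longrightarrow> (\<Sum>w\<in>X \<times> Y. (case z of (x, y) \<Rightarrow> \<lambda>(x', y'). P x x' * R y y') w * K w) = K z"
    and x: "x \<in> X" and y: "y \<in> Y"
  shows "(\<Sum>y'\<in>Y. R y y' * K (x, y')) = K (x, y)" "(\<Sum>x'\<in>X. P x x' * K (x', y)) = K (x, y)"
proof -
  interpret A: perm_rep G a X P by fact
  interpret B: perm_rep G b Y R by fact
  have K': "K (x, y) = (\<Sum>x'\<in>X. \<Sum>y'\<in>Y. P x x' * R y y' * K (x', y'))" if "x \<in> X" "y \<in> Y" for x y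
    using K[of "(x, y)"] that by (simp add: sum.cartesian_product case_prod_unfold)
  have "(\<Sum>y'\<in>Y. R y y' * K (x, y'))
      = (\<Sum>y'\<in>Y. \<Sum>x''\<in>X. \<Sum>y''\<in>Y. R y y' * (P x x'' * R y' y'' * K (x'', y'')))"
    using x by (intro sum.cong refl) (simp add: K' sum_distrib_left)
  also have "\<dots> = (\<Sum>x''\<in>X. \<Sum>y''\<in>Y. \<Sum>y'\<in>Y. R y y' * (P x x'' * R y' y'' * K (x'', y'')))"
    by (rule sum_rotate)
  also have "\<dots> = (\<Sum>x''\<in>X. \<Sum>y''\<in>Y. P x x'' * (\<Sum>y'\<in>Y. R y y' * R y' y'') * K (x'', y''))"
    by (simp add: sum_distrib_left sum_distrib_right mult_ac)
  also have "\<dots> = K (x, y)" using x y by (simp add: B.P_idem K')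
  finally show "(\<Sum>y'\<in>Y. R y y' * K (x, y')) = K (x, y)" .
  have "(\<Sum>x'\<in>X. P x x' * K (x', y))
      = (\<Sum>x'\<in>X. \<Sum>x''\<in>X. \<Sum>y''\<in>Y. P x x' * (P x' x'' * R y y'' * K (x'', y'')))"
    using y by (intro sum.cong refl) (simp add: K' sum_distrib_left)
  also have "\<dots> = (\<Sum>x''\<in>X. \<Sum>y''\<in>Y. \<Sum>x'\<in>X. P x x' * (P x' x'' * R y y'' * K (x'', y'')))"
    by (rule sum_rotate)
  also have "\<dots> = (\<Sum>x''\<in>X. \<Sum>y''\<in>Y. (\<Sum>x'\<in>X. P x x' * P x' x'') * R y y'' * K (x'', y''))"
    by (simp add: sum_distrib_left sum_distrib_right mult_ac)
  also have "\<dots> = K (x, y)" using x y by (simp add: A.P_idem K')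
  finally show "(\<Sum>x'\<in>X. P x x' * K (x', y)) = K (x, y)" .
qed

lemma (in perm_rep) chr_conj:
  assumes "g \<in> G" "s \<in> G"
  shows "chr (inv g \<circ> s \<circ> g) = chr s"
proof -
  have "chr (inv g \<circ> s \<circ> g) = (\<Sum>z\<in>Z. P (act g (act s (act (inv g) z))) z)"
    unfolding chr_def using assms by (intro sum.cong refl) (simp add: act_comp comp_G inv_G act_in)
  also have "\<dots> = (\<Sum>z\<in>Z. P (act s (act (inv g) z)) (act (inv g) z))"
    using assms by (intro sum.cong refl) (simp add: P_shift inv_G act_in)
  also have "\<dots> = chr s"
    unfolding chr_def by (rule sum.reindex_bij_betw[OF act_bij[OF inv_G[OF assms(1)]]])
  finally show ?thesis .
qed

section \<open>Averages over the symmetric group and class functions\<close>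

definition avg_Sym :: "nat \<Rightarrow> ((nat \<Rightarrow> nat) \<Rightarrow> real) \<Rightarrow> real" where
  "avg_Sym n f = (\<Sum>s\<in>Sym n. f s) / fact n"

definition class_fun :: "nat \<Rightarrow> ((nat \<Rightarrow> nat) \<Rightarrow> real) \<Rightarrow> bool" where
  "class_fun n f \<longleftrightarrow> (\<forall>g\<in>Sym n. \<forall>s\<in>Sym n. f (inv g \<circ> s \<circ> g) = f s)"

lemma card_Sym: "card (Sym n) = fact n"
  by (simp add: card_permutations)

lemma finite_Sym [simp]: "finite (Sym n)"
  by (simp add: finite_permutations)

lemma mult_Sym: "perm_rep (Sym n) act Z P \<Longrightarrow> perm_rep.mult (Sym n) act Z P = avg_Sym n (perm_rep.chr act Z P)"
  by (simp add: perm_rep.mult_def avg_Sym_def card_Sym)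

lemma chr_specht:
  assumes "sum_list lam = n" "s permutes {..<n}"
  shows "perm_rep.chr (\<lambda>s x. x \<circ> s) (tabloids lam) (specht_proj lam) s = irr_char lam s"
  using assms by (simp add: perm_rep.chr_def[OF perm_rep_specht_Sym[OF assms(1)]] irr_char_eq)

lemma avg_Sym_cong: "(\<And>s. s permutes {..<n} \<Longrightarrow> f s = g s) \<Longrightarrow> avg_Sym n f = avg_Sym n g"
  by (simp add: avg_Sym_def)

lemma class_fun_chr: "perm_rep (Sym n) act Z P \<Longrightarrow> class_fun n (perm_rep.chr act Z P)"
  by (simp add: class_fun_def perm_rep.chr_conj)

lemma conj_in_Sym: "g \<in> Sym n \<Longrightarrow> s \<in> Sym n \<Longrightarrow> inv g \<circ> s \<circ> g \<in> Sym n"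
  by (simp add: permutes_compose permutes_inv)

lemma class_fun_cong:
  assumes "class_fun n f" "\<And>s. s permutes {..<n} \<Longrightarrow> f s = g s"
  shows "class_fun n g"
proof -
  have "g (inv h \<circ> s \<circ> h) = g s" if "h \<in> Sym n" "s \<in> Sym n" for h s
    using assms(1) assms(2)[of s] assms(2)[of "inv h \<circ> s \<circ> h"] conj_in_Sym[OF that] that
    by (simp add: class_fun_def)
  thus ?thesis by (simp add: class_fun_def)
qed

lemma class_fun_irr_char: "sum_list lam = n \<Longrightarrow> class_fun n (irr_char lam)"
  by (rule class_fun_cong[OF class_fun_chr[OF perm_rep_specht_Sym]]) (simp, rule chr_specht)

lemma specht_proj_nonzero: "\<exists>x\<in>tabloids lam. \<exists>y\<in>tabloids lam. specht_proj lam x y \<noteq> 0"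
proof (rule ccontr)
  assume *: "\<not> ?thesis"
  obtain t where t: "tableau lam t" using exists_tableau by blast
  interpret tableau lam t by fact
  have "polytabloid lam t \<in> specht lam" unfolding specht_eq using t by (auto intro: fun_space.span_base)
  hence "(\<Sum>y\<in>tabloids lam. specht_proj lam (tabloid lam t) y * polytabloid lam t y) = 1"
    using proj_kernel_specht polytabloid_tabloid unfolding proj_kernel_def by metis
  moreover have "(\<Sum>y\<in>tabloids lam. specht_proj lam (tabloid lam t) y * polytabloid lam t y) = 0"
    using * tabloid_in by (intro sum.neutral) auto
  ultimately show False by simp
qed

lemma specht_proj_sym: "specht_proj lam x y = specht_proj lam y x"
  using proj_kernel_specht unfolding proj_kernel_def by blast

text \<open>Invariants of the tensor product are equivariant kernels between the two Specht modules.
  For different shapes a nonzero kernel, read in both directions, would give dominance both ways;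
  for equal shapes the projection itself is such a kernel and the only one up to scalars.\<close>

lemma irr_char_orthonormal:
  assumes lam: "lam \<turnstile>\<^sub>p n" and mu: "mu \<turnstile>\<^sub>p n"
  shows "avg_Sym n (\<lambda>s. irr_char lam s * irr_char mu s) = (if lam = mu then 1 else 0)"
proof -
  let ?act = "\<lambda>s (x, y). (x \<circ> s, y \<circ> s)" and ?Z = "tabloids lam \<times> tabloids mu"
  let ?P = "\<lambda>(x, y) (x', y'). specht_proj lam x x' * specht_proj mu y y'"
  have n: "sum_list lam = n" "sum_list mu = n" using assms by (auto simp: is_partition_def)
  note reps = perm_rep_specht_Sym[OF n(1)] perm_rep_specht_Sym[OF n(2)]
  interpret R: perm_rep "Sym n" ?act ?Z ?P by (rule perm_rep_prod[OF reps])
  have mult: "avg_Sym n (\<lambda>s. irr_char lam s * irr_char mu s) = R.mult"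
    unfolding mult_Sym[OF R.perm_rep_axioms]
    by (rule avg_Sym_cong) (simp add: chr_prod[OF reps] chr_specht n)
  show ?thesis
  proof (cases "lam = mu")
    case True
    have "R.mult \<ge> 1"
    proof -
      obtain x y where xy: "x \<in> tabloids lam" "y \<in> tabloids lam" "specht_proj lam x y \<noteq> 0"
        using specht_proj_nonzero by blast
      show ?thesis
      proof (rule R.mult_ge_1[where K = "\<lambda>(x, y). specht_proj lam x y" and z = "(x, y)"])
        fix z assume "z \<in> ?Z"
        then obtain x y where [simp]: "z = (x, y)" by (cases z)
        have "(\<Sum>w\<in>?Z. ?P z w * (case w of (x, y) \<Rightarrow> specht_proj lam x y))
            = (\<Sum>x'\<in>tabloids lam. \<Sum>y'\<in>tabloids mu. specht_proj lam x x' * specht_proj mu y y' * specht_proj lam x' y')"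
          by (simp add: sum.cartesian_product case_prod_unfold)
        also have "\<dots> = (\<Sum>x'\<in>tabloids lam. specht_proj lam x x' * (\<Sum>y'\<in>tabloids lam. specht_proj lam x' y' * specht_proj lam y' y))"
          using True by (simp add: sum_distrib_left mult_ac specht_proj_sym[of _ _ y])
        also have "\<dots> = specht_proj lam x y"
          by (simp add: proj_kernel_idem[OF proj_kernel_specht])
        finally show "(\<Sum>w\<in>?Z. ?P z w * (case w of (x, y) \<Rightarrow> specht_proj lam x y)) = (case z of (x, y) \<Rightarrow> specht_proj lam x y)"
          by simp
      next
        fix s z assume "s \<in> Sym n" "z \<in> ?Z"
        thus "(case ?act s z of (x, y) \<Rightarrow> specht_proj lam x y) = (case z of (x, y) \<Rightarrow> specht_proj lam x y)"
          using True n by (auto simp: specht_proj_invariant)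
      qed (use xy True in auto)
    qed
    moreover have "R.mult \<le> 1"
    proof (rule R.mult_le_1[where L = "\<lambda>(x, y). specht_proj lam x y"])
      fix K assume K: "\<And>z. z \<in> ?Z \<Longrightarrow> (\<Sum>w\<in>?Z. ?P z w * K w) = K z"
        and inv: "\<And>s z. s \<in> Sym n \<Longrightarrow> z \<in> ?Z \<Longrightarrow> K (?act s z) = K z"
      have "\<exists>c. \<forall>x\<in>tabloids mu. \<forall>y\<in>tabloids mu. K (x, y) = c * specht_proj mu x y"
      proof (rule kernel_scalar[OF mu])
        fix x y assume xy: "x \<in> tabloids mu" "y \<in> tabloids mu"
        show "(\<Sum>y'\<in>tabloids mu. specht_proj mu y y' * K (x, y')) = K (x, y)"
          by (rule prod_kernel_fix(1)[OF reps K]) (use xy True in auto)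
        fix s assume "s permutes {..<n}"
        thus "K (x \<circ> s, y \<circ> s) = K (x, y)" using inv[of s "(x, y)"] xy True by auto
      qed
      thus "\<exists>c. \<forall>z\<in>?Z. K z = c * (case z of (x, y) \<Rightarrow> specht_proj lam x y)" using True by auto
    qed
    ultimately show ?thesis using True mult by simp
  next
    case False
    have "R.mult = 0"
    proof (rule R.mult_eq_0, intro ballI, rule ccontr)
      fix K z assume K: "\<And>z. z \<in> ?Z \<Longrightarrow> (\<Sum>w\<in>?Z. ?P z w * K w) = K z"
        and inv: "\<And>s z. s \<in> Sym n \<Longrightarrow> z \<in> ?Z \<Longrightarrow> K (?act s z) = K z" and z: "z \<in> ?Z" "K z \<noteq> 0"
      note pfix = prod_kernel_fix[OF reps K]
      have inv': "K (x \<circ> s, y \<circ> s) = K (x, y)"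
        if "s permutes {..<n}" "x \<in> tabloids lam" "y \<in> tabloids mu" for s x y
        using inv[of s "(x, y)"] that by auto
      obtain x y where xy: "z = (x, y)" "x \<in> tabloids lam" "y \<in> tabloids mu" using z by auto
      have "dominates mu lam"
        by (rule kernel_dominates[OF mu n(1), where K = "\<lambda>x y. K (x, y)" and x = x and y = y])
           (use xy z in \<open>simp_all only: pfix inv' not_False_eq_True simp_thms\<close>)
      moreover have "dominates lam mu"
        by (rule kernel_dominates[OF lam n(2), where K = "\<lambda>y x. K (x, y)" and x = y and y = x])
           (use xy z in \<open>simp_all only: pfix inv' not_False_eq_True simp_thms\<close>)
      ultimately show False using dominates_antisym False lam mu by (auto simp: is_partition_def)
    qed
    thus ?thesis using False mult by simp
  qed
qed


section \<open>Completeness of the characters\<close>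

definition partitions :: "nat \<Rightarrow> nat list set" where
  "partitions n = {lam. lam \<turnstile>\<^sub>p n}"

lemma length_partition_le: "lam \<turnstile>\<^sub>p n \<Longrightarrow> length lam \<le> n"
proof -
  have "0 \<notin> set lam \<Longrightarrow> length lam \<le> sum_list lam" by (induction lam) auto
  thus "lam \<turnstile>\<^sub>p n \<Longrightarrow> length lam \<le> n" by (auto simp: is_partition_def)
qed

lemma finite_partitions [simp]: "finite (partitions n)"
proof (rule finite_subset)
  show "partitions n \<subseteq> {lam. set lam \<subseteq> {..n} \<and> length lam \<le> n}"
    using length_partition_le by (auto simp: partitions_def is_partition_def member_le_sum_list)
qed (simp add: finite_lists_length_le)

section \<open>Cycle types and the number of conjugacy classes\<close>

lemma cycle_decomp_lists:
  assumes "cycle_decomp S p"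
  shows "(\<forall>x. x \<notin> S \<longrightarrow> p x = x) \<and> (\<forall>x\<in>S. p x \<in> S) \<and>
    (\<exists>css. distinct (concat css) \<and> set (concat css) = S \<and> [] \<notin> set css \<and>
       (\<forall>cs\<in>set css. \<forall>j<length cs. p (cs ! j) = cs ! (Suc j mod length cs)))"
  using assms
proof (induction rule: cycle_decomp.induct)
  case empty
  show ?case by (auto intro: exI[of _ "[]"])
next
  case (comp I p cs)
  let ?c = "cycle_of_list cs"
  from comp obtain css where css: "distinct (concat css)" "set (concat css) = I" "[] \<notin> set css"
    "\<And>cs' j. cs' \<in> set css \<Longrightarrow> j < length cs' \<Longrightarrow> p (cs' ! j) = cs' ! (Suc j mod length cs')" by blast
  have out: "p x = x" if "x \<notin> I" for x using comp that by blast
  have I: "p x \<in> I" if "x \<in> I" for x using comp that by blast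
  have c_in: "?c x \<in> set cs" if "x \<in> set cs" for x
    using that permutes_in_image[OF cycle_permutes] by fast
  have c_nth: "?c (cs ! j) = cs ! (Suc j mod length cs)" if "j < length cs" for j
  proof -
    have "map ?c cs = rotate1 cs" using cyclic_rotation[OF comp.hyps(2), of 1] by simp
    hence "map ?c cs ! j = rotate1 cs ! j" by simp
    thus ?thesis using that by (simp add: nth_rotate1)
  qed
  have main: "\<exists>css. distinct (concat css) \<and> set (concat css) = set cs \<union> I \<and> [] \<notin> set css \<and>
       (\<forall>cs'\<in>set css. \<forall>j<length cs'. (?c \<circ> p) (cs' ! j) = cs' ! (Suc j mod length cs'))"
  \<comment> \<open>An empty cycle changes nothing and has to be dropped, because the lengths of the
    lists become the parts of a partition.\<close>
  proof (cases "cs = []")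
    case True
    thus ?thesis using css by (intro exI[of _ css]) auto
  next
    case False
    have "(?c \<circ> p) (cs' ! j) = cs' ! (Suc j mod length cs')" if "cs' \<in> set (cs # css)" "j < length cs'" for cs' j
    proof (cases "cs' = cs")
      case True
      hence "p (cs ! j) = cs ! j" using that comp.hyps(3) by (intro out) (auto dest: nth_mem)
      thus ?thesis using c_nth True that by simp
    next
      case False
      hence cs': "cs' \<in> set css" using that by simp
      hence "p (cs' ! j) \<in> I" using css(2) that by (intro I) (auto dest: nth_mem)
      hence "?c (p (cs' ! j)) = p (cs' ! j)" using comp.hyps(3) by (intro id_outside_supp) auto
      thus ?thesis using css(4)[OF cs'] that by simp
    qed
    thus ?thesis using css False comp.hyps by (intro exI[of _ "cs # css"]) auto
  qed
  have "(?c \<circ> p) x = x" if "x \<notin> set cs \<union> I" for x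
    using that out id_outside_supp[of x cs] by simp
  moreover have "(?c \<circ> p) x \<in> set cs \<union> I" if "x \<in> set cs \<union> I" for x
  proof (cases "x \<in> I")
    case True
    hence "?c (p x) = p x" using comp.hyps(3) I[OF True] by (intro id_outside_supp) auto
    thus ?thesis using I[OF True] by simp
  next
    case False
    thus ?thesis using that c_in[of x] out[of x] by simp
  qed
  ultimately show ?case using main by blast
qed

text \<open>The rows of the tableau are the cycles of \<open>s\<close>, so shapes are cycle types and there are at most as many
  conjugacy classes as partitions.\<close>

lemma exists_cycle_tableau:
  assumes "s permutes {..<n}"
  shows "\<exists>lam t. lam \<turnstile>\<^sub>p n \<and> tableau lam t \<and>
    (\<forall>(i, j)\<in>cells lam. s (t (i, j)) = t (i, Suc j mod lam ! i))"
proof -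
  have "cycle_decomp {..<n} s" using assms by (intro cycle_decomposition) auto
  from cycle_decomp_lists[OF this] obtain css0 where css0: "distinct (concat css0)"
    "set (concat css0) = {..<n}" "[] \<notin> set css0"
    "\<forall>cs\<in>set css0. \<forall>j<length cs. s (cs ! j) = cs ! (Suc j mod length cs)"
    by (elim conjE exE)
  define css where "css = rev (sort_key length css0)"
  have m: "mset css = mset css0" by (simp add: css_def)
  hence set_css: "set css = set css0" by (rule mset_eq_setD)
  define lam where "lam = map length css"
  define t where "t = (\<lambda>(i, j). css ! i ! j)"
  have "sum_list lam = sum_list (map length css0)"
    unfolding lam_def by (metis m mset_map sum_mset_sum_list)
  also have "\<dots> = length (concat css0)" by (simp add: length_concat)
  also have "\<dots> = n" using css0(1,2) distinct_card[of "concat css0"] by simp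
  finally have n: "sum_list lam = n" .
  have "sorted (map length (sort_key length css0))" by simp
  hence "sorted_wrt (\<ge>) lam" unfolding lam_def css_def rev_map[symmetric] by (simp add: sorted_wrt_rev)
  hence part: "lam \<turnstile>\<^sub>p n" using n css0(3) set_css by (auto simp: is_partition_def lam_def)
  have "t ` cells lam = {..<n}"
  proof (intro equalityI subsetI)
    fix x assume "x \<in> t ` cells lam"
    then obtain i j where "i < length css" "j < length (css ! i)" "x = css ! i ! j"
      by (auto simp: cells_def t_def lam_def)
    hence "x \<in> set (concat css0)" using set_css nth_mem[of i css] nth_mem[of j "css ! i"] by (auto intro!: bexI[of _ "css ! i"])
    thus "x \<in> {..<n}" unfolding css0(2) .
  next
    fix x assume "x \<in> {..<n}"
    then obtain cs where "cs \<in> set css" "x \<in> set cs" using css0(2) set_css by auto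
    then obtain i j where "i < length css" "j < length (css ! i)" "x = css ! i ! j"
      by (metis in_set_conv_nth)
    hence "x = t (i, j)" "(i, j) \<in> cells lam" by (auto simp: cells_def t_def lam_def)
    thus "x \<in> t ` cells lam" by blast
  qed
  moreover from this have "inj_on t (cells lam)" using n by (intro eq_card_imp_inj_on) auto
  ultimately have tab: "tableau lam t"
    using n by unfold_locales (auto simp: is_tableau_def bij_betw_def)
  have "s (t (i, j)) = t (i, Suc j mod lam ! i)" if "(i, j) \<in> cells lam" for i j
    using that css0(4)[rule_format, of "css ! i" j] set_css nth_mem[of i css]
    by (auto simp: cells_def t_def lam_def)
  thus ?thesis using part tab by blast
qed

lemma conj_of_same_shape:
  assumes "tableau lam t" "tableau lam t'" "sum_list lam = n"
    and s: "\<forall>(i, j)\<in>cells lam. s (t (i, j)) = t (i, Suc j mod lam ! i)"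
    and s': "\<forall>(i, j)\<in>cells lam. s' (t' (i, j)) = t' (i, Suc j mod lam ! i)"
    and "s permutes {..<n}" "s' permutes {..<n}"
  shows "\<exists>g\<in>Sym n. s' = inv g \<circ> s \<circ> g"
proof -
  interpret T: tableau lam t by fact
  interpret T': tableau lam t' by fact
  define g where "g = (\<lambda>a. if a < n then t (T'.pos a) else a)"
  have "bij_betw (t \<circ> T'.pos) {..<n} {..<n}"
    using bij_betw_trans[OF T'.bij_pos T.bij_t] assms by simp
  hence "bij_betw g {..<n} {..<n}" by (rule bij_betw_cong[THEN iffD1, rotated]) (auto simp: g_def)
  hence g: "g permutes {..<n}" by (rule bij_imp_permutes) (auto simp: g_def)
  have gt: "g (t' c) = t c" if "c \<in> cells lam" for c
    using T'.t_less[OF that] T'.pos_t[OF that] assms by (simp add: g_def)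
  have "s \<circ> g = g \<circ> s'"
  proof
    fix a
    show "(s \<circ> g) a = (g \<circ> s') a"
    proof (cases "a < n")
      case True
      obtain i j where ij: "T'.pos a = (i, j)" by force
      have c: "(i, j) \<in> cells lam" and a: "t' (i, j) = a"
        using T'.pos_in[of a] T'.t_pos[of a] True ij assms by auto
      hence "(i, Suc j mod lam ! i) \<in> cells lam" by (auto simp: cells_def)
      moreover have "s (t (i, j)) = t (i, Suc j mod lam ! i)" "s' (t' (i, j)) = t' (i, Suc j mod lam ! i)"
        using s s' c by blast+
      ultimately show ?thesis using gt c a by auto
    next
      case False
      thus ?thesis using g assms by (simp add: permutes_not_in)
    qed
  qed
  moreover have "inv g \<circ> g = id" using g by (simp add: permutes_inv_o)
  ultimately have "s' = inv g \<circ> s \<circ> g" by (metis id_comp o_assoc)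
  thus ?thesis using g by blast
qed

lemma conj_comp:
  assumes "g \<in> Sym n" "h \<in> Sym n"
  shows "inv g \<circ> (inv h \<circ> s \<circ> h) \<circ> g = inv (h \<circ> g) \<circ> s \<circ> (h \<circ> g)"
  using assms by (simp add: o_inv_distrib permutes_bij o_assoc)

text \<open>By orbit counting the left-hand side is n! times the number of conjugacy classes.
  Elements of one shape are conjugate to a fixed \<open>s0\<close>; their centralizers are
  translates of the sets of g that carry \<open>s0\<close> to s, and these sets are disjoint for
  different s.\<close>

lemma sum_centralizers_le:
  "(\<Sum>s\<in>Sym n. card {g \<in> Sym n. inv g \<circ> s \<circ> g = s}) \<le> card (partitions n) * fact n"
proof -
  interpret perm_group "Sym n" by (rule perm_group_permutes) simp
  define Q where "Q = (\<lambda>s lam. \<exists>t. lam \<turnstile>\<^sub>p n \<and> tableau lam t \<and>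
    (\<forall>(i, j)\<in>cells lam. s (t (i, j)) = t (i, Suc j mod lam ! i)))"
  have "\<forall>s\<in>Sym n. \<exists>lam. Q s lam" using exists_cycle_tableau unfolding Q_def by blast
  then obtain sh where "\<forall>s\<in>Sym n. Q s (sh s)" by metis
  hence sh: "\<exists>t. sh s \<turnstile>\<^sub>p n \<and> tableau (sh s) t \<and>
      (\<forall>(i, j)\<in>cells (sh s). s (t (i, j)) = t (i, Suc j mod sh s ! i))" if "s \<in> Sym n" for s
    using that unfolding Q_def by blast
  have sh_in: "sh s \<in> partitions n" if "s \<in> Sym n" for s using sh[OF that] by (auto simp: partitions_def)
  have conj: "\<exists>g\<in>Sym n. s' = inv g \<circ> s \<circ> g" if "s \<in> Sym n" "s' \<in> Sym n" "sh s = sh s'" for s s'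
  proof -
    from sh[OF that(1)] obtain t where t: "tableau (sh s) t"
      "\<forall>(i, j)\<in>cells (sh s). s (t (i, j)) = t (i, Suc j mod sh s ! i)" by blast
    from sh[OF that(2)] that(3) obtain t' where t': "tableau (sh s) t'"
      "\<forall>(i, j)\<in>cells (sh s). s' (t' (i, j)) = t' (i, Suc j mod sh s ! i)" by auto
    show ?thesis
      by (rule conj_of_same_shape[OF t(1) t'(1) _ t(2) t'(2)]) (use that sh_in in \<open>auto simp: partitions_def is_partition_def\<close>)
  qed
  have "(\<Sum>s\<in>Sym n. card {g \<in> Sym n. inv g \<circ> s \<circ> g = s})
      = (\<Sum>lam\<in>partitions n. \<Sum>s | s \<in> Sym n \<and> sh s = lam. card {g \<in> Sym n. inv g \<circ> s \<circ> g = s})"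
    by (rule sum.group[symmetric]) (use sh_in in auto)
  also have "\<dots> \<le> (\<Sum>lam\<in>partitions n. fact n)"
  proof (rule sum_mono)
    fix lam
    let ?A = "{s \<in> Sym n. sh s = lam}"
    show "(\<Sum>s\<in>?A. card {g \<in> Sym n. inv g \<circ> s \<circ> g = s}) \<le> fact n"
    proof (cases "?A = {}")
      case True
      show ?thesis unfolding True by simp
    next
      case False
      then obtain s0 where s0: "s0 \<in> Sym n" "sh s0 = lam" by auto
      have "card {g \<in> Sym n. inv g \<circ> s \<circ> g = s} = card {g \<in> Sym n. inv g \<circ> s0 \<circ> g = s}" if s: "s \<in> ?A" for s
      proof -
        obtain h where h: "h \<in> Sym n" "s = inv h \<circ> s0 \<circ> h" using conj[of s0 s] s0 s by auto
        have "bij_betw (\<lambda>g. h \<circ> g) {g \<in> Sym n. inv g \<circ> s \<circ> g = s} {g \<in> Sym n. inv g \<circ> s0 \<circ> g = s}"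
        proof (rule bij_betw_byWitness[where f' = "\<lambda>g. inv h \<circ> g"])
          have i: "inv h \<circ> h = id" "h \<circ> inv h = id" using h by (auto simp: permutes_inv_o)
          have e: "h \<circ> (inv h \<circ> g) = g" "inv h \<circ> (h \<circ> g) = g" for g
            using i by (metis id_comp o_assoc)+
          show "\<forall>g\<in>{g \<in> Sym n. inv g \<circ> s \<circ> g = s}. inv h \<circ> (h \<circ> g) = g"
            "\<forall>g\<in>{g \<in> Sym n. inv g \<circ> s0 \<circ> g = s}. h \<circ> (inv h \<circ> g) = g" using e by auto
          show "(\<lambda>g. h \<circ> g) ` {g \<in> Sym n. inv g \<circ> s \<circ> g = s} \<subseteq> {g \<in> Sym n. inv g \<circ> s0 \<circ> g = s}"
            using conj_comp[OF _ h(1), of _ s0] h comp_G by auto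
          show "(\<lambda>g. inv h \<circ> g) ` {g \<in> Sym n. inv g \<circ> s0 \<circ> g = s} \<subseteq> {g \<in> Sym n. inv g \<circ> s \<circ> g = s}"
          proof safe
            fix g assume g: "g permutes {..<n}" "s = inv g \<circ> s0 \<circ> g"
            have ihg: "inv h \<circ> g \<in> Sym n" using g h comp_G inv_G by auto
            thus "inv h \<circ> g permutes {..<n}" by simp
            have "inv (inv h \<circ> g) \<circ> s \<circ> (inv h \<circ> g) = inv (h \<circ> (inv h \<circ> g)) \<circ> s0 \<circ> (h \<circ> (inv h \<circ> g))"
              using conj_comp[OF ihg h(1), of s0] h(2) by simp
            thus "inv (inv h \<circ> g) \<circ> (inv g \<circ> s0 \<circ> g) \<circ> (inv h \<circ> g) = inv g \<circ> s0 \<circ> g"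
              unfolding e(1) g(2)[symmetric] .
          qed
        qed
        thus ?thesis by (rule bij_betw_same_card)
      qed
      hence "(\<Sum>s\<in>?A. card {g \<in> Sym n. inv g \<circ> s \<circ> g = s}) = (\<Sum>s\<in>?A. card {g \<in> Sym n. inv g \<circ> s0 \<circ> g = s})"
        by (rule sum.cong[OF refl])
      also have "\<dots> = card (\<Union>s\<in>?A. {g \<in> Sym n. inv g \<circ> s0 \<circ> g = s})"
        by (rule card_UN_disjoint[symmetric]) auto
      also have "\<dots> \<le> card (Sym n)" by (rule card_mono) auto
      finally show ?thesis by (simp add: card_Sym)
    qed
  qed
  finally show ?thesis by simp
qed

lemma sum_if_eq_card: "finite A \<Longrightarrow> (\<Sum>x\<in>A. if P x then 1 else 0 :: real) = card {x \<in> A. P x}"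
  by (simp add: sum.If_cases Int_def)

text \<open>\<open>E\<close> and \<open>D\<close> below are the orthogonal projections onto the class functions and onto the span of the
  characters. Their difference is a projection of trace (number of classes) - (number of partitions)
  \<open>\<le> 0\<close>, hence zero.\<close>

theorem class_fun_expansion:
  assumes f: "class_fun n f" and s: "s \<in> Sym n"
  shows "f s = (\<Sum>lam\<in>partitions n. avg_Sym n (\<lambda>s. f s * irr_char lam s) * irr_char lam s)"
proof -
  interpret perm_group "Sym n" by (rule perm_group_permutes) simp
  define E where "E = (\<lambda>s t. (\<Sum>g\<in>Sym n. if inv g \<circ> s \<circ> g = t then 1 else 0 :: real) / fact n)"
  define D where "D = (\<lambda>s t. (\<Sum>lam\<in>partitions n. irr_char lam s * irr_char lam t) / fact n)"
  define F where "F = (\<lambda>s t. E s t - D s t)"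
  have E_fix: "(\<Sum>t\<in>Sym n. E s t * f t) = f s" if "class_fun n f" "s \<in> Sym n" for f s
  proof -
    have "(\<Sum>t\<in>Sym n. E s t * f t) = (\<Sum>g\<in>Sym n. \<Sum>t\<in>Sym n. if inv g \<circ> s \<circ> g = t then f t else 0) / fact n"
      unfolding E_def by (subst sum.swap) (auto simp: sum_divide_distrib sum_distrib_right intro!: sum.cong)
    also have "\<dots> = (\<Sum>g\<in>Sym n. f s) / fact n"
    proof (intro arg_cong[where f = "\<lambda>x. x / fact n"] sum.cong refl)
      fix g assume "g \<in> Sym n"
      thus "(\<Sum>t\<in>Sym n. if inv g \<circ> s \<circ> g = t then f t else 0) = f s"
        using conj_in_Sym[of g n s] that unfolding class_fun_def by (subst sum.delta') auto
    qed
    finally show ?thesis using card_Sym[of n] by simp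
  qed
  have D_sym: "D s t = D t s" for s t by (simp add: D_def mult.commute)
  have E_sym: "E s t = E t s" for s t
  proof -
    have "(\<Sum>g\<in>Sym n. if inv g \<circ> s \<circ> g = t then 1 else 0 :: real)
        = (\<Sum>g\<in>Sym n. if inv (inv g) \<circ> s \<circ> inv g = t then 1 else 0)"
      by (rule sum.reindex_bij_betw[OF inv_bij, symmetric])
    also have "\<dots> = (\<Sum>g\<in>Sym n. if inv g \<circ> t \<circ> g = s then 1 else 0)"
    proof (intro sum.cong refl)
      fix g assume "g \<in> Sym n"
      hence i: "inv g \<circ> g = id" "g \<circ> inv g = id" "inv (inv g) = g"
        by (auto simp: permutes_inv_o permutes_inv_inv)
      have "g \<circ> s \<circ> inv g = t \<longleftrightarrow> inv g \<circ> t \<circ> g = s"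
        using i by (metis comp_id id_comp o_assoc)
      thus "(if inv (inv g) \<circ> s \<circ> inv g = t then 1 else 0 :: real) = (if inv g \<circ> t \<circ> g = s then 1 else 0)"
        using i by simp
    qed
    finally show ?thesis by (simp add: E_def)
  qed
  have class_irr: "class_fun n (irr_char lam)" if "lam \<in> partitions n" for lam
    using that class_fun_irr_char by (auto simp: partitions_def is_partition_def)
  have class_D: "class_fun n (\<lambda>s. D s t)" for t
    using class_irr by (auto simp: class_fun_def D_def)
  have class_E: "class_fun n (\<lambda>s. E s t)" for t
    unfolding class_fun_def
  proof (intro ballI)
    fix h s assume h: "h \<in> Sym n" and "s \<in> Sym n"
    have "(\<Sum>g\<in>Sym n. if inv g \<circ> (inv h \<circ> s \<circ> h) \<circ> g = t then 1 else 0 :: real)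
       = (\<Sum>g\<in>Sym n. if inv (h \<circ> g) \<circ> s \<circ> (h \<circ> g) = t then 1 else 0)"
      using h by (intro sum.cong refl) (simp only: conj_comp)
    also have "\<dots> = (\<Sum>g\<in>Sym n. if inv g \<circ> s \<circ> g = t then 1 else 0)"
      by (rule sum.reindex_bij_betw[OF left_mult_bij[OF h]])
    finally show "E (inv h \<circ> s \<circ> h) t = E s t" by (simp add: E_def)
  qed
  have D_D: "(\<Sum>u\<in>Sym n. D s u * D u t) = D s t" for s t
  proof -
    have "(\<Sum>u\<in>Sym n. D s u * D u t) = (\<Sum>u\<in>Sym n. \<Sum>lam\<in>partitions n. \<Sum>mu\<in>partitions n.
        irr_char lam s * irr_char mu t * (irr_char lam u * irr_char mu u)) / (fact n * fact n)"
      by (simp add: D_def sum_product sum_divide_distrib mult_ac)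
    also have "\<dots> = (\<Sum>lam\<in>partitions n. \<Sum>mu\<in>partitions n.
        irr_char lam s * irr_char mu t * avg_Sym n (\<lambda>u. irr_char lam u * irr_char mu u)) / fact n"
      unfolding avg_Sym_def
      by (subst sum_rotate) (simp add: sum_divide_distrib sum_distrib_left mult_ac)
    also have "\<dots> = (\<Sum>lam\<in>partitions n. \<Sum>mu\<in>partitions n.
        if lam = mu then irr_char lam s * irr_char mu t else 0) / fact n"
      by (intro arg_cong[where f = "\<lambda>x. x / fact n"] sum.cong refl) (simp add: irr_char_orthonormal partitions_def)
    also have "\<dots> = D s t" by (simp add: D_def)
    finally show ?thesis .
  qed
  have F_F: "(\<Sum>u\<in>Sym n. F s u * F u t) = F s t" if "s \<in> Sym n" "t \<in> Sym n" for s t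
  proof -
    have "(\<Sum>u\<in>Sym n. F s u * F u t) = (\<Sum>u\<in>Sym n. E s u * E u t) - (\<Sum>u\<in>Sym n. E s u * D u t)
        - (\<Sum>u\<in>Sym n. E t u * D u s) + (\<Sum>u\<in>Sym n. D s u * D u t)"
      unfolding F_def E_sym[of t] D_sym[of _ s]
      by (simp add: algebra_simps sum.distrib sum_subtractf)
    also have "\<dots> = E s t - D s t - D t s + D s t"
      using that by (simp add: E_fix class_E class_D D_D)
    finally show ?thesis by (simp add: F_def D_sym[of s])
  qed
  have F_sym: "F s t = F t s" for s t by (simp add: F_def D_sym[of s] E_sym[of s])
  have "(\<Sum>s\<in>Sym n. \<Sum>t\<in>Sym n. (F s t)\<^sup>2) = (\<Sum>s\<in>Sym n. F s s)"
  proof (intro sum.cong refl)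
    fix s assume "s \<in> Sym n"
    have "(\<Sum>t\<in>Sym n. (F s t)\<^sup>2) = (\<Sum>t\<in>Sym n. F s t * F t s)"
      unfolding power2_eq_square F_sym[of _ s] ..
    thus "(\<Sum>t\<in>Sym n. (F s t)\<^sup>2) = F s s" using F_F \<open>s \<in> Sym n\<close> by simp
  qed
  \<comment> \<open>The trace of E is the sum of the centralizer orders divided by n!, hence the
    number of classes; the trace of D is the number of partitions by orthonormality.\<close>
  also have "\<dots> = real (\<Sum>s\<in>Sym n. card {g \<in> Sym n. inv g \<circ> s \<circ> g = s}) / fact n - card (partitions n)"
  proof -
    have "(\<Sum>s\<in>Sym n. D s s) = (\<Sum>lam\<in>partitions n. avg_Sym n (\<lambda>s. irr_char lam s * irr_char lam s))"
      unfolding D_def avg_Sym_def sum_divide_distrib by (rule sum.swap)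
    also have "\<dots> = card (partitions n)" by (simp add: irr_char_orthonormal partitions_def)
    finally show ?thesis
      by (simp add: F_def sum_subtractf E_def sum_if_eq_card sum_divide_distrib)
  qed
  also have "\<dots> \<le> 0"
  proof -
    have "real (\<Sum>s\<in>Sym n. card {g \<in> Sym n. inv g \<circ> s \<circ> g = s}) \<le> real (card (partitions n) * fact n)"
      using sum_centralizers_le[of n] of_nat_le_iff by blast
    thus ?thesis by (simp add: field_simps)
  qed
  finally have *: "(\<Sum>s\<in>Sym n. \<Sum>t\<in>Sym n. (F s t)\<^sup>2) \<le> 0" .
  hence "(\<Sum>s\<in>Sym n. \<Sum>t\<in>Sym n. (F s t)\<^sup>2) = 0" by (intro antisym sum_nonneg) auto
  hence "F s t = 0" if "s \<in> Sym n" "t \<in> Sym n" for s t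
    using that by (simp add: sum_nonneg_eq_0_iff sum_nonneg)
  hence "E s t = D s t" if "t \<in> Sym n" for t using that s by (simp add: F_def)
  hence "f s = (\<Sum>t\<in>Sym n. D s t * f t)" using E_fix[OF f s] by simp
  also have "\<dots> = (\<Sum>lam\<in>partitions n. \<Sum>t\<in>Sym n. irr_char lam s * (f t * irr_char lam t) / fact n)"
    unfolding D_def by (subst sum.swap) (simp add: sum_divide_distrib sum_distrib_left sum_distrib_right mult_ac)
  finally show ?thesis
    by (simp add: avg_Sym_def sum_divide_distrib sum_distrib_left mult_ac)
qed

section \<open>Burnside's lemma and permutation characters\<close>

text \<open>Two functions with the same multiset of values on A differ by a permutation of A. So
  multisets of values label the orbits, and counting orbits becomes counting multisets.\<close>

lemma burnside_types:
  fixes X :: "('a \<Rightarrow> 'b) set"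
  assumes A: "finite A" and X: "finite X"
    and closed: "\<And>r s. r \<in> X \<Longrightarrow> s permutes A \<Longrightarrow> r \<circ> s \<in> X"
    and off: "\<And>r r' x. r \<in> X \<Longrightarrow> r' \<in> X \<Longrightarrow> x \<notin> A \<Longrightarrow> r x = r' x"
  shows "(\<Sum>s | s permutes A. card {r \<in> X. r \<circ> s = r})
     = fact (card A) * card ((\<lambda>r. image_mset r (mset_set A)) ` X)"
proof -
  let ?G = "{s. s permutes A}" and ?m = "\<lambda>r. image_mset r (mset_set A)"
  have fG: "finite ?G" using A by (rule finite_permutations)
  have conj: "\<exists>h\<in>?G. r = r0 \<circ> h" if r: "r \<in> X" "r0 \<in> X" and eq: "?m r = ?m r0" for r r0
  proof -
    obtain h where h: "h permutes A" "\<forall>x\<in>A. r x = r0 (h x)"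
      using image_mset_eq_implies_permutes[OF A eq] .
    have "r x = (r0 \<circ> h) x" for x
      using h off[OF r, of x] by (cases "x \<in> A") (auto simp: permutes_not_in)
    hence "r = r0 \<circ> h" by (rule ext)
    thus ?thesis using h by auto
  qed
  have "(\<Sum>s\<in>?G. card {r \<in> X. r \<circ> s = r}) = (\<Sum>s\<in>?G. \<Sum>r\<in>X. if r \<circ> s = r then 1 else 0)"
    using X by (simp add: sum.If_cases Int_def)
  also have "\<dots> = (\<Sum>r\<in>X. \<Sum>s\<in>?G. if r \<circ> s = r then 1 else 0)" by (rule sum.swap)
  also have "\<dots> = (\<Sum>r\<in>X. card {s \<in> ?G. r \<circ> s = r})" using fG by (simp add: sum.If_cases Int_def)
  also have "\<dots> = (\<Sum>M\<in>?m ` X. \<Sum>r | r \<in> X \<and> ?m r = M. card {s \<in> ?G. r \<circ> s = r})"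
    by (rule sum.group[symmetric]) (use X in auto)
  also have "\<dots> = (\<Sum>M\<in>?m ` X. fact (card A))"
  proof (rule sum.cong[OF refl])
    fix M assume "M \<in> ?m ` X"
    then obtain r0 where r0: "r0 \<in> X" "?m r0 = M" by auto
    let ?Y = "{r \<in> X. ?m r = M}"
    have "card {s \<in> ?G. r \<circ> s = r} = card {s \<in> ?G. r0 \<circ> s = r}" if r: "r \<in> ?Y" for r
    proof -
      obtain h where h: "h permutes A" "r = r0 \<circ> h" using conj[of r r0] r r0 by auto
      have hi: "h \<circ> inv h = id" "inv h \<circ> h = id" using h by (auto simp: permutes_inv_o)
      have e: "h \<circ> (inv h \<circ> s) = s" "inv h \<circ> (h \<circ> s) = s" for s :: "'a \<Rightarrow> 'a"
        using hi by (metis id_comp o_assoc)+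
      have "r \<circ> (inv h \<circ> s) = r0 \<circ> s" for s :: "'a \<Rightarrow> 'a"
        using e(1)[of s] h(2) by (simp add: o_assoc[symmetric])
      hence "bij_betw (\<lambda>s. h \<circ> s) {s \<in> ?G. r \<circ> s = r} {s \<in> ?G. r0 \<circ> s = r}"
        using h by (intro bij_betw_byWitness[where f' = "\<lambda>s. inv h \<circ> s"])
          (auto simp: e permutes_compose permutes_inv o_assoc[symmetric])
      thus ?thesis by (rule bij_betw_same_card)
    qed
    hence "(\<Sum>r\<in>?Y. card {s \<in> ?G. r \<circ> s = r}) = (\<Sum>r\<in>?Y. card {s \<in> ?G. r0 \<circ> s = r})"
      by (rule sum.cong[OF refl])
    also have "\<dots> = card (\<Union>r\<in>?Y. {s \<in> ?G. r0 \<circ> s = r})"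
      by (rule card_UN_disjoint[symmetric]) (use X fG in auto)
    also have "(\<Union>r\<in>?Y. {s \<in> ?G. r0 \<circ> s = r}) = ?G"
      using r0 closed by (auto simp: image_mset_permutes)
    finally show "(\<Sum>r\<in>?Y. card {s \<in> ?G. r \<circ> s = r}) = fact (card A)"
      unfolding card_permutations[OF refl A] .
  qed
  finally show ?thesis by (simp add: mult.commute)
qed

definition perm_char :: "nat list \<Rightarrow> (nat \<Rightarrow> nat) \<Rightarrow> real" where
  "perm_char lam s = card {r \<in> tabloids lam. r \<circ> s = r}"

lemma chr_tabloids:
  assumes "sum_list lam = n"
  shows "perm_rep.chr (\<lambda>s x. x \<circ> s) (tabloids lam) (\<lambda>x y. if x = y then 1 else 0) s = perm_char lam s"
  by (simp add: perm_rep.chr_def[OF perm_rep_tabloids[OF assms]] perm_char_def sum_if_eq_card)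

lemma class_fun_perm_char: "sum_list lam = n \<Longrightarrow> class_fun n (perm_char lam)"
  by (rule class_fun_cong[OF class_fun_chr[OF perm_rep_tabloids]], assumption, rule chr_tabloids)

lemma tabloids_nonempty: "tabloids lam \<noteq> {}"
  using exists_tableau[of lam] tableau.tabloid_in by blast

text \<open>All tabloids of one shape have the same multiset of rows, so there is a single
  orbit.\<close>

lemma avg_perm_char:
  assumes "sum_list lam = n"
  shows "avg_Sym n (perm_char lam) = 1"
proof -
  have "(\<Sum>s\<in>Sym n. card {r \<in> tabloids lam. r \<circ> s = r})
      = fact (card {..<n}) * card ((\<lambda>r. image_mset r (mset_set {..<n})) ` tabloids lam)"
    using assms by (intro burnside_types) (auto simp: tabloids_comp, auto simp: tabloids_def)
  also have "(\<lambda>r. image_mset r (mset_set {..<n})) ` tabloids lam = {image_mset fst (mset_set (cells lam))}"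
    using tabloids_nonempty[of lam] assms by (auto simp: tabloids_def)
  finally have "(\<Sum>s\<in>Sym n. card {r \<in> tabloids lam. r \<circ> s = r}) = fact n" by (simp only: card_lessThan card.insert) simp
  hence "real (\<Sum>s\<in>Sym n. card {r \<in> tabloids lam. r \<circ> s = r}) = fact n" by (simp only: of_nat_fact)
  hence "(\<Sum>s\<in>Sym n. perm_char lam s) = fact n" unfolding perm_char_def of_nat_sum .
  thus ?thesis by (simp add: avg_Sym_def)
qed

section \<open>Joint types of three tabloids\<close>

definition row_mset :: "nat list \<Rightarrow> nat multiset" where
  "row_mset lam = image_mset fst (mset_set (cells lam))"

lemma size_row_mset [simp]: "size (row_mset lam) = sum_list lam"
  by (simp add: row_mset_def)

text \<open>Three-dimensional contingency tables with margins lam, mu and nu, encoded as multisets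
  of index triples.\<close>

definition joint_types :: "nat list \<Rightarrow> nat list \<Rightarrow> nat list \<Rightarrow> (nat \<times> nat \<times> nat) multiset set" where
  "joint_types lam mu nu = {M. image_mset fst M = row_mset lam \<and>
     image_mset (\<lambda>x. fst (snd x)) M = row_mset mu \<and> image_mset (\<lambda>x. snd (snd x)) M = row_mset nu}"

text \<open>Joining three tabloids into one function with values in triples turns the product of the
  three fixed-point counts into the fixed-point count of a single action, to which Burnside's lemma
  applies.\<close>

lemma avg_perm_char_triple:
  assumes n: "sum_list lam = n" "sum_list mu = n" "sum_list nu = n"
  shows "avg_Sym n (\<lambda>s. perm_char lam s * perm_char mu s * perm_char nu s)
    = card (joint_types lam mu nu)"
proof -
  define join :: "(nat \<Rightarrow> nat) \<times> (nat \<Rightarrow> nat) \<times> (nat \<Rightarrow> nat) \<Rightarrow> nat \<Rightarrow> nat \<times> nat \<times> nat"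
    where "join = (\<lambda>(f, g, h) x. (f x, g x, h x))"
  define X where "X = join ` (tabloids lam \<times> tabloids mu \<times> tabloids nu)"
  have inj: "inj join" by (rule injI) (auto simp: join_def fun_eq_iff)
  have join_comp: "join (f, g, h) \<circ> s = join (f \<circ> s, g \<circ> s, h \<circ> s)" for f g h s
    by (auto simp: join_def)
  have join_eq: "join p = join q \<longleftrightarrow> p = q" for p q using inj by (auto dest: injD)
  have "perm_char lam s * perm_char mu s * perm_char nu s = card {r \<in> X. r \<circ> s = r}" for s
  proof -
    have "{r \<in> X. r \<circ> s = r} = join ` ({r \<in> tabloids lam. r \<circ> s = r} \<times>
        {r \<in> tabloids mu. r \<circ> s = r} \<times> {r \<in> tabloids nu. r \<circ> s = r})"
      by (auto simp: X_def join_comp join_eq)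
    thus ?thesis
      using card_image[OF inj_on_subset[OF inj subset_UNIV]]
      by (simp add: perm_char_def card_cartesian_product mult.assoc)
  qed
  hence "avg_Sym n (\<lambda>s. perm_char lam s * perm_char mu s * perm_char nu s)
      = real (\<Sum>s\<in>Sym n. card {r \<in> X. r \<circ> s = r}) / fact n"
    by (simp add: avg_Sym_def)
  also have "(\<Sum>s\<in>Sym n. card {r \<in> X. r \<circ> s = r})
      = fact (card {..<n}) * card ((\<lambda>r. image_mset r (mset_set {..<n})) ` X)"
  proof (rule burnside_types)
    show "finite X" by (simp add: X_def)
    fix r :: "nat \<Rightarrow> nat \<times> nat \<times> nat" and s :: "nat \<Rightarrow> nat" assume "r \<in> X" "s permutes {..<n}"
    thus "r \<circ> s \<in> X" using n by (auto simp: X_def join_comp join_eq tabloids_comp intro!: imageI)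
  next
    fix r r' and x :: nat assume "r \<in> X" "r' \<in> X" "x \<notin> {..<n}"
    thus "r x = r' x" using n by (auto simp: X_def join_def tabloids_def)
  qed simp
  also have "(\<lambda>r. image_mset r (mset_set {..<n})) ` X = joint_types lam mu nu"
  proof (intro equalityI subsetI)
    fix M assume "M \<in> (\<lambda>r. image_mset r (mset_set {..<n})) ` X"
    then obtain f g h where *: "f \<in> tabloids lam" "g \<in> tabloids mu" "h \<in> tabloids nu"
      "M = image_mset (join (f, g, h)) (mset_set {..<n})" by (auto simp: X_def)
    thus "M \<in> joint_types lam mu nu"
      using n by (simp add: joint_types_def multiset.map_comp comp_def join_def tabloids_def row_mset_def)
  next
    fix M assume M: "M \<in> joint_types lam mu nu"
    obtain xs where xs: "mset xs = M" using ex_mset by blast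
    have "size (image_mset fst M) = n" using M n by (simp add: joint_types_def)
    hence len: "length xs = n" using xs by auto
    define r where "r = (\<lambda>x. if x < n then xs ! x else (0, 0, 0))"
    have rM: "image_mset r (mset_set {..<n}) = M"
    proof -
      have "image_mset r (mset_set {..<n}) = image_mset ((!) xs) (mset_set {..<n})"
        by (rule image_mset_cong) (simp add: r_def)
      also have "\<dots> = mset (map ((!) xs) [0..<n])" unfolding mset_map mset_upt lessThan_atLeast0 ..
      also have "\<dots> = M" using xs len map_nth[of xs] by simp
      finally show ?thesis .
    qed
    have comp: "image_mset (\<lambda>x. \<phi> (r x)) (mset_set {..<n}) = image_mset \<phi> M" for \<phi> :: "_ \<Rightarrow> nat"
      using rM by (simp add: multiset.map_comp comp_def flip: rM)
    have "(\<lambda>x. fst (r x)) \<in> tabloids lam" "(\<lambda>x. fst (snd (r x))) \<in> tabloids mu" "(\<lambda>x. snd (snd (r x))) \<in> tabloids nu"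
      using M n comp[of fst] comp[of "\<lambda>x. fst (snd x)"] comp[of "\<lambda>x. snd (snd x)"]
      by (auto simp: tabloids_def joint_types_def row_mset_def) (auto simp: r_def)
    moreover have "r = join (\<lambda>x. fst (r x), \<lambda>x. fst (snd (r x)), \<lambda>x. snd (snd (r x)))"
      by (simp add: join_def)
    ultimately have "r \<in> X" unfolding X_def by blast
    thus "M \<in> (\<lambda>r. image_mset r (mset_set {..<n})) ` X" using rM by blast
  qed
  finally show ?thesis by simp
qed

section \<open>Joint types of padded shapes\<close>

lemma cells_pad:
  "cells (pad \<alpha> N) = (\<lambda>j. (0, j)) ` {..<N - sum_list \<alpha>} \<union> (\<lambda>(i, j). (Suc i, j)) ` cells \<alpha>"
  unfolding cells_def pad_def by (auto simp: image_iff nth_Cons split: nat.splits)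

lemma row_mset_pad: "row_mset (pad \<alpha> N) = replicate_mset (N - sum_list \<alpha>) 0 + image_mset Suc (row_mset \<alpha>)"
proof -
  note cells_pad
  moreover have "(\<lambda>j. (0, j)) ` {..<N - sum_list \<alpha>} \<inter> (\<lambda>(i, j). (Suc i, j)) ` cells \<alpha> = {}" by auto
  ultimately have "mset_set (cells (pad \<alpha> N)) = mset_set ((\<lambda>j. (0, j)) ` {..<N - sum_list \<alpha>})
      + mset_set ((\<lambda>(i, j). (Suc i, j)) ` cells \<alpha>)"
    by (simp add: mset_set_Union)
  also have "\<dots> = image_mset (\<lambda>j. (0, j)) (mset_set {..<N - sum_list \<alpha>}) + image_mset (\<lambda>(i, j). (Suc i, j)) (mset_set (cells \<alpha>))"
    by (subst (1 2) image_mset_mset_set) (auto simp: inj_on_def)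
  finally show ?thesis
    by (simp add: row_mset_def multiset.map_comp comp_def case_prod_unfold image_mset_const_eq)
qed

lemma filter_mset_replicate: "filter_mset P (replicate_mset n x) = (if P x then replicate_mset n x else {#})"
  by (induction n) auto

lemma filter_neq_plus_replicate: "M = filter_mset (\<lambda>x. x \<noteq> z) M + replicate_mset (count M z) z"
  by (rule multiset_eqI) simp

lemma image_mset_pad_iff:
  assumes "size M = N" "sum_list \<alpha> \<le> N"
  shows "image_mset f M = row_mset (pad \<alpha> N) \<longleftrightarrow>
    filter_mset (\<lambda>i. i \<noteq> 0) (image_mset f M) = image_mset Suc (row_mset \<alpha>)"
proof
  assume "image_mset f M = row_mset (pad \<alpha> N)"
  thus "filter_mset (\<lambda>i. i \<noteq> 0) (image_mset f M) = image_mset Suc (row_mset \<alpha>)"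
    by (simp add: row_mset_pad filter_mset_eq_conv filter_mset_image_mset)
next
  assume *: "filter_mset (\<lambda>i. i \<noteq> 0) (image_mset f M) = image_mset Suc (row_mset \<alpha>)"
  let ?I = "image_mset f M"
  have I: "?I = filter_mset (\<lambda>i. i \<noteq> 0) ?I + replicate_mset (count ?I 0) 0"
    by (rule filter_neq_plus_replicate)
  have "size ?I = size (filter_mset (\<lambda>i. i \<noteq> 0) ?I) + count ?I 0"
    using arg_cong[OF I, of size] by simp
  hence "N = sum_list \<alpha> + count ?I 0" using assms(1) unfolding * by simp
  hence "count ?I 0 = N - sum_list \<alpha>" by simp
  thus "?I = row_mset (pad \<alpha> N)"
    using I unfolding * row_mset_pad by (simp add: add.commute)
qed

lemma sum_list_pad: "sum_list \<alpha> \<le> N \<Longrightarrow> sum_list (pad \<alpha> N) = N"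
  by (simp add: pad_def)

text \<open>For large \<open>N\<close> the multiplicity of \<open>(0, 0, 0)\<close> is determined by the rest of the joint type, and the
  conditions on the rest do not involve \<open>N\<close>.\<close>

lemma card_joint_types_pad:
  assumes N: "N \<ge> sum_list \<alpha> + sum_list \<beta> + sum_list \<gamma>"
  shows "card (joint_types (pad \<alpha> N) (pad \<beta> N) (pad \<gamma> N))
    = card {M. (0, 0, 0) \<notin># M \<and>
        filter_mset (\<lambda>i. i \<noteq> 0) (image_mset fst M) = image_mset Suc (row_mset \<alpha>) \<and>
        filter_mset (\<lambda>i. i \<noteq> 0) (image_mset (\<lambda>x. fst (snd x)) M) = image_mset Suc (row_mset \<beta>) \<and>
        filter_mset (\<lambda>i. i \<noteq> 0) (image_mset (\<lambda>x. snd (snd x)) M) = image_mset Suc (row_mset \<gamma>)}"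
    (is "card ?T = card ?U")
proof -
  have T: "M \<in> ?T \<longleftrightarrow> size M = N \<and>
        filter_mset (\<lambda>i. i \<noteq> 0) (image_mset fst M) = image_mset Suc (row_mset \<alpha>) \<and>
        filter_mset (\<lambda>i. i \<noteq> 0) (image_mset (\<lambda>x. fst (snd x)) M) = image_mset Suc (row_mset \<beta>) \<and>
        filter_mset (\<lambda>i. i \<noteq> 0) (image_mset (\<lambda>x. snd (snd x)) M) = image_mset Suc (row_mset \<gamma>)" for M
  proof -
    have "size M = N" if "image_mset fst M = row_mset (pad \<alpha> N)"
      using arg_cong[OF that, of size] N by (simp add: sum_list_pad)
    thus ?thesis using image_mset_pad_iff[of M N] N by (auto simp: joint_types_def)
  qed
  have size_U: "size M \<le> N" if "M \<in> ?U" for M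
  proof -
    have 1: "size (filter_mset (\<lambda>x. f x \<noteq> 0) M) = sum_list \<delta>"
      if "filter_mset (\<lambda>i. i \<noteq> 0) (image_mset f M) = image_mset Suc (row_mset \<delta>)" for f :: "_ \<Rightarrow> nat" and \<delta>
      using arg_cong[OF that, of size] by (simp add: filter_mset_image_mset)
    \<comment> \<open>Every triple other than (0, 0, 0) has a nonzero coordinate and is counted by
      one of the three margins. This is where the threshold for N comes from.\<close>
    have "M \<subseteq># filter_mset (\<lambda>x. fst x \<noteq> 0) M + filter_mset (\<lambda>x. fst (snd x) \<noteq> 0) M
        + filter_mset (\<lambda>x. snd (snd x) \<noteq> 0) M"
    proof (rule mset_subset_eqI)
      fix x show "count M x \<le> count (filter_mset (\<lambda>x. fst x \<noteq> 0) M + filter_mset (\<lambda>x. fst (snd x) \<noteq> 0) M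
        + filter_mset (\<lambda>x. snd (snd x) \<noteq> 0) M) x"
        using that by (cases x) (auto simp: not_in_iff)
    qed
    from size_mset_mono[OF this] show ?thesis
      using that N 1[of fst \<alpha>] 1[of "\<lambda>x. fst (snd x)" \<beta>] 1[of "\<lambda>x. snd (snd x)" \<gamma>] by auto
  qed
  let ?z = "(0, 0, 0) :: nat \<times> nat \<times> nat"
  have filt: "filter_mset (\<lambda>i. i \<noteq> 0) (image_mset f (filter_mset (\<lambda>x. x \<noteq> ?z) M)) = filter_mset (\<lambda>i. i \<noteq> 0) (image_mset f M)"
    if "f ?z = 0" for f :: "_ \<Rightarrow> nat" and M
    using that by (auto simp: filter_mset_image_mset filter_filter_mset intro!: arg_cong[where f = "image_mset f"] filter_mset_cong)
  have "bij_betw (filter_mset (\<lambda>x. x \<noteq> ?z)) ?T ?U"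
  proof (rule bij_betw_byWitness[where f' = "\<lambda>M. M + replicate_mset (N - size M) ?z"])
    show "\<forall>M\<in>?T. filter_mset (\<lambda>x. x \<noteq> ?z) M + replicate_mset (N - size (filter_mset (\<lambda>x. x \<noteq> ?z) M)) ?z = M"
    proof
      fix M assume "M \<in> ?T"
      hence s: "size M = N" using T by blast
      have M: "M = filter_mset (\<lambda>x. x \<noteq> ?z) M + replicate_mset (count M ?z) ?z"
        by (rule filter_neq_plus_replicate)
      have "size M = size (filter_mset (\<lambda>x. x \<noteq> ?z) M) + count M ?z"
        using arg_cong[OF M, of size] by simp
      thus "filter_mset (\<lambda>x. x \<noteq> ?z) M + replicate_mset (N - size (filter_mset (\<lambda>x. x \<noteq> ?z) M)) ?z = M"
        using M s by simp
    qed
    show "\<forall>M\<in>?U. filter_mset (\<lambda>x. x \<noteq> ?z) (M + replicate_mset (N - size M) ?z) = M"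
    proof
      fix M assume "M \<in> ?U"
      hence "filter_mset (\<lambda>x. x \<noteq> ?z) M = M" by (auto simp: filter_mset_eq_conv)
      thus "filter_mset (\<lambda>x. x \<noteq> ?z) (M + replicate_mset (N - size M) ?z) = M"
        by (simp only: filter_union_mset filter_mset_replicate) simp
    qed
    show "filter_mset (\<lambda>x. x \<noteq> ?z) ` ?T \<subseteq> ?U" using T filt by auto
    show "(\<lambda>M. M + replicate_mset (N - size M) ?z) ` ?U \<subseteq> ?T"
      using size_U by (auto simp: T)
  qed
  thus ?thesis by (rule bij_betw_same_card)
qed

lemma avg_perm_char_triple_stable:
  "\<exists>v. \<forall>N \<ge> sum_list \<alpha> + sum_list \<beta> + sum_list \<gamma>.
     avg_Sym N (\<lambda>s. perm_char (pad \<alpha> N) s * perm_char (pad \<beta> N) s * perm_char (pad \<gamma> N) s) = v"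
proof (intro exI allI impI)
  fix N assume N: "N \<ge> sum_list \<alpha> + sum_list \<beta> + sum_list \<gamma>"
  show "avg_Sym N (\<lambda>s. perm_char (pad \<alpha> N) s * perm_char (pad \<beta> N) s * perm_char (pad \<gamma> N) s) = real (card {M. (0, 0, 0) \<notin># M \<and>
        filter_mset (\<lambda>i. i \<noteq> 0) (image_mset fst M) = image_mset Suc (row_mset \<alpha>) \<and>
        filter_mset (\<lambda>i. i \<noteq> 0) (image_mset (\<lambda>x. fst (snd x)) M) = image_mset Suc (row_mset \<beta>) \<and>
        filter_mset (\<lambda>i. i \<noteq> 0) (image_mset (\<lambda>x. snd (snd x)) M) = image_mset Suc (row_mset \<gamma>)})"
    using N by (simp only: card_joint_types_pad[OF N, symmetric]) (rule avg_perm_char_triple; simp add: sum_list_pad)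
qed

lemma perm_char_pad_Nil: "perm_char (pad [] N) s = 1"
proof -
  have "r = (\<lambda>_. 0)" if "r \<in> tabloids (pad [] N)" for r
  proof
    fix x show "r x = 0"
    proof (cases "x < N")
      case True
      have eq: "image_mset r (mset_set {..<N}) = row_mset (pad [] N)"
        using that by (simp add: tabloids_def row_mset_def sum_list_pad)
      have "r x \<in># image_mset r (mset_set {..<N})" using True by simp
      moreover have "row_mset [] = {#}" using size_row_mset[of "[]"] by (simp only: sum_list.Nil size_eq_0_iff_empty)
      ultimately show ?thesis unfolding eq row_mset_pad by (simp only: image_mset_empty add_0_right in_replicate_mset)
    next
      case False
      thus ?thesis using that by (simp add: tabloids_def sum_list_pad)
    qed
  qed
  hence eq: "tabloids (pad [] N) = {\<lambda>_. 0}" using tabloids_nonempty[of "pad [] N"] by auto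
  have "{r \<in> tabloids (pad [] N). r \<circ> s = r} = {\<lambda>_. 0}" unfolding eq by (auto simp: comp_def)
  thus ?thesis by (simp add: perm_char_def)
qed

section \<open>Stability of the Kronecker coefficients\<close>

text \<open>These averages are the Kostka numbers, the multiplicities of Specht modules in the
  permutation modules. On the diagonal the projection kernel itself is a nonzero invariant.\<close>

lemma perm_char_irr_char:
  assumes lam: "sum_list lam = n" and mu: "mu \<turnstile>\<^sub>p n"
  shows "avg_Sym n (\<lambda>s. perm_char lam s * irr_char mu s) \<ge> 0"
    and "avg_Sym n (\<lambda>s. perm_char lam s * irr_char mu s) \<noteq> 0 \<Longrightarrow> dominates mu lam"
    and "lam = mu \<Longrightarrow> avg_Sym n (\<lambda>s. perm_char lam s * irr_char mu s) \<ge> 1"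
proof -
  let ?act = "\<lambda>s (x, y). (x \<circ> s, y \<circ> s)" and ?Z = "tabloids lam \<times> tabloids mu"
  let ?P = "\<lambda>(x, y) (x', y'). (if x = x' then 1 else 0) * specht_proj mu y y'"
  have n: "sum_list mu = n" using mu by (auto simp: is_partition_def)
  note reps = perm_rep_tabloids[OF lam] perm_rep_specht_Sym[OF n]
  interpret R: perm_rep "Sym n" ?act ?Z ?P by (rule perm_rep_prod[OF reps])
  have mult: "avg_Sym n (\<lambda>s. perm_char lam s * irr_char mu s) = R.mult"
    unfolding mult_Sym[OF R.perm_rep_axioms]
    by (rule avg_Sym_cong) (simp add: chr_prod[OF reps] chr_specht n chr_tabloids[OF lam])
  show "avg_Sym n (\<lambda>s. perm_char lam s * irr_char mu s) \<ge> 0"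
    unfolding mult by (rule R.mult_nonneg)
  show "dominates mu lam" if nz: "avg_Sym n (\<lambda>s. perm_char lam s * irr_char mu s) \<noteq> 0"
  proof (rule ccontr)
    assume nd: "\<not> dominates mu lam"
    have "R.mult = 0"
    proof (rule R.mult_eq_0, intro ballI, rule ccontr)
      fix K z assume K: "\<And>z. z \<in> ?Z \<Longrightarrow> (\<Sum>w\<in>?Z. ?P z w * K w) = K z"
        and inv: "\<And>s z. s \<in> Sym n \<Longrightarrow> z \<in> ?Z \<Longrightarrow> K (?act s z) = K z" and z: "z \<in> ?Z" "K z \<noteq> 0"
      note pfix = prod_kernel_fix(1)[OF reps K]
      have inv': "K (x \<circ> s, y \<circ> s) = K (x, y)"
        if "s permutes {..<n}" "x \<in> tabloids lam" "y \<in> tabloids mu" for s x y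
        using inv[of s "(x, y)"] that by auto
      obtain x y where xy: "z = (x, y)" "x \<in> tabloids lam" "y \<in> tabloids mu" using z by auto
      have "dominates mu lam"
        by (rule kernel_dominates[OF mu lam, where K = "\<lambda>x y. K (x, y)" and x = x and y = y])
           (use xy z in \<open>simp_all only: pfix inv' not_False_eq_True simp_thms\<close>)
      with nd show False by blast
    qed
    with nz mult show False by simp
  qed
  show "avg_Sym n (\<lambda>s. perm_char lam s * irr_char mu s) \<ge> 1" if eq: "lam = mu"
    unfolding mult
  proof -
    obtain x y where xy: "x \<in> tabloids mu" "y \<in> tabloids mu" "specht_proj mu x y \<noteq> 0"
      using specht_proj_nonzero by blast
    show "1 \<le> R.mult"
    proof (rule R.mult_ge_1[where K = "\<lambda>(x, y). specht_proj mu x y" and z = "(x, y)"])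
      fix z assume z: "z \<in> ?Z"
      then obtain x y where [simp]: "z = (x, y)" and x: "x \<in> tabloids mu" using eq by (cases z) auto
      have "(\<Sum>w\<in>?Z. ?P z w * (case w of (x, y) \<Rightarrow> specht_proj mu x y))
          = (\<Sum>x'\<in>tabloids lam. \<Sum>y'\<in>tabloids mu. (if x = x' then 1 else 0) * specht_proj mu y y' * specht_proj mu x' y')"
        by (simp add: sum.cartesian_product case_prod_unfold)
      also have "\<dots> = (\<Sum>x'\<in>tabloids mu. if x = x' then (\<Sum>y'\<in>tabloids mu. specht_proj mu y y' * specht_proj mu x' y') else 0)"
        using eq by (intro sum.cong) auto
      also have "\<dots> = (\<Sum>y'\<in>tabloids mu. specht_proj mu x y' * specht_proj mu y' y)"
        using x by (simp add: mult.commute specht_proj_sym[of _ y])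
      also have "\<dots> = specht_proj mu x y" by (rule proj_kernel_idem[OF proj_kernel_specht])
      finally show "(\<Sum>w\<in>?Z. ?P z w * (case w of (x, y) \<Rightarrow> specht_proj mu x y)) = (case z of (x, y) \<Rightarrow> specht_proj mu x y)"
        by simp
    next
      fix s z assume "s \<in> Sym n" "z \<in> ?Z"
      thus "(case ?act s z of (x, y) \<Rightarrow> specht_proj mu x y) = (case z of (x, y) \<Rightarrow> specht_proj mu x y)"
        using eq n by (auto simp: specht_proj_invariant)
    qed (use xy eq in auto)
  qed
qed

section \<open>Triangularity for padded shapes, uniformly in N\<close>

definition partitions_le :: "nat \<Rightarrow> nat list set" where
  "partitions_le a = (\<Union>b\<le>a. partitions b)"

lemma finite_partitions_le [simp]: "finite (partitions_le a)"
  by (simp add: partitions_le_def)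

lemma partitions_le_iff: "\<beta> \<in> partitions_le a \<longleftrightarrow> \<beta> \<turnstile>\<^sub>p sum_list \<beta> \<and> sum_list \<beta> \<le> a"
  by (auto simp: partitions_le_def partitions_def is_partition_def)

text \<open>The bound makes the first row longer than any part of \<beta>, and the summand 1 keeps
  it nonzero when \<beta> is empty.\<close>

lemma pad_partition:
  assumes "\<beta> \<turnstile>\<^sub>p sum_list \<beta>" "N \<ge> 2 * sum_list \<beta> + 1"
  shows "pad \<beta> N \<turnstile>\<^sub>p N"
  using assms member_le_sum_list[of _ \<beta>] by (fastforce simp: is_partition_def pad_def)

lemma inj_pad: "inj (\<lambda>\<beta>. pad \<beta> N)"
  by (rule injI) (simp add: pad_def)

text \<open>Dominance at the first row alone forces a first row of at least N - |\<alpha>| cells, so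
  at most |\<alpha>| cells remain below it, whatever N is.\<close>

lemma dominates_pad_tl:
  assumes nu: "nu \<turnstile>\<^sub>p N" and d: "dominates nu (pad \<alpha> N)" and N: "N \<ge> sum_list \<alpha> + 1"
  shows "nu = pad (tl nu) N" "tl nu \<in> partitions_le (sum_list \<alpha>)"
proof -
  have d1: "sum_list (take 1 (pad \<alpha> N)) \<le> sum_list (take 1 nu)" using d by (simp add: dominates_def)
  have "nu \<noteq> []" using d1 N by (auto simp: pad_def)
  then obtain h \<beta> where nu': "nu = h # \<beta>" by (cases nu) auto
  have "h + sum_list \<beta> = N" using nu by (simp add: nu' is_partition_def)
  moreover have "N - sum_list \<alpha> \<le> h" using d1 by (simp add: nu' pad_def)
  ultimately show "nu = pad (tl nu) N" "tl nu \<in> partitions_le (sum_list \<alpha>)"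
    using nu N by (auto simp: nu' pad_def partitions_le_iff is_partition_def)
qed

text \<open>Dominance of the padded shapes, read from the last row upwards so that N drops
  out.\<close>

definition tails_le :: "nat list \<Rightarrow> nat list \<Rightarrow> bool" where
  "tails_le \<beta> \<alpha> \<longleftrightarrow> (\<forall>k. sum_list (drop k \<beta>) \<le> sum_list (drop k \<alpha>))"

text \<open>Strictly increasing along \<open>tails_le\<close> for lists without zeros; it is the
  measure for the induction along the triangular order.\<close>

definition tail_weight :: "nat list \<Rightarrow> nat" where
  "tail_weight \<beta> = (\<Sum>k<length \<beta>. sum_list (drop k \<beta>))"

lemma sum_take_drop: "sum_list (take k xs) + sum_list (drop k xs) = sum_list (xs :: nat list)"
  by (metis append_take_drop_id sum_list_append)

lemma dominates_pad_tails:
  assumes "dominates (pad \<beta> N) (pad \<alpha> N)" "sum_list \<alpha> \<le> N" "sum_list \<beta> \<le> N"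
  shows "tails_le \<beta> \<alpha>"
  unfolding tails_le_def
proof
  fix k
  have "sum_list (take (Suc k) (pad \<alpha> N)) \<le> sum_list (take (Suc k) (pad \<beta> N))"
    using assms(1) by (simp add: dominates_def)
  thus "sum_list (drop k \<beta>) \<le> sum_list (drop k \<alpha>)"
    using sum_take_drop[of k \<alpha>] sum_take_drop[of k \<beta>] assms(2,3) by (simp add: pad_def)
qed

lemma tail_weight_less:
  assumes "tails_le \<beta> \<alpha>" "\<beta> \<noteq> \<alpha>" "0 \<notin> set \<alpha>" "0 \<notin> set \<beta>"
  shows "tail_weight \<beta> < tail_weight \<alpha>"
proof -
  define L where "L = max (length \<alpha>) (length \<beta>)"
  have tw: "tail_weight \<gamma> = (\<Sum>k<L. sum_list (drop k \<gamma>))" if "length \<gamma> \<le> L" for \<gamma>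
    unfolding tail_weight_def using that by (intro sum.mono_neutral_left) auto
  have "\<exists>k. sum_list (drop k \<beta>) \<noteq> sum_list (drop k \<alpha>)"
  proof (rule ccontr)
    assume "\<not> ?thesis"
    hence eq: "sum_list (drop k \<beta>) = sum_list (drop k \<alpha>)" for k by blast
    have "sum_list (take k \<beta>) = sum_list (take k \<alpha>)" for k
      using eq[of k] eq[of 0] sum_take_drop[of k \<alpha>] sum_take_drop[of k \<beta>] by simp
    hence "\<beta> = \<alpha>" using assms by (intro dominates_antisym) (auto simp: dominates_def)
    thus False using assms by blast
  qed
  then obtain k where k: "sum_list (drop k \<beta>) < sum_list (drop k \<alpha>)"
    using assms(1) unfolding tails_le_def by (meson le_neq_implies_less)
  hence "drop k \<alpha> \<noteq> []" by (intro notI) simp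
  hence "k < L" by (simp add: L_def)
  hence "(\<Sum>k<L. sum_list (drop k \<beta>)) < (\<Sum>k<L. sum_list (drop k \<alpha>))"
    using assms(1) k by (intro sum_strict_mono_ex1) (auto simp: tails_le_def)
  thus ?thesis using tw[of \<alpha>] tw[of \<beta>] by (simp add: L_def)
qed

text \<open>In the complete expansion only shapes dominating \<open>pad \<alpha> N\<close> survive.
  They are padded partitions of size at most |\<alpha>|, so the index set is the same for all large
  N.\<close>

lemma perm_char_expansion:
  assumes N: "N \<ge> 2 * sum_list \<alpha> + 1" and s: "s permutes {..<N}"
  shows "perm_char (pad \<alpha> N) s = (\<Sum>\<beta>\<in>partitions_le (sum_list \<alpha>).
    avg_Sym N (\<lambda>s. perm_char (pad \<alpha> N) s * irr_char (pad \<beta> N) s) * irr_char (pad \<beta> N) s)"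
proof -
  let ?k = "\<lambda>nu. avg_Sym N (\<lambda>s. perm_char (pad \<alpha> N) s * irr_char nu s)"
  have n: "sum_list (pad \<alpha> N) = N" using N by (simp add: sum_list_pad)
  have "perm_char (pad \<alpha> N) s = (\<Sum>nu\<in>partitions N. ?k nu * irr_char nu s)"
    using class_fun_expansion[OF class_fun_perm_char[OF n]] s by simp
  also have "\<dots> = (\<Sum>nu\<in>(\<lambda>\<beta>. pad \<beta> N) ` partitions_le (sum_list \<alpha>). ?k nu * irr_char nu s)"
  proof (rule sum.mono_neutral_right)
    show "(\<lambda>\<beta>. pad \<beta> N) ` partitions_le (sum_list \<alpha>) \<subseteq> partitions N"
      using N pad_partition by (fastforce simp: partitions_def partitions_le_iff)
    show "\<forall>nu\<in>partitions N - (\<lambda>\<beta>. pad \<beta> N) ` partitions_le (sum_list \<alpha>). ?k nu * irr_char nu s = 0"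
    proof
      fix nu assume nu: "nu \<in> partitions N - (\<lambda>\<beta>. pad \<beta> N) ` partitions_le (sum_list \<alpha>)"
      have "?k nu = 0"
      proof (rule ccontr)
        assume "?k nu \<noteq> 0"
        hence "dominates nu (pad \<alpha> N)"
          using perm_char_irr_char(2)[OF n] nu by (auto simp: partitions_def)
        hence "nu = pad (tl nu) N" "tl nu \<in> partitions_le (sum_list \<alpha>)"
          using dominates_pad_tl[of nu N \<alpha>] nu N by (auto simp: partitions_def)
        thus False using nu by blast
      qed
      thus "?k nu * irr_char nu s = 0" by simp
    qed
  qed simp
  also have "\<dots> = (\<Sum>\<beta>\<in>partitions_le (sum_list \<alpha>). ?k (pad \<beta> N) * irr_char (pad \<beta> N) s)"
    using inj_on_subset[OF inj_pad subset_UNIV] by (subst sum.reindex) auto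
  finally show ?thesis .
qed

section \<open>Families of class functions with stable expansions\<close>

definition char_stable :: "(nat \<Rightarrow> (nat \<Rightarrow> nat) \<Rightarrow> real) \<Rightarrow> bool" where
  "char_stable F \<longleftrightarrow> (\<exists>c S. finite S \<and> (\<forall>\<^sub>F N in sequentially. \<forall>s. s permutes {..<N} \<longrightarrow>
     F N s = (\<Sum>\<beta>\<in>S. c \<beta> * perm_char (pad \<beta> N) s)))"

lemma char_stableI:
  assumes "finite S" "\<forall>\<^sub>F N in sequentially. \<forall>s. s permutes {..<N} \<longrightarrow>
     F N s = (\<Sum>\<beta>\<in>S. c \<beta> * perm_char (pad \<beta> N) s)"
  shows "char_stable F"
  unfolding char_stable_def using assms by (intro exI conjI)

lemma char_stableE:
  assumes "char_stable F"
  obtains c S where "finite S" "\<forall>\<^sub>F N in sequentially. \<forall>s. s permutes {..<N} \<longrightarrow>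
     F N s = (\<Sum>\<beta>\<in>S. c \<beta> * perm_char (pad \<beta> N) s)"
  using assms unfolding char_stable_def by (elim exE conjE)

lemma stable_perm_char: "char_stable (\<lambda>N. perm_char (pad \<alpha> N))"
  unfolding char_stable_def by (intro exI[of _ "\<lambda>_. 1"] exI[of _ "{\<alpha>}"]) simp

lemma stable_scale:
  assumes "char_stable F" shows "char_stable (\<lambda>N s. c * F N s)"
proof -
  obtain d S where S: "finite S" and ev: "\<forall>\<^sub>F N in sequentially. \<forall>s. s permutes {..<N} \<longrightarrow>
     F N s = (\<Sum>\<beta>\<in>S. d \<beta> * perm_char (pad \<beta> N) s)"
    using \<open>char_stable F\<close> by (rule char_stableE)
  have "\<forall>\<^sub>F N in sequentially. \<forall>s. s permutes {..<N} \<longrightarrow>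
     c * F N s = (\<Sum>\<beta>\<in>S. (c * d \<beta>) * perm_char (pad \<beta> N) s)"
    using ev by eventually_elim (simp add: sum_distrib_left mult.assoc)
  with S show ?thesis by (rule char_stableI)
qed

lemma stable_add:
  assumes "char_stable F" "char_stable G" shows "char_stable (\<lambda>N s. F N s + G N s)"
proof -
  obtain d S where S: "finite S" and F: "\<forall>\<^sub>F N in sequentially. \<forall>s. s permutes {..<N} \<longrightarrow>
     F N s = (\<Sum>\<beta>\<in>S. d \<beta> * perm_char (pad \<beta> N) s)"
    using \<open>char_stable F\<close> by (rule char_stableE)
  obtain e T where T: "finite T" and G: "\<forall>\<^sub>F N in sequentially. \<forall>s. s permutes {..<N} \<longrightarrow>
     G N s = (\<Sum>\<beta>\<in>T. e \<beta> * perm_char (pad \<beta> N) s)"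
    using \<open>char_stable G\<close> by (rule char_stableE)
  define c where "c = (\<lambda>\<beta>. (if \<beta> \<in> S then d \<beta> else 0) + (if \<beta> \<in> T then e \<beta> else 0))"
  have "\<forall>\<^sub>F N in sequentially. \<forall>s. s permutes {..<N} \<longrightarrow>
     F N s + G N s = (\<Sum>\<beta>\<in>S \<union> T. c \<beta> * perm_char (pad \<beta> N) s)"
    using F G
  proof eventually_elim
    case (elim N)
    show ?case
    proof (intro allI impI)
      fix s :: "nat \<Rightarrow> nat" assume s: "s permutes {..<N}"
      have "(\<Sum>\<beta>\<in>S \<union> T. c \<beta> * perm_char (pad \<beta> N) s)
         = (\<Sum>\<beta>\<in>S \<union> T. (if \<beta> \<in> S then d \<beta> else 0) * perm_char (pad \<beta> N) s)
         + (\<Sum>\<beta>\<in>S \<union> T. (if \<beta> \<in> T then e \<beta> else 0) * perm_char (pad \<beta> N) s)"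
        by (simp add: c_def distrib_right sum.distrib)
      also have "\<dots> = F N s + G N s"
        using elim s S T
        by (intro arg_cong2[where f = "(+)"]) (simp_all, (intro sum.mono_neutral_cong_right; auto)+)
      finally show "F N s + G N s = (\<Sum>\<beta>\<in>S \<union> T. c \<beta> * perm_char (pad \<beta> N) s)" by simp
    qed
  qed
  with finite_UnI[OF S T] show ?thesis by (rule char_stableI)
qed

lemma stable_sum:
  assumes "finite I" "\<And>i. i \<in> I \<Longrightarrow> char_stable (F i)"
  shows "char_stable (\<lambda>N s. \<Sum>i\<in>I. F i N s)"
  using assms
proof (induction I rule: finite_induct)
  case empty
  show ?case unfolding char_stable_def by (intro exI[of _ "\<lambda>_. 0"] exI[of _ "{}"]) simp
next
  case (insert i I)
  thus ?case using stable_add[of "F i" "\<lambda>N s. \<Sum>i\<in>I. F i N s"] by simp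
qed

lemma stable_cong:
  assumes "char_stable F" "\<forall>\<^sub>F N in sequentially. \<forall>s. s permutes {..<N} \<longrightarrow> G N s = F N s"
  shows "char_stable G"
proof -
  obtain d S where S: "finite S" and F: "\<forall>\<^sub>F N in sequentially. \<forall>s. s permutes {..<N} \<longrightarrow>
     F N s = (\<Sum>\<beta>\<in>S. d \<beta> * perm_char (pad \<beta> N) s)"
    using \<open>char_stable F\<close> by (rule char_stableE)
  have "\<forall>\<^sub>F N in sequentially. \<forall>s. s permutes {..<N} \<longrightarrow> G N s = (\<Sum>\<beta>\<in>S. d \<beta> * perm_char (pad \<beta> N) s)"
    using F assms(2) by eventually_elim simp
  with S show ?thesis by (rule char_stableI)
qed

lemma sum_product3:
  fixes f g h :: "_ \<Rightarrow> real"
  shows "(\<Sum>a\<in>A. f a) * (\<Sum>b\<in>B. g b) * (\<Sum>c\<in>C. h c) = (\<Sum>a\<in>A. \<Sum>b\<in>B. \<Sum>c\<in>C. f a * g b * h c)"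
  unfolding sum_product[of f A g B] by (simp only: sum_distrib_right, simp only: sum_distrib_left)

lemma avg_Sym_sum: "avg_Sym n (\<lambda>s. \<Sum>i\<in>I. f i s) = (\<Sum>i\<in>I. avg_Sym n (f i))"
  by (simp add: avg_Sym_def sum_divide_distrib, rule sum.swap)

lemma avg_Sym_scale: "avg_Sym n (\<lambda>s. c * f s) = c * avg_Sym n f"
  by (simp add: avg_Sym_def sum_distrib_left)

text \<open>Expanding the product leaves finitely many averages of three permutation characters.
  Each is constant once N exceeds the sizes involved, and B is a common threshold for all of
  them.\<close>

lemma stable_triple:
  assumes "char_stable F" "char_stable G" "char_stable H"
  shows "\<exists>v. \<forall>\<^sub>F N in sequentially. avg_Sym N (\<lambda>s. F N s * G N s * H N s) = v"
proof -
  obtain d S where S: "finite S" and F: "\<forall>\<^sub>F N in sequentially. \<forall>s. s permutes {..<N} \<longrightarrow>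
     F N s = (\<Sum>\<beta>\<in>S. d \<beta> * perm_char (pad \<beta> N) s)"
    using \<open>char_stable F\<close> by (rule char_stableE)
  obtain e T where T: "finite T" and G: "\<forall>\<^sub>F N in sequentially. \<forall>s. s permutes {..<N} \<longrightarrow>
     G N s = (\<Sum>\<beta>\<in>T. e \<beta> * perm_char (pad \<beta> N) s)"
    using \<open>char_stable G\<close> by (rule char_stableE)
  obtain f U where U: "finite U" and H: "\<forall>\<^sub>F N in sequentially. \<forall>s. s permutes {..<N} \<longrightarrow>
     H N s = (\<Sum>\<beta>\<in>U. f \<beta> * perm_char (pad \<beta> N) s)"
    using \<open>char_stable H\<close> by (rule char_stableE)
  from avg_perm_char_triple_stable obtain v where v: "\<And>\<alpha> \<beta> \<gamma> N. N \<ge> sum_list \<alpha> + sum_list \<beta> + sum_list \<gamma> \<Longrightarrow>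
     avg_Sym N (\<lambda>s. perm_char (pad \<alpha> N) s * perm_char (pad \<beta> N) s * perm_char (pad \<gamma> N) s) = v \<alpha> \<beta> \<gamma>"
    by metis
  define B where "B = (\<Sum>\<alpha>\<in>S. sum_list \<alpha>) + (\<Sum>\<alpha>\<in>T. sum_list \<alpha>) + (\<Sum>\<alpha>\<in>U. sum_list \<alpha>)"
  have B: "sum_list \<alpha> + sum_list \<beta> + sum_list \<gamma> \<le> B" if "\<alpha> \<in> S" "\<beta> \<in> T" "\<gamma> \<in> U" for \<alpha> \<beta> \<gamma>
    unfolding B_def using that S T U by (intro add_mono member_le_sum) auto
  have "\<forall>\<^sub>F N in sequentially. avg_Sym N (\<lambda>s. F N s * G N s * H N s)
     = (\<Sum>\<alpha>\<in>S. \<Sum>\<beta>\<in>T. \<Sum>\<gamma>\<in>U. (d \<alpha> * e \<beta> * f \<gamma>) * v \<alpha> \<beta> \<gamma>)"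
    using F G H eventually_ge_at_top[of B]
  proof eventually_elim
    case (elim N)
    have "avg_Sym N (\<lambda>s. F N s * G N s * H N s) = avg_Sym N (\<lambda>s. \<Sum>\<alpha>\<in>S. \<Sum>\<beta>\<in>T. \<Sum>\<gamma>\<in>U.
       (d \<alpha> * e \<beta> * f \<gamma>) * (perm_char (pad \<alpha> N) s * perm_char (pad \<beta> N) s * perm_char (pad \<gamma> N) s))"
      using elim by (intro avg_Sym_cong) (simp add: sum_product3, simp add: mult_ac)
    also have "\<dots> = (\<Sum>\<alpha>\<in>S. \<Sum>\<beta>\<in>T. \<Sum>\<gamma>\<in>U. (d \<alpha> * e \<beta> * f \<gamma>) * v \<alpha> \<beta> \<gamma>)"
      unfolding avg_Sym_sum avg_Sym_scale
      by (intro sum.cong refl arg_cong2[where f = "(*)"] v order_trans[OF B elim(4)])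
    finally show ?case .
  qed
  thus ?thesis by blast
qed

text \<open>The constant 1 is the permutation character of the one-row shape, so that averages of
  pairs are a case of averages of triples.\<close>

lemma stable_one: "char_stable (\<lambda>N s. 1)"
proof -
  have "perm_char (pad [] N) = (\<lambda>s. 1)" for N by (rule ext) (rule perm_char_pad_Nil)
  thus ?thesis using stable_perm_char[of "[]"] by simp
qed

lemma stable_pair:
  assumes "char_stable F" "char_stable G"
  shows "\<exists>v. \<forall>\<^sub>F N in sequentially. avg_Sym N (\<lambda>s. F N s * G N s) = v"
  using stable_triple[OF assms stable_one] by simp

text \<open>Gram-Schmidt: up to a positive factor the character of \<open>pad \<alpha> N\<close> is the permutation character minus
  its projections to earlier characters, and all inner products involved are eventually constant.\<close>

lemma stable_irr_char: "\<alpha> \<turnstile>\<^sub>p sum_list \<alpha> \<Longrightarrow> char_stable (\<lambda>N. irr_char (pad \<alpha> N))"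
proof (induction \<alpha> rule: measure_induct_rule[of tail_weight])
  case (less \<alpha>)
  let ?a = "sum_list \<alpha>"
  define R where "R = {\<beta> \<in> partitions_le ?a. \<beta> \<noteq> \<alpha> \<and> tails_le \<beta> \<alpha>}"
  define k where "k = (\<lambda>\<beta> N. avg_Sym N (\<lambda>s. perm_char (pad \<alpha> N) s * irr_char (pad \<beta> N) s))"
  have fR: "finite R" by (simp add: R_def)
  have stR: "char_stable (\<lambda>N. irr_char (pad \<beta> N))" if "\<beta> \<in> R" for \<beta>
    using that less.prems by (intro less.IH tail_weight_less) (auto simp: R_def partitions_le_iff is_partition_def)
  have "\<exists>v. \<forall>\<^sub>F N in sequentially. k \<beta> N = v" if "\<beta> \<in> R" for \<beta>
    unfolding k_def using stable_pair[OF stable_perm_char stR[OF that]] .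
  then obtain v where v: "\<And>\<beta>. \<beta> \<in> R \<Longrightarrow> \<forall>\<^sub>F N in sequentially. k \<beta> N = v \<beta>" by metis
  define F where "F = (\<lambda>N s. perm_char (pad \<alpha> N) s + (\<Sum>\<beta>\<in>R. (- v \<beta>) * irr_char (pad \<beta> N) s))"
  have stF: "char_stable F"
    unfolding F_def by (intro stable_add stable_perm_char stable_sum fR stable_scale stR)
  have evR: "\<forall>\<^sub>F N in sequentially. \<forall>\<beta>\<in>R. k \<beta> N = v \<beta>"
    using v fR by (simp add: eventually_ball_finite_distrib)
  have evF: "\<forall>\<^sub>F N in sequentially. (\<forall>s. s permutes {..<N} \<longrightarrow> F N s = k \<alpha> N * irr_char (pad \<alpha> N) s) \<and> k \<alpha> N \<ge> 1
      \<and> avg_Sym N (\<lambda>s. irr_char (pad \<alpha> N) s * irr_char (pad \<alpha> N) s) = 1"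
    using evR eventually_ge_at_top[of "2 * ?a + 1"]
  proof eventually_elim
    case (elim N)
    have part: "pad \<beta> N \<turnstile>\<^sub>p N" if "\<beta> \<in> partitions_le ?a" for \<beta>
      using that elim by (intro pad_partition) (auto simp: partitions_le_iff)
    have \<alpha>: "\<alpha> \<in> partitions_le ?a" using less.prems by (simp add: partitions_le_iff)
    have n: "sum_list (pad \<alpha> N) = N" using elim by (simp add: sum_list_pad)
    have zero: "k \<beta> N = 0" if "\<beta> \<in> partitions_le ?a" "\<not> tails_le \<beta> \<alpha>" for \<beta>
      using perm_char_irr_char(2)[OF n part[OF that(1)]] dominates_pad_tails[of \<beta> N \<alpha>] that elim
      unfolding k_def by (auto simp: partitions_le_iff)
    have "F N s = k \<alpha> N * irr_char (pad \<alpha> N) s" if s: "s permutes {..<N}" for s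
    proof -
      have "perm_char (pad \<alpha> N) s = (\<Sum>\<beta>\<in>partitions_le ?a. k \<beta> N * irr_char (pad \<beta> N) s)"
        using perm_char_expansion[OF elim(2) s] by (simp add: k_def)
      also have "\<dots> = (\<Sum>\<beta>\<in>insert \<alpha> R. k \<beta> N * irr_char (pad \<beta> N) s)"
        using \<alpha> zero by (intro sum.mono_neutral_right) (auto simp: R_def)
      also have "\<dots> = k \<alpha> N * irr_char (pad \<alpha> N) s + (\<Sum>\<beta>\<in>R. v \<beta> * irr_char (pad \<beta> N) s)"
        using fR elim(1) by (subst sum.insert) (auto simp: R_def)
      finally show ?thesis by (simp add: F_def sum_negf)
    qed
    moreover have "k \<alpha> N \<ge> 1"
      unfolding k_def using perm_char_irr_char(3)[OF n part[OF \<alpha>]] by simp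
    ultimately show ?case using irr_char_orthonormal[OF part[OF \<alpha>] part[OF \<alpha>]] by simp
  qed
  obtain w where "\<forall>\<^sub>F N in sequentially. avg_Sym N (\<lambda>s. F N s * F N s) = w"
    using stable_pair[OF stF stF] by blast
  hence "\<forall>\<^sub>F N in sequentially. \<forall>s. s permutes {..<N} \<longrightarrow> irr_char (pad \<alpha> N) s = (1 / sqrt w) * F N s"
    using evF
  proof eventually_elim
    case (elim N)
    have "w = avg_Sym N (\<lambda>s. F N s * F N s)" using elim by simp
    also have "\<dots> = avg_Sym N (\<lambda>s. (k \<alpha> N)\<^sup>2 * (irr_char (pad \<alpha> N) s * irr_char (pad \<alpha> N) s))"
      using elim by (intro avg_Sym_cong) (simp add: power2_eq_square)
    also have "\<dots> = (k \<alpha> N)\<^sup>2" using elim by (simp add: avg_Sym_scale)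
    finally have "sqrt w = k \<alpha> N" using elim by simp
    thus ?case using elim by auto
  qed
  thus ?case by (rule stable_cong[OF stable_scale[OF stF]])
qed

lemma kronecker_eq_avg:
  assumes "sum_list lam = n"
  shows "kronecker lam mu nu = avg_Sym n (\<lambda>s. irr_char lam s * irr_char mu s * irr_char nu s)"
  using assms by (simp add: kronecker_def avg_Sym_def)

theorem eventually_reduced_kronecker:
  assumes "\<alpha> \<turnstile>\<^sub>p a" "\<beta> \<turnstile>\<^sub>p b" "\<gamma> \<turnstile>\<^sub>p c"
  shows "\<forall>\<^sub>F N in sequentially. kronecker (pad \<alpha> N) (pad \<beta> N) (pad \<gamma> N) = reduced_kronecker \<alpha> \<beta> \<gamma>"
proof -
  have "char_stable (\<lambda>N. irr_char (pad \<delta> N))" if "\<delta> \<turnstile>\<^sub>p d" for \<delta> d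
    using that by (intro stable_irr_char) (simp add: is_partition_def)
  from stable_triple[OF this[OF assms(1)] this[OF assms(2)] this[OF assms(3)]]
  obtain v where v: "\<forall>\<^sub>F N in sequentially.
     avg_Sym N (\<lambda>s. irr_char (pad \<alpha> N) s * irr_char (pad \<beta> N) s * irr_char (pad \<gamma> N) s) = v" by blast
  have ev: "\<forall>\<^sub>F N in sequentially. kronecker (pad \<alpha> N) (pad \<beta> N) (pad \<gamma> N) = v"
    using v eventually_ge_at_top[of "sum_list \<alpha>"]
    by eventually_elim (simp add: kronecker_eq_avg[OF sum_list_pad])
  have "(\<lambda>N. kronecker (pad \<alpha> N) (pad \<beta> N) (pad \<gamma> N)) \<longlonglongrightarrow> v"
    by (rule tendsto_eventually[OF ev])
  hence "reduced_kronecker \<alpha> \<beta> \<gamma> = v" unfolding reduced_kronecker_def by (rule limI)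
  thus ?thesis using ev by simp
qed

section \<open>The lower bound\<close>

text \<open>Partitions are among the compositions. A composition of b + 1 arises from one of b by
  prepending a 1 or enlarging the first part, so the number at most doubles with b.\<close>

lemma card_partitions_le_power: "card (partitions b) \<le> 2 ^ b"
proof -
  define comps where "comps = (\<lambda>b. {xs. 0 \<notin> set xs \<and> sum_list xs = (b :: nat)})"
  have "finite (comps b) \<and> card (comps b) \<le> 2 ^ b" for b
  proof (induction b)
    case 0
    have "xs = []" if "0 \<notin> set xs" "sum_list xs = (0 :: nat)" for xs
      using that by (cases xs) auto
    hence "comps 0 = {[]}" by (auto simp: comps_def)
    thus ?case by simp
  next
    case (Suc b)
    \<comment> \<open>For b = 0 the second image contains a list built from the unspecified
      \<open>hd []\<close>; an inclusion tolerates it.\<close>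
    have sub: "comps (Suc b) \<subseteq> (\<lambda>xs. 1 # xs) ` comps b \<union> (\<lambda>xs. Suc (hd xs) # tl xs) ` comps b"
    proof
      fix xs assume xs: "xs \<in> comps (Suc b)"
      then obtain k ys where k: "xs = Suc k # ys"
        by (cases xs; cases "hd xs") (auto simp: comps_def)
      show "xs \<in> (\<lambda>xs. 1 # xs) ` comps b \<union> (\<lambda>xs. Suc (hd xs) # tl xs) ` comps b"
      proof (cases "k = 0")
        case True
        thus ?thesis using xs k by (auto simp: comps_def)
      next
        case False
        hence "k # ys \<in> comps b" using xs k by (auto simp: comps_def)
        hence "Suc (hd (k # ys)) # tl (k # ys) \<in> (\<lambda>xs. Suc (hd xs) # tl xs) ` comps b" by (rule imageI)
        thus ?thesis by (simp add: k)
      qed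
    qed
    have "card (comps (Suc b)) \<le> card ((\<lambda>xs. 1 # xs) ` comps b \<union> (\<lambda>xs. Suc (hd xs) # tl xs) ` comps b)"
      by (rule card_mono[OF _ sub]) (use Suc in auto)
    also have "\<dots> \<le> card (comps b) + card (comps b)"
      by (rule order_trans[OF card_Un_le add_mono]) (use Suc card_image_le in auto)
    finally show ?case using Suc finite_subset[OF sub] by auto
  qed
  moreover have "partitions b \<subseteq> comps b" by (auto simp: partitions_def comps_def is_partition_def)
  ultimately show ?thesis by (meson card_mono order_trans)
qed

lemma card_partitions_le: "card (partitions_le n) \<le> 2 ^ Suc n"
proof -
  have "card (partitions_le n) \<le> (\<Sum>b\<le>n. card (partitions b))"
    unfolding partitions_le_def by (rule card_UN_le) simp
  also have "\<dots> \<le> (\<Sum>b\<le>n. 2 ^ b)" by (intro sum_mono card_partitions_le_power)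
  also have "\<dots> \<le> 2 ^ Suc n" using sum_power2[of "Suc n"] by (simp add: lessThan_Suc_atMost atLeast0LessThan)
  finally show ?thesis .
qed

section \<open>The permutation character of a long row with n single cells below it\<close>

lemma row_mset_ones: "row_mset (replicate n 1) = mset_set {..<n}"
proof -
  have "cells (replicate n 1) = (\<lambda>i. (i, 0)) ` {..<n}" by (auto simp: cells_def)
  hence "mset_set (cells (replicate n 1)) = image_mset (\<lambda>i. (i, 0)) (mset_set {..<n})"
    by (simp add: image_mset_mset_set inj_on_def)
  thus ?thesis by (simp add: row_mset_def multiset.map_comp comp_def)
qed

lemma card_fibre_eq_count:
  "finite A \<Longrightarrow> card {x \<in> A. r x = v} = count (image_mset r (mset_set A)) v"
  by (simp add: count_conv_size_mset filter_mset_image_mset eq_commute)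

lemma prod_upper_eq_fact_binomial: "k \<le> m \<Longrightarrow> \<Prod>{m - k + 1..m} = fact k * (m choose k)"
proof -
  assume k: "k \<le> m"
  have "fact (m - k) * \<Prod>{m - k + 1..m} = (fact m :: nat)"
  proof -
    have "{1..m} = {1..m - k} \<union> {m - k + 1..m}" using k by auto
    hence "\<Prod>{1..m} = \<Prod>{1..m - k} * \<Prod>{m - k + 1..m}" by (simp add: prod.union_disjoint)
    thus ?thesis by (simp add: fact_prod)
  qed
  also have "\<dots> = fact (m - k) * (fact k * (m choose k))"
    using binomial_fact_lemma[OF k] by (simp add: mult_ac)
  finally show ?thesis by simp
qed

text \<open>A tabloid of this shape is the ordered list of the n entries in its single-cell rows,
  and s fixes it exactly when s fixes every entry of the list. The value is the falling factorial of
  order n of the number of fixed points.\<close>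

lemma perm_char_ones:
  assumes N: "n \<le> N" and s: "s permutes {..<N}"
  shows "perm_char (pad (replicate n 1) N) s = real (fact n * (card {x. x < N \<and> s x = x} choose n))"
proof -
  define Fx where "Fx = {x. x < N \<and> s x = x}"
  let ?T = "{r \<in> tabloids (pad (replicate n 1) N). r \<circ> s = r}"
  let ?L = "{xs. length xs = n \<and> distinct xs \<and> set xs \<subseteq> Fx}"
  have sN: "sum_list (pad (replicate n 1) N) = N" using N by (simp add: pad_def sum_list_replicate)
  have T: "r \<in> tabloids (pad (replicate n 1) N) \<longleftrightarrow> (\<forall>x\<ge>N. r x = 0) \<and>
      image_mset r (mset_set {..<N}) = replicate_mset (N - n) 0 + image_mset Suc (mset_set {..<n})" for r
    unfolding tabloids_def sN row_mset_def[symmetric] row_mset_pad row_mset_ones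
    by (simp add: sum_list_replicate)
  define f :: "nat list \<Rightarrow> nat \<Rightarrow> nat" where "f = (\<lambda>xs x. \<Sum>i<n. if xs ! i = x then Suc i else 0)"
  have f_nth: "f xs (xs ! i) = Suc i" if "xs \<in> ?L" "i < n" for xs i
  proof -
    have "f xs (xs ! i) = (\<Sum>j<n. if j = i then Suc j else 0)"
      unfolding f_def using that by (intro sum.cong) (auto simp: nth_eq_iff_index_eq)
    thus ?thesis using that by simp
  qed
  have f_out: "f xs x = 0" if "length xs = n" "x \<notin> set xs" for xs x
    using that by (auto simp: f_def)
  have f_in: "x \<in> set xs" if "length xs = n" "f xs x \<noteq> 0" for xs x
    using that f_out[of xs x] by auto
  have "bij_betw f ?L ?T"
    unfolding bij_betw_def
  proof (intro conjI equalityI subsetI)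
    show "inj_on f ?L"
    proof (rule inj_onI)
      fix xs ys assume xs: "xs \<in> ?L" and ys: "ys \<in> ?L" and eq: "f xs = f ys"
      show "xs = ys"
      proof (rule nth_equalityI)
        show "length xs = length ys" using xs ys by simp
        fix i assume "i < length xs"
        hence i: "i < n" using xs by simp
        have "f ys (xs ! i) = Suc i" using f_nth[OF xs i] eq by simp
        hence "xs ! i \<in> set ys" using f_in ys by auto
        then obtain j where j: "j < n" "ys ! j = xs ! i" using ys by (auto simp: in_set_conv_nth)
        hence "Suc j = Suc i" using f_nth[OF ys, of j] \<open>f ys (xs ! i) = Suc i\<close> by simp
        thus "xs ! i = ys ! i" using j by simp
      qed
    qed
  next
    fix r assume "r \<in> f ` ?L"
    then obtain xs where xs: "xs \<in> ?L" and r: "r = f xs" by blast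
    have set_xs: "set xs \<subseteq> {..<N}" using xs by (auto simp: Fx_def)
    have "image_mset r (mset_set {..<N}) = image_mset r (mset_set ({..<N} - set xs)) + image_mset r (mset_set (set xs))"
      using set_xs by (subst image_mset_union[symmetric], subst mset_set_Union[symmetric]) (auto simp: Un_absorb2)
    also have "image_mset r (mset_set ({..<N} - set xs)) = image_mset (\<lambda>_. 0) (mset_set ({..<N} - set xs))"
      using xs by (intro image_mset_cong) (auto simp: r f_out)
    also have "\<dots> = replicate_mset (N - n) 0"
      using xs set_xs by (simp add: image_mset_const_eq card_Diff_subset distinct_card)
    also have "image_mset r (mset_set (set xs)) = image_mset Suc (mset_set {..<n})"
    proof -
      have "mset_set (set xs) = mset xs" using xs by (simp add: mset_set_set)
      also have "mset xs = mset (map ((!) xs) [0..<n])" using xs map_nth[of xs] by simp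
      also have "\<dots> = image_mset ((!) xs) (mset_set {..<n})" unfolding mset_map mset_upt lessThan_atLeast0 ..
      finally have "image_mset r (mset_set (set xs)) = image_mset (\<lambda>i. r (xs ! i)) (mset_set {..<n})"
        by (simp add: multiset.map_comp comp_def)
      also have "\<dots> = image_mset Suc (mset_set {..<n})"
        by (intro image_mset_cong) (use f_nth[OF xs] r in auto)
      finally show ?thesis .
    qed
    finally have m: "image_mset r (mset_set {..<N}) = replicate_mset (N - n) 0 + image_mset Suc (mset_set {..<n})" .
    have "r x = 0" if "x \<ge> N" for x
      unfolding r by (rule f_out) (use that xs set_xs in auto)
    with m have "r \<in> tabloids (pad (replicate n 1) N)" using T[of r] by blast
    moreover have "r (s x) = r x" for x
    proof (cases "x \<in> set xs \<or> s x \<in> set xs")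
      case True
      have "s x = x"
      proof (cases "x \<in> set xs")
        case False
        hence "s (s x) = s x" using True xs by (auto simp: Fx_def)
        thus ?thesis using permutes_inj[OF s] by (auto dest: injD)
      qed (use xs in \<open>auto simp: Fx_def\<close>)
      thus ?thesis by simp
    next
      case False
      thus ?thesis using xs by (simp add: r f_out)
    qed
    ultimately show "r \<in> ?T" by (auto simp: fun_eq_iff)
  next
    fix r assume r: "r \<in> ?T"
    hence m: "image_mset r (mset_set {..<N}) = replicate_mset (N - n) 0 + image_mset Suc (mset_set {..<n})"
      and out: "\<And>x. x \<ge> N \<Longrightarrow> r x = 0" and rs: "\<And>x. r (s x) = r x"
      using T by (auto simp: fun_eq_iff)
    have "card {x \<in> {..<N}. r x = Suc i} = 1" if "i < n" for i
    proof -
      have "card {x \<in> {..<N}. r x = Suc i} = count (image_mset r (mset_set {..<N})) (Suc i)"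
        by (rule card_fibre_eq_count) simp
      also have "\<dots> = count (image_mset Suc (mset_set {..<n})) (Suc i)" by (simp add: m)
      also have "\<dots> = card {x \<in> {..<n}. Suc x = Suc i}" by (rule card_fibre_eq_count[symmetric]) simp
      also have "{x \<in> {..<n}. Suc x = Suc i} = {i}" using that by auto
      finally show ?thesis by simp
    qed
    hence "\<forall>i. \<exists>x. i < n \<longrightarrow> {x \<in> {..<N}. r x = Suc i} = {x}" by (meson card_1_singletonE)
    then obtain g where g: "\<And>i. i < n \<Longrightarrow> {x \<in> {..<N}. r x = Suc i} = {g i}" by metis
    have rg: "r (g i) = Suc i" "g i < N" if "i < n" for i using g[OF that] by auto
    have uniq: "x = g i" if "i < n" "r x = Suc i" for i x
      using g[OF that(1)] that(2) out[of x] by (cases "x < N") auto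
    have s_lt: "s x < N" if "x < N" for x using permutes_in_image[OF s, of x] that by simp
    have r_le: "r x < Suc n" for x
    proof (cases "x < N")
      case True
      hence "r x \<in># image_mset r (mset_set {..<N})" by simp
      thus ?thesis unfolding m by (auto split: if_splits)
    qed (simp add: out)
    define xs where "xs = map g [0..<n]"
    have xs: "xs \<in> ?L"
    proof -
      have "inj_on g {..<n}" using rg by (metis inj_onI lessThan_iff nat.inject)
      moreover have "s (g i) = g i" if "i < n" for i using uniq[OF that, of "s (g i)"] rs rg(1)[OF that] by simp
      ultimately show ?thesis using rg by (auto simp: xs_def distinct_map Fx_def lessThan_atLeast0)
    qed
    have "f xs = r"
    proof
      fix x
      show "f xs x = r x"
      proof (cases "r x")
        case 0
        have "x \<notin> set xs" using 0 rg by (auto simp: xs_def)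
        thus ?thesis using 0 f_out[of xs x] xs by simp
      next
        case (Suc i)
        hence i: "i < n" using r_le[of x] by simp
        hence "x = xs ! i" using uniq[OF i Suc] by (simp add: xs_def)
        thus ?thesis using f_nth[OF xs i] Suc by simp
      qed
    qed
    thus "r \<in> f ` ?L" using xs by blast
  qed
  hence "card ?T = card ?L" by (rule bij_betw_same_card[symmetric])
  also have "\<dots> = fact n * (card Fx choose n)"
  proof (cases "n \<le> card Fx")
    case True
    have "card ?L = \<Prod>{card Fx - n + 1..card Fx}"
      using True by (intro card_lists_distinct_length_eq) (auto simp: Fx_def)
    thus ?thesis using prod_upper_eq_fact_binomial[OF True] by simp
  next
    case False
    have "card xs' \<le> card Fx" if "xs' \<subseteq> Fx" for xs' using that by (intro card_mono) (auto simp: Fx_def)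
    hence "?L = {}" using False by (auto simp: distinct_card[symmetric])
    hence "card ?L = 0" by (simp only: card.empty)
    thus ?thesis using False by (simp add: binomial_eq_0)
  qed
  finally show ?thesis by (simp add: perm_char_def Fx_def)
qed

text \<open>Squares of falling factorials expand into falling factorials of orders \<open>2 n - k\<close>, which average to \<open>1\<close>
  over the number of fixed points.\<close>

lemma falling_square_le:
  "(fact n * (x choose n))\<^sup>2 \<le> (\<Sum>k\<le>n. (n choose k) * fact n * (fact (2 * n - k) * (x choose (2 * n - k))))"
proof (cases "n \<le> x")
  case True
  \<comment> \<open>k is the size of the overlap of two n-sets; their union has 2 n - k elements,
    which is the order of the resulting falling factorial.\<close>
  have "(x choose n) = (\<Sum>k\<le>n. (n choose k) * ((x - n) choose (n - k)))"
    using vandermonde[of n "x - n" n] True by simp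
  hence "(fact n * (x choose n))\<^sup>2
      = (\<Sum>k\<le>n. (n choose k) * (fact n * fact n * ((x choose n) * ((x - n) choose (n - k)))))"
    by (simp add: power2_eq_square sum_distrib_left sum_distrib_right mult_ac)
  also have "\<dots> \<le> (\<Sum>k\<le>n. (n choose k) * (fact n * (fact (2 * n - k) * (x choose (2 * n - k)))))"
  proof (intro sum_mono mult_left_mono)
    fix k assume "k \<in> {..n}"
    hence k: "k \<le> n" by simp
    have eq: "(x choose n) * ((x - n) choose (n - k)) = (x choose (2 * n - k)) * ((2 * n - k) choose n)"
    proof (cases "2 * n - k \<le> x")
      case True
      have "(x choose (2 * n - k)) * ((2 * n - k) choose n) = (x choose n) * ((x - n) choose (2 * n - k - n))"
        by (rule choose_mult) (use k True in auto)
      moreover have "2 * n - k - n = n - k" by simp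
      ultimately show ?thesis by simp
    next
      case False
      hence "x choose (2 * n - k) = 0" "(x - n) choose (n - k) = 0"
        using \<open>n \<le> x\<close> k by (auto intro!: binomial_eq_0)
      thus ?thesis by (simp only: mult_zero_left mult_zero_right)
    qed
    have "fact n * fact (2 * n - k - n) * ((2 * n - k) choose n) = (fact (2 * n - k) :: nat)"
      by (rule binomial_fact_lemma) (use k in simp)
    \<comment> \<open>The factor (n - k)! is at least 1 and is given away here, which leaves a bare
      binomial coefficient in front of each term.\<close>
    moreover have "fact n * 1 * ((2 * n - k) choose n) \<le> fact n * fact (2 * n - k - n) * ((2 * n - k) choose n)"
      by (intro mult_mono mult_left_mono) (auto simp: fact_ge_1)
    ultimately have "fact n * ((2 * n - k) choose n) \<le> (fact (2 * n - k) :: nat)" by simp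
    hence "fact n * ((x choose (2 * n - k)) * (fact n * ((2 * n - k) choose n)))
        \<le> fact n * ((x choose (2 * n - k)) * fact (2 * n - k))"
      by (intro mult_left_mono) auto
    thus "fact n * fact n * ((x choose n) * ((x - n) choose (n - k)))
        \<le> fact n * (fact (2 * n - k) * (x choose (2 * n - k)))"
      unfolding eq by (simp add: mult_ac)
  qed simp
  finally show ?thesis by (simp add: mult.assoc)
qed (simp add: binomial_eq_0)

lemma avg_Sym_mono: "(\<And>s. s permutes {..<n} \<Longrightarrow> f s \<le> g s) \<Longrightarrow> avg_Sym n f \<le> avg_Sym n g"
  unfolding avg_Sym_def by (intro divide_right_mono sum_mono) auto

text \<open>All orders 2 n - k are at most N, so each falling factorial in the expansion has mean 1,
  and 2^n is the row sum of the binomial coefficients.\<close>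

lemma avg_perm_char_ones_square:
  assumes N: "N \<ge> 2 * n"
  shows "avg_Sym N (\<lambda>s. (perm_char (pad (replicate n 1) N) s)\<^sup>2) \<le> 2 ^ n * fact n"
proof -
  have "(perm_char (pad (replicate n 1) N) s)\<^sup>2
      \<le> (\<Sum>k\<le>n. real ((n choose k) * fact n) * perm_char (pad (replicate (2 * n - k) 1) N) s)"
    if s: "s permutes {..<N}" for s
  proof -
    let ?x = "card {x. x < N \<and> s x = x}"
    have "(perm_char (pad (replicate n 1) N) s)\<^sup>2 = real ((fact n * (?x choose n))\<^sup>2)"
      using perm_char_ones[of n N s] N s by simp
    also have "\<dots> \<le> real (\<Sum>k\<le>n. (n choose k) * fact n * (fact (2 * n - k) * (?x choose (2 * n - k))))"
      by (intro of_nat_mono falling_square_le)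
    also have "\<dots> = (\<Sum>k\<le>n. real ((n choose k) * fact n) * perm_char (pad (replicate (2 * n - k) 1) N) s)"
      unfolding of_nat_sum of_nat_mult[of _ "fact _ * _"]
      by (intro sum.cong refl arg_cong2[where f = "(*)"] perm_char_ones[symmetric] s) (use N in auto)
    finally show ?thesis .
  qed
  hence "avg_Sym N (\<lambda>s. (perm_char (pad (replicate n 1) N) s)\<^sup>2)
      \<le> avg_Sym N (\<lambda>s. \<Sum>k\<le>n. real ((n choose k) * fact n) * perm_char (pad (replicate (2 * n - k) 1) N) s)"
    by (rule avg_Sym_mono)
  also have "\<dots> = (\<Sum>k\<le>n. real ((n choose k) * fact n) * avg_Sym N (perm_char (pad (replicate (2 * n - k) 1) N)))"
    by (simp add: avg_Sym_sum avg_Sym_scale)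
  also have "\<dots> = (\<Sum>k\<le>n. real ((n choose k) * fact n))"
    using N by (intro sum.cong refl) (simp add: avg_perm_char sum_list_pad sum_list_replicate)
  also have "\<dots> = real ((\<Sum>k\<le>n. n choose k) * fact n)" by (simp add: sum_distrib_right)
  also have "\<dots> = 2 ^ n * fact n" by (simp add: choose_row_sum)
  finally show ?thesis .
qed

lemma avg_perm_char_ones_cube:
  assumes N: "N \<ge> n"
  shows "avg_Sym N (\<lambda>s. perm_char (pad (replicate n 1) N) s * perm_char (pad (replicate n 1) N) s
    * perm_char (pad (replicate n 1) N) s) \<ge> (fact n)\<^sup>2"
proof -
  let ?p = "perm_char (pad (replicate n 1) N)"
  have "(fact n)\<^sup>2 * ?p s \<le> ?p s * ?p s * ?p s" if s: "s permutes {..<N}" for s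
  proof -
    obtain x where x: "?p s = real (fact n * (x choose n))" using perm_char_ones[OF N s] by blast
    have "(fact n)\<^sup>2 \<le> (?p s)\<^sup>2 \<or> ?p s = 0"
    proof (cases "x choose n = 0")
      case False
      hence "1 \<le> x choose n" by linarith
      hence "1 \<le> real (x choose n)" by linarith
      hence "(fact n :: real) * 1 \<le> fact n * real (x choose n)" by (intro mult_left_mono) simp_all
      thus ?thesis unfolding x by (intro disjI1 power_mono) auto
    next
      case True
      thus ?thesis using x by simp
    qed
    moreover have "?p s \<ge> 0" by (simp add: perm_char_def)
    ultimately show ?thesis
      by (auto simp: power2_eq_square intro: mult_right_mono)
  qed
  hence "avg_Sym N (\<lambda>s. (fact n)\<^sup>2 * ?p s) \<le> avg_Sym N (\<lambda>s. ?p s * ?p s * ?p s)"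
    by (rule avg_Sym_mono)
  moreover have "sum_list (pad (replicate n 1) N) = N" using N by (simp add: sum_list_pad sum_list_replicate)
  ultimately show ?thesis by (simp add: avg_Sym_scale avg_perm_char)
qed

section \<open>From the moments to the maximum\<close>

lemma finite_reduced_kronecker_values:
  "finite {reduced_kronecker \<alpha> \<beta> \<gamma> | a b c \<alpha> \<beta> \<gamma>.
     a + b + c \<le> 3 * n \<and> \<alpha> \<turnstile>\<^sub>p a \<and> \<beta> \<turnstile>\<^sub>p b \<and> \<gamma> \<turnstile>\<^sub>p c}"
proof (rule finite_subset)
  let ?Q = "partitions_le (3 * n)"
  show "{reduced_kronecker \<alpha> \<beta> \<gamma> | a b c \<alpha> \<beta> \<gamma>.
     a + b + c \<le> 3 * n \<and> \<alpha> \<turnstile>\<^sub>p a \<and> \<beta> \<turnstile>\<^sub>p b \<and> \<gamma> \<turnstile>\<^sub>p c} \<subseteq> (\<lambda>(\<alpha>, \<beta>, \<gamma>). reduced_kronecker \<alpha> \<beta> \<gamma>) ` (?Q \<times> ?Q \<times> ?Q)"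
    by (force simp: partitions_le_def partitions_def)
qed simp

lemma reduced_kronecker_le_max:
  assumes "\<alpha> \<turnstile>\<^sub>p a" "\<beta> \<turnstile>\<^sub>p b" "\<gamma> \<turnstile>\<^sub>p c" "a + b + c \<le> 3 * n"
  shows "reduced_kronecker \<alpha> \<beta> \<gamma> \<le> max_reduced_kronecker n"
  unfolding max_reduced_kronecker_def
  by (rule Max_ge[OF finite_reduced_kronecker_values]) (use assms in blast)

text \<open>With K the sum of the coefficients and G the maximum, the expanded cube gives (n!)^2
  \<le> K^3 G, while Cauchy-Schwarz gives K^2 \<le> 2^(n+1) 2^n n!. Squaring the first estimate
  before inserting the second avoids a half-integral exponent.\<close>

lemma max_reduced_kronecker_square_ge:
  "(max_reduced_kronecker n)\<^sup>2 * (2 ^ Suc n * 2 ^ n) ^ 3 \<ge> fact n"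
  and max_reduced_kronecker_pos: "max_reduced_kronecker n > 0"
proof -
  let ?Q = "partitions_le n" and ?G = "max_reduced_kronecker n"
  define \<omega> where "\<omega> = replicate n (1 :: nat)"
  have s\<omega>: "sum_list \<omega> = n" by (simp add: \<omega>_def sum_list_replicate)
  have "\<forall>\<^sub>F N in sequentially. \<forall>p\<in>?Q \<times> ?Q \<times> ?Q.
      kronecker (pad (fst p) N) (pad (fst (snd p)) N) (pad (snd (snd p)) N)
        = reduced_kronecker (fst p) (fst (snd p)) (snd (snd p))"
    by (intro eventually_ball_finite ballI)
       (auto simp: partitions_le_iff intro!: eventually_reduced_kronecker)
  then obtain N0 where N0: "\<And>N p. N \<ge> N0 \<Longrightarrow> p \<in> ?Q \<times> ?Q \<times> ?Q \<Longrightarrow>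
      kronecker (pad (fst p) N) (pad (fst (snd p)) N) (pad (snd (snd p)) N)
        = reduced_kronecker (fst p) (fst (snd p)) (snd (snd p))"
    unfolding eventually_sequentially by blast
  define N where "N = max N0 (2 * n + 1)"
  have N: "N \<ge> 2 * n + 1" "N \<ge> N0" by (auto simp: N_def)
  define k where "k = (\<lambda>\<beta>. avg_Sym N (\<lambda>s. perm_char (pad \<omega> N) s * irr_char (pad \<beta> N) s))"
  have part: "pad \<beta> N \<turnstile>\<^sub>p N" if "\<beta> \<in> ?Q" for \<beta>
    using that N by (intro pad_partition) (auto simp: partitions_le_iff)
  have n\<omega>: "sum_list (pad \<omega> N) = N" using N by (simp add: sum_list_pad s\<omega>)
  have k_nonneg: "k \<beta> \<ge> 0" if "\<beta> \<in> ?Q" for \<beta>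
    unfolding k_def by (rule perm_char_irr_char(1)[OF n\<omega> part[OF that]])
  have expand: "perm_char (pad \<omega> N) s = (\<Sum>\<beta>\<in>?Q. k \<beta> * irr_char (pad \<beta> N) s)" if "s permutes {..<N}" for s
    using perm_char_expansion[of \<omega> N s] that N by (simp add: k_def s\<omega>)
  have sq: "(\<Sum>\<beta>\<in>?Q. (k \<beta>)\<^sup>2) \<le> 2 ^ n * fact n"
  proof -
    have "(\<Sum>\<beta>\<in>?Q. (k \<beta>)\<^sup>2) = (\<Sum>\<beta>\<in>?Q. k \<beta> * avg_Sym N (\<lambda>s. perm_char (pad \<omega> N) s * irr_char (pad \<beta> N) s))"
      by (simp add: power2_eq_square k_def)
    also have "\<dots> = avg_Sym N (\<lambda>s. \<Sum>\<beta>\<in>?Q. k \<beta> * (perm_char (pad \<omega> N) s * irr_char (pad \<beta> N) s))"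
      by (simp add: avg_Sym_sum avg_Sym_scale)
    also have "\<dots> = avg_Sym N (\<lambda>s. (perm_char (pad \<omega> N) s)\<^sup>2)"
    proof (rule avg_Sym_cong)
      fix s :: "nat \<Rightarrow> nat" assume s: "s permutes {..<N}"
      have "(\<Sum>\<beta>\<in>?Q. k \<beta> * (perm_char (pad \<omega> N) s * irr_char (pad \<beta> N) s))
        = perm_char (pad \<omega> N) s * (\<Sum>\<beta>\<in>?Q. k \<beta> * irr_char (pad \<beta> N) s)"
        by (simp add: sum_distrib_left mult.left_commute)
      thus "(\<Sum>\<beta>\<in>?Q. k \<beta> * (perm_char (pad \<omega> N) s * irr_char (pad \<beta> N) s)) = (perm_char (pad \<omega> N) s)\<^sup>2"
        by (simp add: expand[OF s, symmetric] power2_eq_square)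
    qed
    also have "\<dots> \<le> 2 ^ n * fact n" unfolding \<omega>_def using N by (intro avg_perm_char_ones_square) simp
    finally show ?thesis .
  qed
  define K where "K = (\<Sum>\<beta>\<in>?Q. k \<beta>)"
  have K_nonneg: "K \<ge> 0" unfolding K_def by (intro sum_nonneg k_nonneg)
  have "K\<^sup>2 = (\<Sum>\<beta>\<in>?Q. 1 * k \<beta>)\<^sup>2" by (simp add: K_def)
  also have "\<dots> \<le> (\<Sum>\<beta>\<in>?Q. 1\<^sup>2) * (\<Sum>\<beta>\<in>?Q. (k \<beta>)\<^sup>2)" by (rule Cauchy_Schwarz_ineq_sum)
  also have "\<dots> \<le> 2 ^ Suc n * (2 ^ n * fact n)"
  proof (rule mult_mono[OF _ sq])
    have "real (card ?Q) \<le> real (2 ^ Suc n)" by (intro of_nat_mono card_partitions_le)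
    thus "(\<Sum>\<beta>\<in>?Q. 1\<^sup>2) \<le> (2 ^ Suc n :: real)" by simp
  qed (auto intro: sum_nonneg)
  finally have K2: "K\<^sup>2 \<le> 2 ^ Suc n * 2 ^ n * fact n" by (simp add: mult.assoc)
  \<comment> \<open>Each of the three partitions has size at most n, so every triple in the
    expansion competes in the maximum over total size 3 n.\<close>
  have kron_le: "avg_Sym N (\<lambda>s. irr_char (pad \<alpha> N) s * irr_char (pad \<beta> N) s * irr_char (pad \<gamma> N) s) \<le> ?G"
    if "\<alpha> \<in> ?Q" "\<beta> \<in> ?Q" "\<gamma> \<in> ?Q" for \<alpha> \<beta> \<gamma>
  proof -
    have "sum_list (pad \<alpha> N) = N" using part[OF that(1)] by (simp add: is_partition_def)
    hence "avg_Sym N (\<lambda>s. irr_char (pad \<alpha> N) s * irr_char (pad \<beta> N) s * irr_char (pad \<gamma> N) s)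
        = reduced_kronecker \<alpha> \<beta> \<gamma>"
      using N0[OF N(2), of "(\<alpha>, \<beta>, \<gamma>)"] that by (simp add: kronecker_eq_avg)
    also have "\<dots> \<le> ?G"
      by (rule reduced_kronecker_le_max) (use that in \<open>auto simp: partitions_le_iff\<close>)
    finally show ?thesis .
  qed
  have "(fact n)\<^sup>2 \<le> avg_Sym N (\<lambda>s. perm_char (pad \<omega> N) s * perm_char (pad \<omega> N) s * perm_char (pad \<omega> N) s)"
    unfolding \<omega>_def using N by (intro avg_perm_char_ones_cube) simp
  also have "\<dots> = avg_Sym N (\<lambda>s. \<Sum>\<alpha>\<in>?Q. \<Sum>\<beta>\<in>?Q. \<Sum>\<gamma>\<in>?Q. (k \<alpha> * k \<beta> * k \<gamma>) *
      (irr_char (pad \<alpha> N) s * irr_char (pad \<beta> N) s * irr_char (pad \<gamma> N) s))"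
    by (rule avg_Sym_cong) (simp add: expand sum_product3, simp add: mult_ac)
  also have "\<dots> = (\<Sum>\<alpha>\<in>?Q. \<Sum>\<beta>\<in>?Q. \<Sum>\<gamma>\<in>?Q. (k \<alpha> * k \<beta> * k \<gamma>) *
      avg_Sym N (\<lambda>s. irr_char (pad \<alpha> N) s * irr_char (pad \<beta> N) s * irr_char (pad \<gamma> N) s))"
    by (simp add: avg_Sym_sum avg_Sym_scale)
  \<comment> \<open>The coefficients are multiplicities and hence nonnegative, so each average may
    be replaced by the maximum.\<close>
  also have "\<dots> \<le> (\<Sum>\<alpha>\<in>?Q. \<Sum>\<beta>\<in>?Q. \<Sum>\<gamma>\<in>?Q. (k \<alpha> * k \<beta> * k \<gamma>) * ?G)"
    by (intro sum_mono mult_left_mono kron_le) (auto simp: k_nonneg)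
  also have "\<dots> = K ^ 3 * ?G"
    unfolding K_def power3_eq_cube sum_product3 by (simp only: sum_distrib_right)
  finally have main: "(fact n)\<^sup>2 \<le> K ^ 3 * ?G" .
  have "(0 :: real) < (fact n)\<^sup>2" by simp
  with main have pos: "0 < K ^ 3 * ?G" by linarith
  thus G: "?G > 0" using K_nonneg by (simp add: zero_less_mult_iff)
  have "((fact n :: real)\<^sup>2)\<^sup>2 \<le> (K ^ 3 * ?G)\<^sup>2" by (intro power_mono main) simp
  also have "\<dots> = (K\<^sup>2) ^ 3 * ?G\<^sup>2" by (simp add: power_mult_distrib flip: power_mult)
  also have "\<dots> \<le> (2 ^ Suc n * 2 ^ n * fact n) ^ 3 * ?G\<^sup>2"
    by (intro mult_right_mono power_mono K2) auto
  finally have "(fact n) ^ 3 * fact n \<le> (fact n :: real) ^ 3 * (?G\<^sup>2 * (2 ^ Suc n * 2 ^ n) ^ 3)"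
    by (simp add: power_mult_distrib power2_eq_square power3_eq_cube mult_ac)
  thus "?G\<^sup>2 * (2 ^ Suc n * 2 ^ n) ^ 3 \<ge> fact n" by (simp only: mult_le_cancel_left_pos zero_less_power fact_gt_zero)
qed

section \<open>Characters induced from Young subgroups\<close>

definition young :: "nat \<Rightarrow> nat \<Rightarrow> (nat \<Rightarrow> nat) set" where
  "young b N = {s. s permutes {..<N} \<and> s ` {..<b} = {..<b}}"

text \<open>The group \<open>young b N\<close> is \<open>S\<^sub>b \<times> S\<^sub>N\<^sub>-\<^sub>b\<close>. Since tabloids of size \<open>b\<close> vanish on \<open>{b..}\<close>, composition lets
  it act on them through the first factor, and \<open>ext_char \<beta>\<close> is the character of
  \<open>S(\<beta>) \<otimes> 1\<close>.\<close>

definition restr :: "nat \<Rightarrow> (nat \<Rightarrow> nat) \<Rightarrow> nat \<Rightarrow> nat" where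
  "restr b s = (\<lambda>i. if i < b then s i else i)"

definition ext_char :: "nat list \<Rightarrow> (nat \<Rightarrow> nat) \<Rightarrow> real" where
  "ext_char \<beta> s = (\<Sum>x\<in>tabloids \<beta>. specht_proj \<beta> (x \<circ> s) x)"

definition avg_young :: "nat \<Rightarrow> nat \<Rightarrow> ((nat \<Rightarrow> nat) \<Rightarrow> real) \<Rightarrow> real" where
  "avg_young b N f = (\<Sum>s\<in>young b N. f s) / card (young b N)"

text \<open>The tabloid of padded shape with first row {b..<N} and with x in the rows below; the
  successor makes room for the new row 0.\<close>

definition lift :: "nat \<Rightarrow> (nat \<Rightarrow> nat) \<Rightarrow> nat \<Rightarrow> nat" where
  "lift b x = (\<lambda>i. if i < b then Suc (x i) else 0)"

lemma perm_group_young: "perm_group (young b N)"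
proof
  show "finite (young b N)"
    by (rule finite_subset[OF _ finite_Sym[of N]]) (auto simp: young_def)
  fix s assume s: "s \<in> young b N"
  have "inv s ` {..<b} = inv s ` (s ` {..<b})" using s by (simp add: young_def)
  also have "\<dots> = {..<b}" using s by (intro image_inv_f_f) (auto simp: young_def permutes_inj)
  finally show "inv s \<in> young b N" using s by (simp add: young_def permutes_inv)
  show "bij s" using s by (auto simp: young_def permutes_bij)
  fix t assume t: "t \<in> young b N"
  have "(s \<circ> t) ` {..<b} = s ` (t ` {..<b})" by (rule image_comp[symmetric])
  also have "\<dots> = {..<b}" using s t by (simp add: young_def)
  finally show "s \<circ> t \<in> young b N" using s t by (simp only: young_def mem_Collect_eq permutes_compose)
qed (auto simp: young_def permutes_id)

lemma young_less_iff: "s \<in> young b N \<Longrightarrow> s i < b \<longleftrightarrow> i < b"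
proof -
  assume s: "s \<in> young b N"
  hence "s i \<in> s ` {..<b} \<longleftrightarrow> i \<in> {..<b}"
    by (intro inj_image_mem_iff) (auto simp: young_def permutes_inj)
  thus ?thesis using s by (simp add: young_def)
qed

lemma restr_permutes: "s \<in> young b N \<Longrightarrow> restr b s permutes {..<b}"
proof (rule bij_imp_permutes)
  assume s: "s \<in> young b N"
  hence "bij_betw s {..<b} {..<b}"
    by (auto simp: young_def bij_betw_def intro: permutes_inj_on)
  thus "bij_betw (restr b s) {..<b} {..<b}"
    by (rule bij_betw_cong[THEN iffD1, rotated]) (auto simp: restr_def)
qed (auto simp: restr_def)

lemma comp_restr:
  assumes "s \<in> young b N" "\<And>i. i \<ge> b \<Longrightarrow> x i = 0"
  shows "x \<circ> s = x \<circ> restr b s"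
proof
  fix i
  have "b \<le> s i \<longleftrightarrow> b \<le> i" using young_less_iff[OF assms(1), of i] by linarith
  thus "(x \<circ> s) i = (x \<circ> restr b s) i"
    using assms(2)[of i] assms(2)[of "s i"] by (cases "i < b") (simp_all add: restr_def)
qed

lemma tabloids_out: "x \<in> tabloids \<beta> \<Longrightarrow> i \<ge> sum_list \<beta> \<Longrightarrow> x i = 0"
  by (simp add: tabloids_def)

lemma comp_restr_tabloids:
  assumes "s \<in> young b N" "x \<in> tabloids \<beta>" "sum_list \<beta> = b"
  shows "x \<circ> s = x \<circ> restr b s"
proof (rule comp_restr[OF assms(1)])
  fix i assume "b \<le> i"
  thus "x i = 0" using tabloids_out[OF assms(2), of i] assms(3) by simp
qed

lemma perm_rep_young_small:
  assumes "sum_list \<beta> = b"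
  shows "perm_rep (young b N) (\<lambda>s x. x \<circ> s) (tabloids \<beta>) (specht_proj \<beta>)"
proof (rule perm_rep_specht[OF perm_group_young])
  fix s assume s: "s \<in> young b N"
  show "\<exists>s'. s' permutes {..<sum_list \<beta>} \<and> (\<forall>x\<in>tabloids \<beta>. x \<circ> s = x \<circ> s')"
    using restr_permutes[OF s] comp_restr_tabloids[OF s _ assms] assms
    by (intro exI[of _ "restr b s"]) simp
qed

lemma perm_rep_young_big:
  assumes "sum_list \<nu> = N"
  shows "perm_rep (young b N) (\<lambda>s x. x \<circ> s) (tabloids \<nu>) (specht_proj \<nu>)"
  by (rule perm_rep_specht[OF perm_group_young]) (use assms in \<open>auto simp: young_def\<close>)

lemma ext_char_eq:
  assumes "sum_list \<beta> = b" "s \<in> young b N"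
  shows "ext_char \<beta> s = irr_char \<beta> (restr b s)"
proof -
  have "restr b s permutes {..<sum_list \<beta>}" using restr_permutes[OF assms(2)] assms(1) by simp
  thus ?thesis
    unfolding ext_char_def irr_char_eq[OF \<open>restr b s permutes _\<close>]
  proof (intro sum.cong refl)
    fix x assume "x \<in> tabloids \<beta>"
    hence "x \<circ> s = x \<circ> restr b s" by (rule comp_restr_tabloids[OF assms(2) _ assms(1)])
    thus "specht_proj \<beta> (x \<circ> s) x = specht_proj \<beta> (x \<circ> restr b s) x" by simp
  qed
qed

lemma perm_rep_young_prod:
  assumes "sum_list \<beta> = b" "sum_list \<nu> = N"
  shows "perm_rep (young b N) (\<lambda>s (x, y). (x \<circ> s, y \<circ> s)) (tabloids \<beta> \<times> tabloids \<nu>)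
    (\<lambda>(x, y) (x', y'). specht_proj \<beta> x x' * specht_proj \<nu> y y')"
  by (rule perm_rep_prod[OF perm_rep_young_small[OF assms(1)] perm_rep_young_big[OF assms(2)]])

lemma avg_young_eq_mult:
  assumes "sum_list \<beta> = b" "sum_list \<nu> = N"
  shows "avg_young b N (\<lambda>s. ext_char \<beta> s * irr_char \<nu> s)
    = perm_rep.mult (young b N) (\<lambda>s (x, y). (x \<circ> s, y \<circ> s)) (tabloids \<beta> \<times> tabloids \<nu>)
    (\<lambda>(x, y) (x', y'). specht_proj \<beta> x x' * specht_proj \<nu> y y')"
  unfolding avg_young_def perm_rep.mult_def[OF perm_rep_young_prod[OF assms]]
    chr_prod[OF perm_rep_young_small[OF assms(1)] perm_rep_young_big[OF assms(2)]]
    perm_rep.chr_def[OF perm_rep_young_small[OF assms(1)]]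
    perm_rep.chr_def[OF perm_rep_young_big[OF assms(2)]]
  by (intro arg_cong2[where f = "(/)"] sum.cong refl)
     (use assms in \<open>auto simp: young_def ext_char_def irr_char_eq\<close>)

lemma avg_young_nonneg:
  assumes "sum_list \<beta> = b" "sum_list \<nu> = N"
  shows "avg_young b N (\<lambda>s. ext_char \<beta> s * irr_char \<nu> s) \<ge> 0"
  unfolding avg_young_eq_mult[OF assms] by (rule perm_rep.mult_nonneg[OF perm_rep_young_prod[OF assms]])

definition extend_tableau :: "nat \<Rightarrow> (nat \<times> nat \<Rightarrow> nat) \<Rightarrow> nat \<times> nat \<Rightarrow> nat" where
  "extend_tableau b t = (\<lambda>(i, j). case i of 0 \<Rightarrow> b + j | Suc i' \<Rightarrow> t (i', j))"

lemma extend_tableau: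
  assumes t: "tableau \<beta> t" and b: "sum_list \<beta> = b" and N: "b \<le> N"
  shows "tableau (pad \<beta> N) (extend_tableau b t)"
proof -
  interpret tableau \<beta> t by fact
  have n: "sum_list (pad \<beta> N) = N" using b N by (simp add: sum_list_pad)
  have "extend_tableau b t ` cells (pad \<beta> N) = (\<lambda>j. b + j) ` {..<N - b} \<union> t ` cells \<beta>"
    by (auto simp: cells_pad b extend_tableau_def image_Un image_image case_prod_unfold)
  also have "t ` cells \<beta> = {..<b}" using bij_t b by (simp add: bij_betw_def)
  also have "(\<lambda>j. b + j) ` {..<N - b} \<union> {..<b} = {..<N}"
  proof -
    have "x \<in> (\<lambda>j. b + j) ` {..<N - b}" if "x < N" "\<not> x < b" for x
      using that by (intro image_eqI[of _ _ "x - b"]) auto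
    thus ?thesis using N by auto
  qed
  finally have im: "extend_tableau b t ` cells (pad \<beta> N) = {..<N}" .
  moreover have "inj_on (extend_tableau b t) (cells (pad \<beta> N))"
    by (rule eq_card_imp_inj_on) (simp_all add: im n)
  ultimately show ?thesis by unfold_locales (simp add: is_tableau_def bij_betw_def n)
qed

lemma lift_comp: "s \<in> young b N \<Longrightarrow> lift b x \<circ> s = lift b (x \<circ> s)"
  using young_less_iff by (auto simp: lift_def fun_eq_iff)

lemma lift_tabloids:
  assumes x: "x \<in> tabloids \<beta>" and b: "sum_list \<beta> = b" and N: "b \<le> N"
  shows "lift b x \<in> tabloids (pad \<beta> N)"
proof -
  have "mset_set {..<N} = mset_set {..<b} + mset_set {b..<N}"
    using N by (subst mset_set_Union[symmetric]) (auto simp: ivl_disj_un)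
  moreover have "image_mset (lift b x) (mset_set {..<b}) = image_mset Suc (image_mset x (mset_set {..<b}))"
    unfolding multiset.map_comp by (rule image_mset_cong) (simp add: lift_def)
  moreover have "image_mset (lift b x) (mset_set {b..<N}) = image_mset (\<lambda>_. 0) (mset_set {b..<N})"
    by (rule image_mset_cong) (simp add: lift_def)
  moreover have "image_mset x (mset_set {..<b}) = row_mset \<beta>"
    using x b by (simp add: tabloids_def row_mset_def)
  ultimately have "image_mset (lift b x) (mset_set {..<N}) = row_mset (pad \<beta> N)"
    using b by (simp add: row_mset_pad image_mset_const_eq)
  thus ?thesis using b N by (simp add: tabloids_def sum_list_pad row_mset_def lift_def)
qed

text \<open>A column permutation of the extended tableau contributes at a lifted tabloid only if it
  fixes {b..<N} pointwise, and such permutations are the column permutations of the small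
  tableau.\<close>

lemma polytabloid_lift:
  assumes t': "tableau \<beta> t'" and b: "sum_list \<beta> = b" and N: "b \<le> N" and x: "x \<in> tabloids \<beta>"
  shows "polytabloid (pad \<beta> N) (extend_tableau b t') (lift b x) = polytabloid \<beta> t' x"
proof -
  define t where "t = extend_tableau b t'"
  interpret T': tableau \<beta> t' by fact
  interpret T: tableau "pad \<beta> N" t unfolding t_def by (rule extend_tableau[OF t' b N])
  have n: "sum_list (pad \<beta> N) = N" using b N by (simp add: sum_list_pad)
  have pos1: "T.pos a = (Suc (fst (T'.pos a)), snd (T'.pos a))" if "a < b" for a
  proof -
    have "T'.pos a \<in> cells \<beta>" "t' (T'.pos a) = a" using T'.pos_in T'.t_pos that b by auto
    thus ?thesis
      using T.pos_t[of "(Suc (fst (T'.pos a)), snd (T'.pos a))"]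
      by (auto simp: cells_pad t_def extend_tableau_def image_iff case_prod_unfold intro!: bexI)
  qed
  have pos2: "T.pos a = (0, a - b)" if "b \<le> a" "a < N" for a
    using T.pos_t[of "(0, a - b)"] that b
    by (auto simp: cells_pad t_def extend_tableau_def)
  have col1: "T.col a = T'.col a" if "a < b" for a using pos1[OF that] by (simp add: T.col_def T'.col_def)
  have col2: "T.col a = a - b" if "b \<le> a" "a < N" for a using pos2[OF that] by (simp add: T.col_def)
  have tab: "tabloid (pad \<beta> N) t = lift b (tabloid \<beta> t')"
  proof
    fix a
    show "tabloid (pad \<beta> N) t a = lift b (tabloid \<beta> t') a"
      using pos1[of a] pos2[of a] b n N by (auto simp: tabloid_def lift_def not_less)
  qed
  have in_N: "p a < N" if "p permutes {..<N}" "a < N" for p a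
    using permutes_in_image[OF that(1), of a] that by simp
  have in_b: "p a < b" if "p permutes {..<b}" "a < b" for p a
    using permutes_in_image[OF that(1), of a] that by simp
  have sub: "p \<in> col_stab (pad \<beta> N) t" if p: "p \<in> col_stab \<beta> t'" for p
  proof -
    have pb: "p permutes {..<b}" using T'.col_stab_permutes[OF p] b by simp
    have "p permutes {..<N}" by (rule permutes_subset[OF pb]) (use N in auto)
    moreover have "T.col (p a) = T.col a" if "a < N" for a
    proof (cases "a < b")
      case True
      thus ?thesis using p b in_b[OF pb True] by (simp add: col1 T'.col_stab_eq)
    next
      case False
      thus ?thesis using pb by (simp add: permutes_not_in)
    qed
    ultimately show ?thesis by (simp add: T.col_stab_eq n)
  qed
  have eqv: "lift b x \<circ> p = lift b (tabloid \<beta> t') \<longleftrightarrow> x \<circ> p = tabloid \<beta> t'" if p: "p \<in> col_stab \<beta> t'" for p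
  proof -
    have pb: "p permutes {..<b}" using T'.col_stab_permutes[OF p] b by simp
    hence py: "p \<in> young b N"
      using permutes_subset[OF pb, of "{..<N}"] N by (auto simp: young_def permutes_image)
    have xp: "x \<circ> p \<in> tabloids \<beta>" using tabloids_comp[OF x] pb b by simp
    have "u = v" if "lift b u = lift b v" "u \<in> tabloids \<beta>" "v \<in> tabloids \<beta>" for u v
    proof
      fix a show "u a = v a"
        using fun_cong[OF that(1), of a] tabloids_out[OF that(2), of a] tabloids_out[OF that(3), of a] b
        by (cases "a < b") (auto simp: lift_def)
    qed
    from this[OF _ xp T'.tabloid_in] show ?thesis by (auto simp: lift_comp[OF py])
  qed
  have conv: "p \<in> col_stab \<beta> t'"
    if p: "p \<in> col_stab (pad \<beta> N) t" and eq: "lift b x \<circ> p = lift b (tabloid \<beta> t')" for p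
  proof -
    have pN: "p permutes {..<N}" using T.col_stab_permutes[OF p] n by simp
    \<comment> \<open>p keeps the entries from b on among themselves, since they form row 0 on both
      sides. These entries lie in pairwise different columns, so preserving columns forces p to fix
      them.\<close>
    have fix1: "p a = a" if "b \<le> a" "a < N" for a
    proof -
      have "b \<le> p a" using fun_cong[OF eq, of a] that by (auto simp: lift_def split: if_splits)
      moreover have "T.col (p a) = T.col a" using p that n by (simp add: T.col_stab_eq)
      ultimately show ?thesis using that col2[of a] col2[of "p a"] in_N[OF pN, of a] by simp
    qed
    have pb: "p permutes {..<b}" by (rule permutes_superset[OF pN]) (use fix1 in auto)
    have "T'.col (p a) = T'.col a" if "a < b" for a
      using p that n N col1[OF that] col1[OF in_b[OF pb that]] by (simp add: T.col_stab_eq)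
    thus ?thesis using pb b by (simp add: T'.col_stab_eq)
  qed
  show ?thesis
    unfolding T.polytabloid_eq_antisym[folded t_def] T'.polytabloid_eq_antisym
      T.antisym_def T'.antisym_def tab t_def[symmetric]
  proof (rule sum.mono_neutral_cong_right)
    show "finite (col_stab (pad \<beta> N) t)" using T.perm_group_col_stab by (simp add: perm_group_def)
    show "col_stab \<beta> t' \<subseteq> col_stab (pad \<beta> N) t" using sub by blast
  qed (use conv eqv in auto)
qed

text \<open>Restricting functions to the tabloids whose first row is \<open>{b..<N}\<close> is an equivariant map from the Specht
  module of \<open>pad \<beta> N\<close> to that of \<open>\<beta>\<close>; the invariant kernel \<open>K\<close> is its matrix.\<close>

lemma avg_young_ge_1:
  assumes b: "sum_list \<beta> = b" and N: "b \<le> N"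
  shows "avg_young b N (\<lambda>s. ext_char \<beta> s * irr_char (pad \<beta> N) s) \<ge> 1"
proof -
  let ?X = "tabloids \<beta>" and ?\<nu> = "pad \<beta> N" and ?P = "specht_proj \<beta>"
  let ?Y = "tabloids ?\<nu>" and ?R = "specht_proj ?\<nu>"
  have n: "sum_list ?\<nu> = N" using b N by (simp add: sum_list_pad)
  interpret R: perm_rep "young b N" "\<lambda>s (x, y). (x \<circ> s, y \<circ> s)" "?X \<times> ?Y" "\<lambda>(x, y) (x', y'). ?P x x' * ?R y y'"
    by (rule perm_rep_young_prod[OF b n])
  interpret A: perm_rep "young b N" "\<lambda>s x. x \<circ> s" ?X ?P by (rule perm_rep_young_small[OF b])
  interpret B: perm_rep "young b N" "\<lambda>s x. x \<circ> s" ?Y ?R by (rule perm_rep_young_big[OF n])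
  define K where "K = (\<lambda>(x, y). \<Sum>x'\<in>?X. ?P x x' * ?R (lift b x') y)"
  have li: "lift b x \<in> ?Y" if "x \<in> ?X" for x by (rule lift_tabloids[OF that b N])
  have "\<exists>z\<in>?X \<times> ?Y. K z \<noteq> 0"
  proof (rule ccontr)
    assume "\<not> ?thesis"
    hence K0: "K (x, y) = 0" if "x \<in> ?X" "y \<in> ?Y" for x y using that by blast
    obtain t' where t': "tableau \<beta> t'" using exists_tableau by blast
    define e' where "e' = polytabloid \<beta> t'"
    define e where "e = polytabloid ?\<nu> (extend_tableau b t')"
    have t: "tableau ?\<nu> (extend_tableau b t')" by (rule extend_tableau[OF t' b N])
    have "e' \<in> specht \<beta>" "e \<in> specht ?\<nu>"
      unfolding specht_eq e_def e'_def using t t' by (auto intro: fun_space.span_base)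
    hence Pe: "(\<Sum>y\<in>?X. ?P x y * e' y) = e' x" "(\<Sum>y\<in>?Y. ?R x y * e y) = e x" for x
      using proj_kernel_specht unfolding proj_kernel_def by blast+
    \<comment> \<open>Pairing K with the two polytabloids lets both projections act trivially. What
      remains is the sum of squares of the small polytabloid, which cannot vanish.\<close>
    have "0 = (\<Sum>x\<in>?X. \<Sum>y\<in>?Y. e' x * e y * K (x, y))" by (simp add: K0)
    also have "\<dots> = (\<Sum>x\<in>?X. \<Sum>y\<in>?Y. \<Sum>x'\<in>?X. (?P x' x * e' x) * (?R (lift b x') y * e y))"
      by (intro sum.cong refl) (simp add: K_def sum_distrib_left specht_proj_sym[of \<beta>] mult_ac)
    also have "\<dots> = (\<Sum>x'\<in>?X. \<Sum>x\<in>?X. \<Sum>y\<in>?Y. (?P x' x * e' x) * (?R (lift b x') y * e y))"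
      by (rule sum_rotate[symmetric])
    also have "\<dots> = (\<Sum>x'\<in>?X. (\<Sum>x\<in>?X. ?P x' x * e' x) * (\<Sum>y\<in>?Y. ?R (lift b x') y * e y))"
      by (simp add: sum_product)
    also have "\<dots> = (\<Sum>x'\<in>?X. (e' x')\<^sup>2)"
      unfolding Pe by (intro sum.cong refl) (simp add: e_def e'_def polytabloid_lift[OF t' b N] power2_eq_square)
    finally have "(e' (tabloid \<beta> t'))\<^sup>2 = 0"
      using tableau.tabloid_in[OF t'] by (simp add: sum_nonneg_eq_0_iff)
    thus False by (simp add: e'_def tableau.polytabloid_tabloid[OF t'])
  qed
  then obtain z where z: "z \<in> ?X \<times> ?Y" "K z \<noteq> 0" by blast
  show ?thesis
    unfolding avg_young_eq_mult[OF b n]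
  proof (rule R.mult_ge_1[where K = K, OF _ _ z])
    fix z assume "z \<in> ?X \<times> ?Y"
    then obtain x y where [simp]: "z = (x, y)" and xy: "x \<in> ?X" "y \<in> ?Y" by blast
    have "(\<Sum>w\<in>?X \<times> ?Y. (case z of (x, y) \<Rightarrow> \<lambda>(x', y'). ?P x x' * ?R y y') w * K w)
        = (\<Sum>x1\<in>?X. \<Sum>y1\<in>?Y. ?P x x1 * ?R y y1 * K (x1, y1))"
      by (simp add: sum.cartesian_product case_prod_unfold)
    also have "\<dots> = (\<Sum>x1\<in>?X. \<Sum>y1\<in>?Y. \<Sum>x'\<in>?X. (?P x x1 * ?P x1 x') * (?R (lift b x') y1 * ?R y1 y))"
      by (intro sum.cong refl) (simp add: K_def sum_distrib_left specht_proj_sym[of ?\<nu> y] mult_ac)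
    also have "\<dots> = (\<Sum>x'\<in>?X. \<Sum>x1\<in>?X. \<Sum>y1\<in>?Y. (?P x x1 * ?P x1 x') * (?R (lift b x') y1 * ?R y1 y))"
      by (rule sum_rotate[symmetric])
    also have "\<dots> = (\<Sum>x'\<in>?X. (\<Sum>x1\<in>?X. ?P x x1 * ?P x1 x') * (\<Sum>y1\<in>?Y. ?R (lift b x') y1 * ?R y1 y))"
      by (simp add: sum_product)
    also have "\<dots> = K z" using xy li by (simp add: A.P_idem B.P_idem K_def)
    finally show "(\<Sum>w\<in>?X \<times> ?Y. (case z of (x, y) \<Rightarrow> \<lambda>(x', y'). ?P x x' * ?R y y') w * K w) = K z" .
  next
    fix s z assume s: "s \<in> young b N" and "z \<in> ?X \<times> ?Y"
    then obtain x y where [simp]: "z = (x, y)" and xy: "x \<in> ?X" "y \<in> ?Y" by blast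
    have "K (x \<circ> s, y \<circ> s) = (\<Sum>x'\<in>?X. ?P (x \<circ> s) (x' \<circ> s) * ?R (lift b (x' \<circ> s)) (y \<circ> s))"
      unfolding K_def prod.case by (rule sum.reindex_bij_betw[OF A.act_bij[OF s], symmetric])
    also have "\<dots> = (\<Sum>x'\<in>?X. ?P x x' * ?R (lift b x') y)"
      by (intro sum.cong refl) (simp add: A.P_inv[OF s] B.P_inv[OF s] xy li flip: lift_comp[OF s])
    finally show "K (case z of (x, y) \<Rightarrow> (x \<circ> s, y \<circ> s)) = K z" by (simp add: K_def)
  qed
qed

section \<open>Induction and Frobenius reciprocity\<close>

text \<open>The formula for an induced class function, summed over all conjugating elements instead
  of coset representatives; this accounts for the division by the order of the Young
  subgroup.\<close>

definition ind :: "nat \<Rightarrow> nat \<Rightarrow> ((nat \<Rightarrow> nat) \<Rightarrow> real) \<Rightarrow> (nat \<Rightarrow> nat) \<Rightarrow> real" where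
  "ind b N f \<sigma> = (\<Sum>g\<in>Sym N. if inv g \<circ> \<sigma> \<circ> g \<in> young b N then f (inv g \<circ> \<sigma> \<circ> g) else 0)
     / card (young b N)"

lemma card_young_pos: "card (young b N) > 0"
  by (rule perm_group.card_G[OF perm_group_young])

lemma class_fun_ind: "class_fun N (ind b N f)"
  unfolding class_fun_def
proof (intro ballI)
  interpret perm_group "Sym N" by (rule perm_group_permutes) simp
  fix h s assume h: "h \<in> Sym N" and "s \<in> Sym N"
  define F where "F = (\<lambda>g. if inv g \<circ> s \<circ> g \<in> young b N then f (inv g \<circ> s \<circ> g) else 0)"
  have "ind b N f (inv h \<circ> s \<circ> h) = (\<Sum>g\<in>Sym N. F (h \<circ> g)) / card (young b N)"
    unfolding ind_def F_def
    by (intro arg_cong2[where f = "(/)"] sum.cong refl) (simp only: conj_comp[OF _ h])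
  also have "(\<Sum>g\<in>Sym N. F (h \<circ> g)) = (\<Sum>g\<in>Sym N. F g)"
    by (rule sum.reindex_bij_betw[OF left_mult_bij[OF h]])
  also have "(\<Sum>g\<in>Sym N. F g) / card (young b N) = ind b N f s" unfolding ind_def F_def ..
  finally show "ind b N f (inv h \<circ> s \<circ> h) = ind b N f s" .
qed

text \<open>Frobenius reciprocity. Since F is a class function it can be moved inside the
  conjugation, after which each of the N! conjugating elements contributes the same sum.\<close>

lemma avg_ind:
  assumes F: "class_fun N F"
  shows "avg_Sym N (\<lambda>s. ind b N f s * F s) = avg_young b N (\<lambda>s. f s * F s)"
proof -
  interpret perm_group "Sym N" by (rule perm_group_permutes) simp
  define Q where "Q = (\<lambda>s. if s \<in> young b N then f s * F s else 0)"
  have young_sub: "young b N \<subseteq> Sym N" by (auto simp: young_def)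
  have "(\<Sum>s\<in>Sym N. ind b N f s * F s) = (\<Sum>s\<in>Sym N. (\<Sum>g\<in>Sym N. Q (inv g \<circ> s \<circ> g)) / card (young b N))"
  proof (intro sum.cong refl)
    fix s assume s: "s \<in> Sym N"
    have "ind b N f s * F s = (\<Sum>g\<in>Sym N. (if inv g \<circ> s \<circ> g \<in> young b N then f (inv g \<circ> s \<circ> g) else 0) * F s) / card (young b N)"
      by (simp add: ind_def sum_distrib_right)
    also have "\<dots> = (\<Sum>g\<in>Sym N. Q (inv g \<circ> s \<circ> g)) / card (young b N)"
      using F s by (intro arg_cong2[where f = "(/)"] sum.cong refl) (auto simp: Q_def class_fun_def)
    finally show "ind b N f s * F s = (\<Sum>g\<in>Sym N. Q (inv g \<circ> s \<circ> g)) / card (young b N)" .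
  qed
  also have "\<dots> = (\<Sum>s\<in>Sym N. \<Sum>g\<in>Sym N. Q (inv g \<circ> s \<circ> g)) / card (young b N)"
    by (rule sum_divide_distrib[symmetric])
  also have "(\<Sum>s\<in>Sym N. \<Sum>g\<in>Sym N. Q (inv g \<circ> s \<circ> g)) = (\<Sum>g\<in>Sym N. \<Sum>s\<in>Sym N. Q (inv g \<circ> s \<circ> g))"
    by (rule sum.swap)
  also have "\<dots> = (\<Sum>g\<in>Sym N. \<Sum>s\<in>Sym N. Q s)"
  proof (rule sum.cong[OF refl])
    fix g assume g: "g \<in> Sym N"
    have "(\<Sum>s\<in>Sym N. Q (inv g \<circ> s \<circ> g)) = (\<Sum>s\<in>Sym N. Q (s \<circ> g))"
      by (rule sum.reindex_bij_betw[OF left_mult_bij[OF inv_G[OF g]]])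
    also have "\<dots> = (\<Sum>s\<in>Sym N. Q s)" by (rule sum.reindex_bij_betw[OF right_mult_bij[OF g]])
    finally show "(\<Sum>s\<in>Sym N. Q (inv g \<circ> s \<circ> g)) = (\<Sum>s\<in>Sym N. Q s)" .
  qed
  also have "\<dots> = fact N * (\<Sum>s\<in>young b N. f s * F s)"
    using young_sub by (simp add: card_Sym[simplified] Q_def sum.If_cases Int_absorb1)
  finally show ?thesis by (simp add: avg_Sym_def avg_young_def)
qed

lemma ind_square_le: "(ind b N f \<sigma>)\<^sup>2 \<le> ind b N (\<lambda>_. 1) \<sigma> * ind b N (\<lambda>s. (f s)\<^sup>2) \<sigma>"
proof -
  let ?Q = "\<lambda>g. inv g \<circ> \<sigma> \<circ> g \<in> young b N" and ?f = "\<lambda>g. f (inv g \<circ> \<sigma> \<circ> g)"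
  have "(\<Sum>g\<in>Sym N. if ?Q g then ?f g else 0)\<^sup>2
      = (\<Sum>g\<in>Sym N. (if ?Q g then 1 else 0) * (if ?Q g then ?f g else 0))\<^sup>2"
    by (intro arg_cong[where f = "\<lambda>x. x\<^sup>2"] sum.cong) auto
  also have "\<dots> \<le> (\<Sum>g\<in>Sym N. (if ?Q g then 1 else 0)\<^sup>2) * (\<Sum>g\<in>Sym N. (if ?Q g then ?f g else 0)\<^sup>2)"
    by (rule Cauchy_Schwarz_ineq_sum)
  also have "\<dots> = (\<Sum>g\<in>Sym N. if ?Q g then 1 else 0) * (\<Sum>g\<in>Sym N. if ?Q g then (?f g)\<^sup>2 else 0)"
    by (intro arg_cong2[where f = "(*)"] sum.cong) auto
  finally show ?thesis
    unfolding ind_def power_divide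
    by (simp add: power2_eq_square divide_right_mono)
qed

lemma ind_mono:
  "(\<And>s. s \<in> young b N \<Longrightarrow> f s \<le> c * g s) \<Longrightarrow> ind b N f \<sigma> \<le> c * ind b N g \<sigma>"
  unfolding ind_def times_divide_eq_right sum_distrib_left
  by (intro divide_right_mono sum_mono) auto

lemma ind_nonneg: "(\<And>s. f s \<ge> 0) \<Longrightarrow> ind b N f \<sigma> \<ge> 0"
  unfolding ind_def by (intro divide_nonneg_nonneg sum_nonneg) auto

section \<open>Invariant sets and their moments\<close>

text \<open>The size is bounded by b instead of equal to b, so that intersecting an invariant set
  with {b..<N} does not leave the family.\<close>

definition inv_sets :: "nat set \<Rightarrow> nat \<Rightarrow> (nat \<Rightarrow> nat) \<Rightarrow> nat set set" where
  "inv_sets S b \<sigma> = {B. B \<subseteq> S \<and> card B \<le> b \<and> (\<forall>x. \<sigma> x \<in> B \<longleftrightarrow> x \<in> B)}"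

lemma finite_inv_sets [simp]: "finite S \<Longrightarrow> finite (inv_sets S b \<sigma>)"
  by (rule finite_subset[of _ "Pow S"]) (auto simp: inv_sets_def)

text \<open>Inducing the trivial character gives the permutation character on b-subsets. The
  conjugate by g lies in the Young subgroup only if g{..<b} is invariant, and the g with a
  prescribed image form at most one coset.\<close>

lemma ind_one_le:
  assumes \<sigma>: "\<sigma> \<in> Sym N" and b: "b \<le> N"
  shows "ind b N (\<lambda>_. 1) \<sigma> \<le> card (inv_sets {..<N} b \<sigma>)"
proof -
  interpret perm_group "Sym N" by (rule perm_group_permutes) simp
  let ?I = "inv_sets {..<N} b \<sigma>" and ?C = "\<lambda>A. {g \<in> Sym N. g ` {..<b} = A}"
  have fiY: "finite (young b N)" using perm_group_young by (simp add: perm_group_def)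
  have "card (?C A) \<le> card (young b N)" for A
  proof (cases "?C A = {}")
    case False
    then obtain h where h: "h \<in> Sym N" "h ` {..<b} = A" by blast
    have ih: "inv h \<circ> h = id" using h by (simp add: permutes_inv_o)
    have "(\<lambda>g. inv h \<circ> g) ` ?C A \<subseteq> young b N"
    proof safe
      fix g assume g: "g permutes {..<N}" "A = g ` {..<b}"
      have "(inv h \<circ> g) ` {..<b} = inv h ` (h ` {..<b})" unfolding h(2) g(2) by (simp only: image_comp)
      also have "\<dots> = {..<b}" using ih by (simp add: image_comp)
      finally show "inv h \<circ> g \<in> young b N" using g h by (simp add: young_def permutes_compose permutes_inv)
    qed
    moreover have "inj_on (\<lambda>g. inv h \<circ> g) (?C A)"
      using left_mult_bij[OF inv_G[OF h(1)]] by (rule inj_on_subset[OF bij_betw_imp_inj_on]) auto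
    ultimately show ?thesis using fiY by (intro card_inj_on_le)
  next
    case True
    show ?thesis unfolding True by simp
  qed
  note C = this
  have "{g \<in> Sym N. inv g \<circ> \<sigma> \<circ> g \<in> young b N} \<subseteq> (\<Union>A\<in>?I. ?C A)"
  proof
    fix g assume "g \<in> {g \<in> Sym N. inv g \<circ> \<sigma> \<circ> g \<in> young b N}"
    hence g: "g permutes {..<N}" and im: "(inv g \<circ> \<sigma> \<circ> g) ` {..<b} = {..<b}" by (auto simp: young_def)
    define A where "A = g ` {..<b}"
    have "g \<circ> inv g = id" using g by (simp add: permutes_inv_o)
    hence "g \<circ> (inv g \<circ> \<sigma> \<circ> g) = \<sigma> \<circ> g" by (metis id_comp o_assoc)
    hence "\<sigma> ` A = g ` ((inv g \<circ> \<sigma> \<circ> g) ` {..<b})" by (simp only: A_def image_comp)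
    hence \<sigma>A: "\<sigma> ` A = A" by (simp only: im A_def)
    have "\<sigma> x \<in> A \<longleftrightarrow> x \<in> A" for x
      using inj_image_mem_iff[of \<sigma> x A] \<sigma> \<sigma>A by (auto simp: permutes_inj)
    moreover have "A \<subseteq> {..<N}" unfolding A_def using b g permutes_image[OF g] by force
    moreover have "card A \<le> b" unfolding A_def using card_image_le[of "{..<b}" g] by simp
    ultimately have "A \<in> ?I" by (simp add: inv_sets_def)
    thus "g \<in> (\<Union>A\<in>?I. ?C A)" using g A_def by blast
  qed
  hence "card {g \<in> Sym N. inv g \<circ> \<sigma> \<circ> g \<in> young b N} \<le> card (\<Union>A\<in>?I. ?C A)"
    by (rule card_mono[rotated]) auto
  also have "\<dots> \<le> (\<Sum>A\<in>?I. card (?C A))" by (rule card_UN_le) simp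
  also have "\<dots> \<le> (\<Sum>A\<in>?I. card (young b N))" by (intro sum_mono C)
  finally have "real (card {g \<in> Sym N. inv g \<circ> \<sigma> \<circ> g \<in> young b N}) \<le> real (card ?I * card (young b N))"
    by (intro of_nat_mono) simp
  thus ?thesis using card_young_pos[of b N]
    by (simp add: ind_def sum_if_eq_card[OF finite_Sym] pos_divide_le_eq)
qed

text \<open>An invariant set splits at b. The lower part is one of at most 2^b subsets, and the
  upper part is again invariant because the Young subgroup preserves the splitting.\<close>

lemma card_inv_sets_young:
  assumes \<sigma>: "\<sigma> \<in> young b N"
  shows "card (inv_sets {..<N} b \<sigma>) \<le> 2 ^ b * card (inv_sets {b..<N} b \<sigma>)"
proof -
  let ?f = "\<lambda>A. (A \<inter> {..<b}, A \<inter> {b..<N})"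
  have lt: "\<sigma> x < N \<longleftrightarrow> x < N" for x
    using \<sigma> permutes_in_image[of \<sigma> "{..<N}" x] by (simp add: young_def)
  have "card (inv_sets {..<N} b \<sigma>) \<le> card (Pow {..<b} \<times> inv_sets {b..<N} b \<sigma>)"
  proof (rule card_inj_on_le)
    show "inj_on ?f (inv_sets {..<N} b \<sigma>)"
    proof (rule inj_onI)
      fix A B assume A: "A \<in> inv_sets {..<N} b \<sigma>" and B: "B \<in> inv_sets {..<N} b \<sigma>" and eq: "?f A = ?f B"
      have "C = C \<inter> {..<b} \<union> C \<inter> {b..<N}" if "C \<in> inv_sets {..<N} b \<sigma>" for C
        using that by (auto simp: inv_sets_def not_less)
      from this[OF A] this[OF B] eq show "A = B" by simp
    qed
    show "?f ` inv_sets {..<N} b \<sigma> \<subseteq> Pow {..<b} \<times> inv_sets {b..<N} b \<sigma>"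
    proof
      fix p assume "p \<in> ?f ` inv_sets {..<N} b \<sigma>"
      then obtain A where A: "A \<in> inv_sets {..<N} b \<sigma>" "p = ?f A" by blast
      have "finite A" using A finite_subset[of A "{..<N}"] by (auto simp: inv_sets_def)
      hence "card (A \<inter> {b..<N}) \<le> card A" by (intro card_mono) auto
      hence "A \<inter> {b..<N} \<in> inv_sets {b..<N} b \<sigma>"
        using A young_less_iff[OF \<sigma>] lt by (auto simp: inv_sets_def not_less[symmetric])
      thus "p \<in> Pow {..<b} \<times> inv_sets {b..<N} b \<sigma>" using A by auto
    qed
  qed simp
  thus ?thesis by (simp add: card_cartesian_product card_Pow)
qed

text \<open>The third moment counts orbits of triples of subsets. An orbit is determined by the
  sizes of the seven regions of the Venn diagram inside the union, each of size at most b; this is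
  the origin of the exponent 7.\<close>

lemma sum_inv_sets_cube:
  assumes S: "finite S"
  shows "(\<Sum>\<sigma> | \<sigma> permutes S. card (inv_sets S b \<sigma>) ^ 3) \<le> fact (card S) * (b + 1) ^ 7"
proof -
  define join :: "nat set \<times> nat set \<times> nat set \<Rightarrow> nat \<Rightarrow> bool \<times> bool \<times> bool"
    where "join = (\<lambda>(A, B, C) x. (x \<in> A, x \<in> B, x \<in> C))"
  define \<D> where "\<D> = {B. B \<subseteq> S \<and> card B \<le> b}"
  define X where "X = join ` (\<D> \<times> \<D> \<times> \<D>)"
  let ?z = "(False, False, False)"
  have f\<D>: "finite \<D>" by (rule finite_subset[of _ "Pow S"]) (use S in \<open>auto simp: \<D>_def\<close>)
  have inj: "inj join" by (rule injI) (auto simp: join_def fun_eq_iff)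
  have "card (inv_sets S b \<sigma>) ^ 3 = card {r \<in> X. r \<circ> \<sigma> = r}" for \<sigma>
  proof -
    have inv: "inv_sets S b \<sigma> = {B \<in> \<D>. \<sigma> -` B = B}" by (auto simp: inv_sets_def \<D>_def)
    have jc: "join (A, B, C) \<circ> \<sigma> = join (\<sigma> -` A, \<sigma> -` B, \<sigma> -` C)" for A B C
      by (auto simp: join_def)
    have je: "join p = join q \<longleftrightarrow> p = q" for p q using inj by (auto dest: injD)
    have "{r \<in> X. r \<circ> \<sigma> = r} = join ` (inv_sets S b \<sigma> \<times> inv_sets S b \<sigma> \<times> inv_sets S b \<sigma>)"
      unfolding inv X_def by (auto simp: jc je)
    thus ?thesis
      using card_image[OF inj_on_subset[OF inj subset_UNIV]]
      by (simp add: card_cartesian_product power3_eq_cube)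
  qed
  hence "(\<Sum>\<sigma> | \<sigma> permutes S. card (inv_sets S b \<sigma>) ^ 3) = (\<Sum>\<sigma> | \<sigma> permutes S. card {r \<in> X. r \<circ> \<sigma> = r})"
    by simp
  also have "\<dots> = fact (card S) * card ((\<lambda>r. image_mset r (mset_set S)) ` X)"
  proof (rule burnside_types[OF S])
    show "finite X" by (simp add: X_def f\<D>)
    fix r and s :: "nat \<Rightarrow> nat" assume r: "r \<in> X" and s: "s permutes S"
    then obtain A B C where ABC: "A \<in> \<D>" "B \<in> \<D>" "C \<in> \<D>" "r = join (A, B, C)" by (auto simp: X_def)
    have vimage: "s -` D \<in> \<D>" if "D \<in> \<D>" for D
    proof -
      have "card (s -` D) = card D"
        using permutes_bij[OF s] by (intro card_vimage_inj) (auto simp: bij_is_inj bij_is_surj)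
      moreover have "s -` D \<subseteq> S" using that permutes_in_image[OF s] by (auto simp: \<D>_def)
      ultimately show ?thesis using that by (simp add: \<D>_def)
    qed
    have "r \<circ> s = join (s -` A, s -` B, s -` C)" by (auto simp: ABC join_def fun_eq_iff)
    thus "r \<circ> s \<in> X" using vimage ABC unfolding X_def by blast
  next
    fix r r' x assume "r \<in> X" "r' \<in> X" "x \<notin> S"
    thus "r x = r' x" by (auto simp: X_def join_def \<D>_def)
  qed
  also have "card ((\<lambda>r. image_mset r (mset_set S)) ` X) \<le> (b + 1) ^ 7"
  proof -
    let ?M = "(\<lambda>r. image_mset r (mset_set S)) ` X" and ?L = "UNIV - {?z}"
    let ?f = "\<lambda>M. restrict (count M) ?L"
    have cnt: "count M l \<le> b" if "M \<in> ?M" "l \<noteq> ?z" for M l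
    proof -
      from that obtain A B C where ABC: "A \<in> \<D>" "B \<in> \<D>" "C \<in> \<D>" "M = image_mset (join (A, B, C)) (mset_set S)"
        by (auto simp: X_def)
      have "count M l = card {x \<in> S. join (A, B, C) x = l}"
        unfolding ABC(4) by (rule card_fibre_eq_count[OF S, symmetric])
      moreover have ex: "\<exists>D\<in>\<D>. {x \<in> S. join (A, B, C) x = l} \<subseteq> D"
      proof -
        obtain p q r where l: "l = (p, q, r)" by (cases l)
        with that(2) consider "p" | "q" | "r" by auto
        thus ?thesis by cases (use ABC(1-3) l in \<open>auto simp: join_def\<close>)
      qed
      from ex obtain D where D: "D \<in> \<D>" "{x \<in> S. join (A, B, C) x = l} \<subseteq> D" by (elim bexE)
      hence "finite D" using finite_subset[OF _ S] by (simp add: \<D>_def)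
      hence le: "card {x \<in> S. join (A, B, C) x = l} \<le> card D" using D(2) by (rule card_mono)
      ultimately show ?thesis using D(1) le by (simp add: \<D>_def)
    qed
    have "inj_on ?f ?M"
    proof (rule inj_onI)
      fix M M' assume M: "M \<in> ?M" "M' \<in> ?M" "?f M = ?f M'"
      have eq: "count M l = count M' l" if "l \<noteq> ?z" for l
        using fun_cong[OF M(3), of l] that by simp
      \<comment> \<open>The region outside all three sets has whatever size is left of
        \<open>card S\<close>, so the seven other counts determine the multiset.\<close>
      have size: "size M'' = count M'' ?z + (\<Sum>l\<in>?L. count M'' l)" for M'' :: "(bool \<times> bool \<times> bool) multiset"
      proof -
        have "size M'' = (\<Sum>l\<in>UNIV. count M'' l)"
          unfolding size_multiset_overloaded_eq
          by (rule sum.mono_neutral_left) (auto simp: count_eq_zero_iff)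
        thus ?thesis by (simp add: sum.remove[of UNIV ?z])
      qed
      have "size M = card S" "size M' = card S" using M by auto
      moreover have "(\<Sum>l\<in>?L. count M l) = (\<Sum>l\<in>?L. count M' l)" by (intro sum.cong refl eq) auto
      ultimately have "count M ?z = count M' ?z" using size[of M] size[of M'] by simp
      thus "M = M'" using eq by (intro multiset_eqI) metis
    qed
    moreover have "?f ` ?M \<subseteq> (\<Pi>\<^sub>E l\<in>?L. {..b})" using cnt by (auto simp: PiE_iff)
    ultimately have "card ?M \<le> card (\<Pi>\<^sub>E l\<in>?L. {..b})"
      by (intro card_inj_on_le finite_PiE) auto
    also have "card ?L = 7"
      by (simp add: card_Diff_singleton card_UNIV_bool flip: UNIV_Times_UNIV)
    hence "card (\<Pi>\<^sub>E l\<in>?L. {..b}) = (b + 1) ^ 7" by (simp add: card_PiE)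
    finally show ?thesis .
  qed
  finally show ?thesis by simp
qed

lemma young_product_bij:
  assumes "b \<le> N"
  shows "bij_betw (\<lambda>(s, t). s \<circ> t) (Sym b \<times> {t. t permutes {b..<N}}) (young b N)"
proof (rule bij_betw_byWitness[where f' = "\<lambda>s. (restr b s, \<lambda>i. if i < b then i else s i)"])
  have comp: "s (t i) = (if i < b then s i else t i)" if "s permutes {..<b}" "t permutes {b..<N}" for s t :: "nat \<Rightarrow> nat" and i
  proof (cases "i < b")
    case False
    hence "\<not> t i < b" using that(2) permutes_in_image[OF that(2), of i] by (cases "i < N") (auto simp: permutes_not_in)
    thus ?thesis using that(1) False by (simp add: permutes_not_in)
  qed (use that in \<open>simp add: permutes_not_in\<close>)
  show "\<forall>p\<in>Sym b \<times> {t. t permutes {b..<N}}.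
    (restr b ((\<lambda>(s, t). s \<circ> t) p), \<lambda>i. if i < b then i else ((\<lambda>(s, t). s \<circ> t) p) i) = p"
    by (auto simp: comp restr_def fun_eq_iff permutes_not_in)
  show "(\<lambda>(s, t). s \<circ> t) ` (Sym b \<times> {t. t permutes {b..<N}}) \<subseteq> young b N"
  proof safe
    fix s t :: "nat \<Rightarrow> nat" assume st: "s permutes {..<b}" "t permutes {b..<N}"
    have "s \<circ> t permutes {..<N}"
      by (rule permutes_compose; rule permutes_subset) (use st assms in auto)
    moreover have "(s \<circ> t) ` {..<b} = s ` {..<b}"
      using st by (intro image_cong) (auto simp: comp)
    ultimately show "s \<circ> t \<in> young b N" using st by (simp add: young_def permutes_image)
  qed
  show "\<forall>s\<in>young b N. (\<lambda>(s, t). s \<circ> t) (restr b s, \<lambda>i. if i < b then i else s i) = s"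
    using young_less_iff by (auto simp: restr_def fun_eq_iff)
  show "(\<lambda>s. (restr b s, \<lambda>i. if i < b then i else s i)) ` young b N \<subseteq> Sym b \<times> {t. t permutes {b..<N}}"
  proof safe
    fix s assume s: "s \<in> young b N"
    show "restr b s permutes {..<b}" by (rule restr_permutes[OF s])
    have sN: "s permutes {..<N}" using s by (simp add: young_def)
    have "bij_betw s ({..<N} - {..<b}) ({..<N} - {..<b})"
    proof (rule bij_betw_DiffI[OF permutes_imp_bij[OF sN]])
      show "bij_betw s {..<b} {..<b}" using s by (auto simp: young_def bij_betw_def permutes_inj_on)
    qed (use assms in auto)
    moreover have "{..<N} - {..<b} = {b..<N}" by auto
    ultimately have "bij_betw s {b..<N} {b..<N}" by simp
    hence "bij_betw (\<lambda>i. if i < b then i else s i) {b..<N} {b..<N}"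
      by (rule bij_betw_cong[THEN iffD1, rotated]) auto
    thus "(\<lambda>i. if i < b then i else s i) permutes {b..<N}"
      by (rule bij_imp_permutes) (use sN in \<open>auto simp: permutes_not_in\<close>)
  qed
qed

text \<open>The character sees only the factor permuting {..<b}, while the number of invariant sets
  is at most 2^b times a quantity depending on the other factor alone. So the average of the bound
  splits: the square of the character has mean 1, the other part is the third moment, and 8^b is the
  cube of 2^b.\<close>

lemma avg_young_moment:
  assumes \<beta>: "\<beta> \<turnstile>\<^sub>p b" and N: "b \<le> N"
  shows "avg_young b N (\<lambda>s. (ext_char \<beta> s)\<^sup>2 * (ind b N (\<lambda>_. 1) s) ^ 3) \<le> 8 ^ b * (b + 1) ^ 7"
proof -
  have sb: "sum_list \<beta> = b" using \<beta> by (simp add: is_partition_def)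
  let ?T = "{t. t permutes {b..<N}}" and ?J = "\<lambda>t. real (card (inv_sets {b..<N} b t))"
  have fT: "finite ?T" by (simp add: finite_permutations)
  have I_le: "ind b N (\<lambda>_. 1) s \<le> 2 ^ b * ?J s" if "s \<in> young b N" for s
  proof -
    have "ind b N (\<lambda>_. 1) s \<le> card (inv_sets {..<N} b s)"
      using that N by (intro ind_one_le) (auto simp: young_def)
    also have "\<dots> \<le> real (2 ^ b * card (inv_sets {b..<N} b s))"
      by (intro of_nat_mono card_inv_sets_young that)
    finally show ?thesis by simp
  qed
  have "(\<Sum>s\<in>young b N. (ext_char \<beta> s)\<^sup>2 * (ind b N (\<lambda>_. 1) s) ^ 3)
      \<le> (\<Sum>s\<in>young b N. (ext_char \<beta> s)\<^sup>2 * (2 ^ b * ?J s) ^ 3)"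
    by (intro sum_mono mult_left_mono power_mono I_le ind_nonneg) auto
  also have "\<dots> = 8 ^ b * (\<Sum>s\<in>young b N. (ext_char \<beta> s)\<^sup>2 * ?J s ^ 3)"
  proof -
    have "(2 ^ b) ^ 3 = (8 :: real) ^ b" by (simp flip: power_mult add: mult.commute[of b]) (simp add: power_mult)
    thus ?thesis by (simp add: power_mult_distrib sum_distrib_left mult_ac)
  qed
  also have "(\<Sum>s\<in>young b N. (ext_char \<beta> s)\<^sup>2 * ?J s ^ 3)
      = (\<Sum>(s, t)\<in>Sym b \<times> ?T. (ext_char \<beta> (s \<circ> t))\<^sup>2 * ?J (s \<circ> t) ^ 3)"
    by (subst sum.reindex_bij_betw[OF young_product_bij[OF N], symmetric]) (simp add: case_prod_unfold)
  also have "\<dots> = (\<Sum>(s, t)\<in>Sym b \<times> ?T. (irr_char \<beta> s)\<^sup>2 * ?J t ^ 3)"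
  proof (rule sum.cong[OF refl], clarify)
    fix s t :: "nat \<Rightarrow> nat" assume st: "s permutes {..<b}" "t permutes {b..<N}"
    have st_young: "s \<circ> t \<in> young b N"
      using young_product_bij[OF N] st unfolding bij_betw_def by blast
    have "restr b (s \<circ> t) = s" using st by (auto simp: restr_def fun_eq_iff permutes_not_in)
    moreover have "inv_sets {b..<N} b (s \<circ> t) = inv_sets {b..<N} b t"
    proof -
      have "s y \<in> B \<longleftrightarrow> y \<in> B" if "B \<subseteq> {b..<N}" for y B
        using st(1) permutes_in_image[OF st(1), of y] that by (cases "y < b") (auto simp: permutes_not_in)
      thus ?thesis by (auto simp: inv_sets_def)
    qed
    ultimately show "(ext_char \<beta> (s \<circ> t))\<^sup>2 * ?J (s \<circ> t) ^ 3 = (irr_char \<beta> s)\<^sup>2 * ?J t ^ 3"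
      by (simp add: ext_char_eq[OF sb st_young])
  qed
  also have "\<dots> = (\<Sum>s\<in>Sym b. (irr_char \<beta> s)\<^sup>2) * (\<Sum>t\<in>?T. ?J t ^ 3)"
    by (simp add: sum_product sum.cartesian_product)
  also have "(\<Sum>s\<in>Sym b. (irr_char \<beta> s)\<^sup>2) = fact b"
    using irr_char_orthonormal[OF \<beta> \<beta>] by (simp add: avg_Sym_def power2_eq_square)
  also have "(\<Sum>t\<in>?T. ?J t ^ 3) \<le> fact (N - b) * (b + 1) ^ 7"
    using of_nat_mono[OF sum_inv_sets_cube[of "{b..<N}" b], where 'a = real] by simp
  finally have "(\<Sum>s\<in>young b N. (ext_char \<beta> s)\<^sup>2 * (ind b N (\<lambda>_. 1) s) ^ 3)
      \<le> 8 ^ b * (fact b * (fact (N - b) * (b + 1) ^ 7))" by simp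
  moreover have "card (young b N) = fact b * fact (N - b)"
    using bij_betw_same_card[OF young_product_bij[OF N]] card_Sym[of b]
    by (simp add: card_cartesian_product card_permutations)
  ultimately show ?thesis by (simp add: avg_young_def field_simps)
qed

section \<open>The upper bound\<close>

text \<open>By completeness these are the nonnegative real combinations of irreducible characters.
  They are closed under products because Kronecker coefficients are nonnegative, so inequalities
  between multiplicities carry over to higher moments.\<close>

definition pos_class :: "nat \<Rightarrow> ((nat \<Rightarrow> nat) \<Rightarrow> real) \<Rightarrow> bool" where
  "pos_class n f \<longleftrightarrow> class_fun n f \<and> (\<forall>\<nu>\<in>partitions n. avg_Sym n (\<lambda>s. f s * irr_char \<nu> s) \<ge> 0)"

lemma avg_Sym_parseval:
  assumes f: "class_fun n f" and g: "class_fun n g"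
  shows "avg_Sym n (\<lambda>s. f s * g s)
    = (\<Sum>\<nu>\<in>partitions n. avg_Sym n (\<lambda>s. f s * irr_char \<nu> s) * avg_Sym n (\<lambda>s. g s * irr_char \<nu> s))"
proof -
  define F where "F = (\<lambda>\<nu>. avg_Sym n (\<lambda>s. f s * irr_char \<nu> s))"
  have "avg_Sym n (\<lambda>s. f s * g s) = avg_Sym n (\<lambda>s. \<Sum>\<nu>\<in>partitions n. F \<nu> * (g s * irr_char \<nu> s))"
  proof (rule avg_Sym_cong)
    fix s :: "nat \<Rightarrow> nat" assume "s permutes {..<n}"
    hence e: "f s = (\<Sum>\<nu>\<in>partitions n. F \<nu> * irr_char \<nu> s)"
      using class_fun_expansion[OF f, of s] by (simp add: F_def)
    show "f s * g s = (\<Sum>\<nu>\<in>partitions n. F \<nu> * (g s * irr_char \<nu> s))"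
      unfolding e sum_distrib_right by (simp add: mult_ac)
  qed
  also have "\<dots> = (\<Sum>\<nu>\<in>partitions n. F \<nu> * avg_Sym n (\<lambda>s. g s * irr_char \<nu> s))"
    by (simp add: avg_Sym_sum avg_Sym_scale)
  finally show ?thesis by (simp add: F_def)
qed

lemma pos_class_inner: "pos_class n f \<Longrightarrow> pos_class n g \<Longrightarrow> avg_Sym n (\<lambda>s. f s * g s) \<ge> 0"
  by (subst avg_Sym_parseval) (auto simp: pos_class_def intro!: sum_nonneg)

lemma irr_char_triple_nonneg:
  assumes "sum_list \<alpha> = n" "sum_list \<beta> = n" "sum_list \<gamma> = n"
  shows "avg_Sym n (\<lambda>s. irr_char \<alpha> s * irr_char \<beta> s * irr_char \<gamma> s) \<ge> 0"
proof -
  note r = assms[THEN perm_rep_specht_Sym]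
  note r2 = perm_rep_prod[OF r(2,3)]
  note r3 = perm_rep_prod[OF r(1) r2]
  have "avg_Sym n (\<lambda>s. irr_char \<alpha> s * irr_char \<beta> s * irr_char \<gamma> s) = perm_rep.mult (Sym n)
     (\<lambda>s (x, y). (x \<circ> s, (\<lambda>s (x, y). (x \<circ> s, y \<circ> s)) s y)) (tabloids \<alpha> \<times> (tabloids \<beta> \<times> tabloids \<gamma>))
     (\<lambda>(x, y) (x', y'). specht_proj \<alpha> x x' * (\<lambda>(x, y) (x', y'). specht_proj \<beta> x x' * specht_proj \<gamma> y y') y y')"
    unfolding mult_Sym[OF r3]
    by (rule avg_Sym_cong) (simp only: chr_prod[OF r(1) r2] chr_prod[OF r(2,3)] chr_specht assms mult.assoc)
  thus ?thesis using perm_rep.mult_nonneg[OF r3] by simp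
qed

lemma pos_class_irr_char:
  assumes "\<beta> \<turnstile>\<^sub>p n"
  shows "pos_class n (irr_char \<beta>)"
proof -
  have "sum_list \<beta> = n" using assms by (simp add: is_partition_def)
  thus ?thesis
    using irr_char_orthonormal[OF assms] class_fun_irr_char
    by (auto simp: pos_class_def partitions_def)
qed

lemma avg_Sym_add: "avg_Sym n (\<lambda>s. f s + g s) = avg_Sym n f + avg_Sym n g"
  by (simp add: avg_Sym_def sum.distrib add_divide_distrib)

lemma avg_Sym_diff: "avg_Sym n (\<lambda>s. f s - g s) = avg_Sym n f - avg_Sym n g"
  by (simp add: avg_Sym_def sum_subtractf diff_divide_distrib)

lemma pos_class_add:
  assumes "pos_class n f" "pos_class n g" shows "pos_class n (\<lambda>s. f s + g s)"
  using assms by (auto simp: pos_class_def class_fun_def distrib_right avg_Sym_add)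

lemma pos_class_mult:
  assumes f: "pos_class n f" and g: "pos_class n g"
  shows "pos_class n (\<lambda>s. f s * g s)"
  unfolding pos_class_def
proof (intro conjI ballI)
  show "class_fun n (\<lambda>s. f s * g s)" using f g by (auto simp: pos_class_def class_fun_def)
  fix \<nu> assume \<nu>: "\<nu> \<in> partitions n"
  let ?P = "partitions n"
  define F where "F = (\<lambda>\<nu>. avg_Sym n (\<lambda>s. f s * irr_char \<nu> s))"
  define G where "G = (\<lambda>\<nu>. avg_Sym n (\<lambda>s. g s * irr_char \<nu> s))"
  have "avg_Sym n (\<lambda>s. f s * g s * irr_char \<nu> s) = avg_Sym n (\<lambda>s. \<Sum>a\<in>?P. \<Sum>b\<in>?P.
      (F a * G b) * (irr_char a s * irr_char b s * irr_char \<nu> s))"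
  proof (rule avg_Sym_cong)
    fix s :: "nat \<Rightarrow> nat" assume s: "s permutes {..<n}"
    have e: "f s = (\<Sum>a\<in>?P. F a * irr_char a s)" "g s = (\<Sum>b\<in>?P. G b * irr_char b s)"
      using f g s class_fun_expansion[of n _ s] by (auto simp: pos_class_def F_def G_def)
    have "f s * g s * irr_char \<nu> s = (\<Sum>a\<in>?P. \<Sum>b\<in>?P. (F a * irr_char a s) * (G b * irr_char b s) * irr_char \<nu> s)"
      unfolding e by (subst sum_product) (simp only: sum_distrib_right)
    thus "f s * g s * irr_char \<nu> s = (\<Sum>a\<in>?P. \<Sum>b\<in>?P. (F a * G b) * (irr_char a s * irr_char b s * irr_char \<nu> s))"
      by (simp add: mult_ac)
  qed
  also have "\<dots> = (\<Sum>a\<in>?P. \<Sum>b\<in>?P. (F a * G b) * avg_Sym n (\<lambda>s. irr_char a s * irr_char b s * irr_char \<nu> s))"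
    by (simp add: avg_Sym_sum avg_Sym_scale)
  also have "\<dots> \<ge> 0"
    using f g \<nu>
    by (intro sum_nonneg mult_nonneg_nonneg irr_char_triple_nonneg)
       (auto simp: F_def G_def pos_class_def partitions_def is_partition_def)
  finally show "avg_Sym n (\<lambda>s. f s * g s * irr_char \<nu> s) \<ge> 0" .
qed

text \<open>The square is a single term of the sum of squares over the group, which orthonormality
  evaluates to b!; the degree of the character is not computed.\<close>

lemma irr_char_square_le:
  assumes "\<beta> \<turnstile>\<^sub>p b" "s permutes {..<b}"
  shows "(irr_char \<beta> s)\<^sup>2 \<le> fact b"
proof -
  have "(irr_char \<beta> s)\<^sup>2 \<le> (\<Sum>s\<in>Sym b. (irr_char \<beta> s)\<^sup>2)"
    using assms(2) by (intro member_le_sum) auto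
  also have "\<dots> = fact b"
    using irr_char_orthonormal[OF assms(1,1)] by (simp add: avg_Sym_def power2_eq_square)
  finally show ?thesis .
qed

text \<open>The induced character \<open>w\<close> contains \<open>\<chi>\<close>, so \<open>w\<^sup>2 - \<chi>\<^sup>2 = (w - \<chi>) (w + \<chi>)\<close> is a positive combination of
  characters, and the fourth moment of \<open>\<chi>\<close> is at most that of \<open>w\<close>.\<close>

lemma fourth_moment:
  assumes \<beta>: "\<beta> \<turnstile>\<^sub>p b" and N: "2 * b + 1 \<le> N"
  shows "avg_Sym N (\<lambda>s. (irr_char (pad \<beta> N) s) ^ 4) \<le> real (fact b * (8 ^ b * (b + 1) ^ 7))"
proof -
  have sb: "sum_list \<beta> = b" using \<beta> by (simp add: is_partition_def)
  have part: "pad \<beta> N \<turnstile>\<^sub>p N" using \<beta> N sb by (intro pad_partition) auto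
  define \<chi> where "\<chi> = irr_char (pad \<beta> N)"
  define w where "w = ind b N (ext_char \<beta>)"
  define I where "I = ind b N (\<lambda>_. 1)"
  define S where "S = ind b N (\<lambda>s. (ext_char \<beta> s)\<^sup>2)"
  have \<chi>: "pos_class N \<chi>" unfolding \<chi>_def by (rule pos_class_irr_char[OF part])
  have w\<nu>: "avg_Sym N (\<lambda>s. w s * irr_char \<nu> s) = avg_young b N (\<lambda>s. ext_char \<beta> s * irr_char \<nu> s)"
    if "\<nu> \<in> partitions N" for \<nu>
    unfolding w_def using that by (intro avg_ind class_fun_irr_char) (simp add: partitions_def is_partition_def)
  have "avg_Sym N (\<lambda>s. w s * irr_char \<nu> s) \<ge> 0" if "\<nu> \<in> partitions N" for \<nu>
    unfolding w\<nu>[OF that] using that by (intro avg_young_nonneg sb) (simp add: partitions_def is_partition_def)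
  hence w: "pos_class N w" unfolding pos_class_def w_def using class_fun_ind by blast
  have diff: "pos_class N (\<lambda>s. w s - \<chi> s)"
    unfolding pos_class_def
  proof (intro conjI ballI)
    show "class_fun N (\<lambda>s. w s - \<chi> s)" using w \<chi> by (auto simp: pos_class_def class_fun_def)
    fix \<nu> assume \<nu>: "\<nu> \<in> partitions N"
    have "avg_Sym N (\<lambda>s. (w s - \<chi> s) * irr_char \<nu> s)
        = avg_Sym N (\<lambda>s. w s * irr_char \<nu> s) - avg_Sym N (\<lambda>s. \<chi> s * irr_char \<nu> s)"
      by (simp add: left_diff_distrib avg_Sym_diff)
    also have "\<dots> \<ge> 0"
    proof (cases "pad \<beta> N = \<nu>")
      case True
      have "avg_Sym N (\<lambda>s. \<chi> s * irr_char \<nu> s) = 1"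
        unfolding \<chi>_def using irr_char_orthonormal[OF part part] True by simp
      moreover have "avg_Sym N (\<lambda>s. w s * irr_char \<nu> s) \<ge> 1"
        unfolding w\<nu>[OF \<nu>] using avg_young_ge_1[OF sb, of N] N True by simp
      ultimately show ?thesis by simp
    next
      case False
      have "avg_Sym N (\<lambda>s. \<chi> s * irr_char \<nu> s) = 0"
        unfolding \<chi>_def using irr_char_orthonormal[OF part, of \<nu>] False \<nu> by (simp add: partitions_def)
      thus ?thesis using w \<nu> by (simp add: pos_class_def)
    qed
    finally show "avg_Sym N (\<lambda>s. (w s - \<chi> s) * irr_char \<nu> s) \<ge> 0" .
  qed
  have "0 \<le> avg_Sym N (\<lambda>s. ((w s - \<chi> s) * (w s + \<chi> s)) * (w s * w s + \<chi> s * \<chi> s))"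
    by (intro pos_class_inner pos_class_mult pos_class_add diff w \<chi>)
  also have "\<dots> = avg_Sym N (\<lambda>s. w s ^ 4 - \<chi> s ^ 4)"
    by (rule avg_Sym_cong) (simp add: algebra_simps power4_eq_xxxx)
  also have "\<dots> = avg_Sym N (\<lambda>s. w s ^ 4) - avg_Sym N (\<lambda>s. \<chi> s ^ 4)"
    by (rule avg_Sym_diff)
  finally have "avg_Sym N (\<lambda>s. \<chi> s ^ 4) \<le> avg_Sym N (\<lambda>s. w s ^ 4)" by simp
  also have "\<dots> \<le> avg_Sym N (\<lambda>s. fact b * (S s * I s ^ 3))"
  proof (rule avg_Sym_mono)
    fix s :: "nat \<Rightarrow> nat"
    have I: "I s \<ge> 0" unfolding I_def by (rule ind_nonneg) simp
    have S: "S s \<ge> 0" unfolding S_def by (rule ind_nonneg) simp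
    have SI: "S s \<le> fact b * I s"
      \<comment> \<open>Squaring the Cauchy-Schwarz estimate for w produces two factors S. One is
        traded for b! times I by this pointwise bound; the other stays under the average, so that b!
        enters only once.\<close>
      unfolding S_def I_def
    proof (rule ind_mono)
      fix u assume u: "u \<in> young b N"
      show "(ext_char \<beta> u)\<^sup>2 \<le> fact b * 1"
        unfolding ext_char_eq[OF sb u] using irr_char_square_le[OF \<beta> restr_permutes[OF u]] by simp
    qed
    have "(w s)\<^sup>2 \<le> I s * S s" unfolding w_def I_def S_def by (rule ind_square_le)
    hence "((w s)\<^sup>2)\<^sup>2 \<le> (I s * S s)\<^sup>2" by (rule power_mono) simp
    also have "\<dots> = (I s)\<^sup>2 * S s * S s" by (simp add: power2_eq_square mult_ac)
    also have "\<dots> \<le> (I s)\<^sup>2 * S s * (fact b * I s)" using S SI by (intro mult_left_mono) auto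
    finally show "w s ^ 4 \<le> fact b * (S s * I s ^ 3)"
      by (simp add: power2_eq_square power3_eq_cube power4_eq_xxxx mult_ac)
  qed
  also have "\<dots> = fact b * avg_Sym N (\<lambda>s. S s * I s ^ 3)" by (rule avg_Sym_scale)
  also have "avg_Sym N (\<lambda>s. S s * I s ^ 3) = avg_young b N (\<lambda>s. (ext_char \<beta> s)\<^sup>2 * I s ^ 3)"
    unfolding S_def by (rule avg_ind) (use class_fun_ind[of N b "\<lambda>_. 1"] in \<open>auto simp: class_fun_def I_def\<close>)
  also have "\<dots> \<le> 8 ^ b * (b + 1) ^ 7"
    unfolding I_def using N by (intro avg_young_moment \<beta>) simp
  finally show ?thesis by (simp add: \<chi>_def mult_left_mono)
qed

section \<open>Cauchy-Schwarz and the explicit upper bound\<close>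

lemma avg_Sym_Cauchy_Schwarz:
  "(avg_Sym n (\<lambda>s. f s * g s))\<^sup>2 \<le> avg_Sym n (\<lambda>s. (f s)\<^sup>2) * avg_Sym n (\<lambda>s. (g s)\<^sup>2)"
proof -
  have "(\<Sum>s\<in>Sym n. f s * g s)\<^sup>2 \<le> (\<Sum>s\<in>Sym n. (f s)\<^sup>2) * (\<Sum>s\<in>Sym n. (g s)\<^sup>2)"
    by (rule Cauchy_Schwarz_ineq_sum)
  thus ?thesis
    by (simp add: avg_Sym_def power_divide power2_eq_square[of "fact n"] divide_right_mono)
qed

lemma irr_char_triple_power4:
  assumes \<alpha>: "\<alpha> \<turnstile>\<^sub>p a" and \<beta>: "\<beta> \<turnstile>\<^sub>p b" and \<gamma>: "\<gamma> \<turnstile>\<^sub>p c"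
    and N: "2 * a + 1 \<le> N" "2 * b + 1 \<le> N" "2 * c + 1 \<le> N"
  shows "(avg_Sym N (\<lambda>s. irr_char (pad \<alpha> N) s * irr_char (pad \<beta> N) s * irr_char (pad \<gamma> N) s)) ^ 4
    \<le> real (fact b * (8 ^ b * (b + 1) ^ 7)) * real (fact c * (8 ^ c * (c + 1) ^ 7))"
proof -
  let ?a = "irr_char (pad \<alpha> N)" and ?b = "irr_char (pad \<beta> N)" and ?c = "irr_char (pad \<gamma> N)"
  have part: "pad \<alpha> N \<turnstile>\<^sub>p N" using \<alpha> N by (intro pad_partition) (auto simp: is_partition_def)
  have "(avg_Sym N (\<lambda>s. ?a s * ?b s * ?c s))\<^sup>2 = (avg_Sym N (\<lambda>s. ?a s * (?b s * ?c s)))\<^sup>2"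
    by (simp add: mult.assoc)
  also have "\<dots> \<le> avg_Sym N (\<lambda>s. (?a s)\<^sup>2) * avg_Sym N (\<lambda>s. (?b s * ?c s)\<^sup>2)"
    by (rule avg_Sym_Cauchy_Schwarz)
  also have "avg_Sym N (\<lambda>s. (?a s)\<^sup>2) = 1"
    using irr_char_orthonormal[OF part part] by (simp add: power2_eq_square)
  finally have "((avg_Sym N (\<lambda>s. ?a s * ?b s * ?c s))\<^sup>2)\<^sup>2 \<le> (avg_Sym N (\<lambda>s. (?b s * ?c s)\<^sup>2))\<^sup>2"
    by (intro power_mono) simp_all
  also have "\<dots> = (avg_Sym N (\<lambda>s. (?b s)\<^sup>2 * (?c s)\<^sup>2))\<^sup>2" by (simp add: power_mult_distrib)
  also have "\<dots> \<le> avg_Sym N (\<lambda>s. ((?b s)\<^sup>2)\<^sup>2) * avg_Sym N (\<lambda>s. ((?c s)\<^sup>2)\<^sup>2)"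
    by (rule avg_Sym_Cauchy_Schwarz)
  also have "\<dots> = avg_Sym N (\<lambda>s. ?b s ^ 4) * avg_Sym N (\<lambda>s. ?c s ^ 4)"
    by (simp flip: power_mult)
  also have "\<dots> \<le> real (fact b * (8 ^ b * (b + 1) ^ 7)) * real (fact c * (8 ^ c * (c + 1) ^ 7))"
  proof (rule mult_mono[OF fourth_moment[OF \<beta> N(2)] fourth_moment[OF \<gamma> N(3)]])
    show "0 \<le> avg_Sym N (\<lambda>s. ?c s ^ 4)" unfolding avg_Sym_def by (intro divide_nonneg_nonneg sum_nonneg) auto
  qed simp
  finally show ?thesis by (simp flip: power_mult)
qed

text \<open>The exponent is 22 = 2 + 6 + 14: the central binomial coefficient contributes 2, the
  power 8^(b+c) contributes 6, and the two seventh powers contribute 14 through k + 1 \<le>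
  2^k.\<close>

lemma moment_product_le:
  assumes bc: "b + c \<le> 2 * n"
  shows "(fact b * (8 ^ b * (b + 1) ^ 7)) * (fact c * (8 ^ c * (c + 1) ^ 7)) \<le> (fact n)\<^sup>2 * (2 :: nat) ^ (22 * n)"
proof -
  have "fact b * fact c * 1 \<le> fact b * fact c * ((b + c) choose b)"
    by (intro mult_left_mono) (auto simp: Suc_le_eq)
  also have "\<dots> = (fact (b + c) :: nat)" using binomial_fact_lemma[of b "b + c"] by simp
  also have "\<dots> \<le> fact (2 * n)" using bc by (rule fact_mono)
  also have "\<dots> = fact n * fact n * ((2 * n) choose n)" using binomial_fact_lemma[of n "2 * n"] by simp
  also have "\<dots> \<le> fact n * fact n * 2 ^ (2 * n)" by (intro mult_left_mono binomial_le_pow2) simp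
  finally have 1: "fact b * fact c \<le> (fact n)\<^sup>2 * (2 :: nat) ^ (2 * n)" by (simp add: power2_eq_square)
  have "8 ^ b * 8 ^ c = (8 :: nat) ^ (b + c)" by (simp add: power_add)
  also have "\<dots> \<le> 8 ^ (2 * n)" using bc by (intro power_increasing) auto
  also have "\<dots> = (2 ^ 3) ^ (2 * n)" by simp
  also have "\<dots> = 2 ^ (6 * n)" unfolding power_mult[symmetric] by simp
  finally have 2: "8 ^ b * 8 ^ c \<le> (2 :: nat) ^ (6 * n)" .
  have s: "k + 1 \<le> 2 ^ k" for k :: nat by (induction k) auto
  have "(b + 1) ^ 7 * (c + 1) ^ 7 \<le> (2 ^ b) ^ 7 * (2 ^ c) ^ 7" by (intro mult_mono power_mono s) auto
  also have "\<dots> = (2 :: nat) ^ (7 * (b + c))" by (simp add: power_mult[symmetric] power_add[symmetric] algebra_simps)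
  also have "\<dots> \<le> 2 ^ (14 * n)" using bc by (intro power_increasing) auto
  finally have 3: "(b + 1) ^ 7 * (c + 1) ^ 7 \<le> (2 :: nat) ^ (14 * n)" .
  have "(fact b * (8 ^ b * (b + 1) ^ 7)) * (fact c * (8 ^ c * (c + 1) ^ 7))
      = (fact b * fact c) * ((8 ^ b * 8 ^ c) * ((b + 1) ^ 7 * (c + 1) ^ 7))" by (simp only: mult_ac)
  also have "\<dots> \<le> ((fact n)\<^sup>2 * 2 ^ (2 * n)) * (2 ^ (6 * n) * 2 ^ (14 * n))"
    by (intro mult_mono 1 2 3) auto
  also have "\<dots> = (fact n)\<^sup>2 * 2 ^ (22 * n)" by (simp add: mult.assoc flip: power_add)
  finally show ?thesis .
qed

lemma reduced_kronecker_power4_le: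
  assumes \<alpha>: "\<alpha> \<turnstile>\<^sub>p a" and \<beta>: "\<beta> \<turnstile>\<^sub>p b" and \<gamma>: "\<gamma> \<turnstile>\<^sub>p c" and sum: "a + b + c \<le> 3 * n"
  shows "(reduced_kronecker \<alpha> \<beta> \<gamma>) ^ 4 \<le> (fact n)\<^sup>2 * 2 ^ (22 * n)"
proof -
  have "\<forall>\<^sub>F N in sequentially. kronecker (pad \<alpha> N) (pad \<beta> N) (pad \<gamma> N) = reduced_kronecker \<alpha> \<beta> \<gamma>
      \<and> 2 * (a + b + c) + 1 \<le> N"
    by (intro eventually_conj eventually_reduced_kronecker[OF \<alpha> \<beta> \<gamma>] eventually_ge_at_top)
  then obtain N where N: "kronecker (pad \<alpha> N) (pad \<beta> N) (pad \<gamma> N) = reduced_kronecker \<alpha> \<beta> \<gamma>"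
    "2 * (a + b + c) + 1 \<le> N" using eventually_happens'[OF sequentially_bot] by blast
  have Ns: "2 * a + 1 \<le> N" "2 * b + 1 \<le> N" "2 * c + 1 \<le> N" using N(2) by auto
  let ?a = "irr_char (pad \<alpha> N)" and ?b = "irr_char (pad \<beta> N)" and ?c = "irr_char (pad \<gamma> N)"
  have "sum_list (pad \<alpha> N) = N" using \<alpha> Ns by (simp add: sum_list_pad is_partition_def)
  hence eq: "reduced_kronecker \<alpha> \<beta> \<gamma> = avg_Sym N (\<lambda>s. ?a s * ?b s * ?c s)"
    using N(1) by (simp add: kronecker_eq_avg)
  have bound: "real (fact x * (8 ^ x * (x + 1) ^ 7)) * real (fact y * (8 ^ y * (y + 1) ^ 7)) \<le> (fact n)\<^sup>2 * (2 :: real) ^ (22 * n)"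
    if "x + y \<le> 2 * n" for x y :: nat
    using of_nat_mono[OF moment_product_le[OF that], where 'a = real] by simp
  consider "b + c \<le> 2 * n" | "a + c \<le> 2 * n" | "a + b \<le> 2 * n" using sum by linarith
  thus ?thesis
  proof cases
    case 1
    show ?thesis unfolding eq
      using irr_char_triple_power4[OF \<alpha> \<beta> \<gamma> Ns(1,2,3)] bound[OF 1] by linarith
  next
    case 2
    have "avg_Sym N (\<lambda>s. ?a s * ?b s * ?c s) = avg_Sym N (\<lambda>s. ?b s * ?a s * ?c s)"
      by (simp only: mult.commute)
    thus ?thesis unfolding eq
      using irr_char_triple_power4[OF \<beta> \<alpha> \<gamma> Ns(2,1,3)] bound[OF 2] by simp
  next
    case 3
    have "avg_Sym N (\<lambda>s. ?a s * ?b s * ?c s) = avg_Sym N (\<lambda>s. ?c s * ?a s * ?b s)"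
      by (rule avg_Sym_cong) (simp only: mult_ac)
    thus ?thesis unfolding eq
      using irr_char_triple_power4[OF \<gamma> \<alpha> \<beta> Ns(3,1,2)] bound[OF 3] by simp
  qed
qed

theorem theorem1p4:
  shows "\<exists>C::real. C > 0 \<and> (\<forall>n::nat. n \<ge> 1 \<longrightarrow>
           sqrt (fact n) * exp (- C * real n) \<le> max_reduced_kronecker n \<and>
           max_reduced_kronecker n \<le> sqrt (fact n) * exp (C * real n))"
proof (intro exI[of _ "6 :: real"] conjI allI impI)
  \<comment> \<open>Below, the squared estimate loses (2^(n+1) 2^n)^3 = 2^(6n+3), at most 2^(12n)
    since n \<ge> 1, and 12 is twice 6. Above, the fourth power loses 2^(22n), and 22 is rounded up
    to 24, four times 6. Powers of 2 pass to powers of e by 2 \<le> e.\<close>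
  show "(0 :: real) < 6" by simp
  fix n :: nat assume n: "n \<ge> 1"
  let ?m = "max_reduced_kronecker n"
  have exp_ge: "2 ^ k \<le> exp (real k)" for k
  proof -
    have "(2 :: real) \<le> exp 1" using exp_ge_add_one_self[of "1 :: real"] by simp
    hence "2 ^ k \<le> exp (1 :: real) ^ k" by (intro power_mono) auto
    thus ?thesis by (simp flip: exp_of_nat_mult)
  qed
  show "sqrt (fact n) * exp (- 6 * real n) \<le> ?m"
  proof (rule power2_le_imp_le)
    have "(2 ^ Suc n * 2 ^ n) ^ 3 = (2 :: real) ^ ((Suc n + n) * 3)"
      by (simp only: power_add[symmetric] power_mult[symmetric])
    also have "\<dots> \<le> 2 ^ (12 * n)" using n by (intro power_increasing) auto
    also have "\<dots> \<le> exp (real (12 * n))" by (rule exp_ge)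
    finally have "?m\<^sup>2 * (2 ^ Suc n * 2 ^ n) ^ 3 \<le> ?m\<^sup>2 * exp (real (12 * n))"
      by (rule mult_left_mono) simp
    with max_reduced_kronecker_square_ge[of n] have "fact n \<le> ?m\<^sup>2 * exp (real (12 * n))" by linarith
    hence "fact n * exp (- real (12 * n)) \<le> ?m\<^sup>2" by (simp add: exp_minus field_simps)
    moreover have "(exp (- 6 * real n))\<^sup>2 = exp (- real (12 * n))"
      by (simp flip: exp_double)
    ultimately show "(sqrt (fact n) * exp (- 6 * real n))\<^sup>2 \<le> ?m\<^sup>2" by (simp add: power_mult_distrib)
  qed (use max_reduced_kronecker_pos[of n] in simp)
  let ?V = "{reduced_kronecker \<alpha> \<beta> \<gamma> | a b c \<alpha> \<beta> \<gamma>.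
            a + b + c \<le> 3 * n \<and> \<alpha> \<turnstile>\<^sub>p a \<and> \<beta> \<turnstile>\<^sub>p b \<and> \<gamma> \<turnstile>\<^sub>p c}"
  have "[] \<turnstile>\<^sub>p 0" by (simp add: is_partition_def)
  hence "reduced_kronecker [] [] [] \<in> ?V" by force
  hence "?V \<noteq> {}" by blast
  hence "?m \<in> ?V"
    unfolding max_reduced_kronecker_def by (rule Max_in[OF finite_reduced_kronecker_values])
  hence "?m ^ 4 \<le> (fact n)\<^sup>2 * 2 ^ (22 * n)" using reduced_kronecker_power4_le by auto
  also have "\<dots> \<le> (fact n)\<^sup>2 * 2 ^ (24 * n)" by (intro mult_left_mono power_increasing) auto
  also have "\<dots> \<le> (fact n)\<^sup>2 * exp (real (24 * n))" by (intro mult_left_mono exp_ge) simp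
  also have "\<dots> = (sqrt (fact n) * exp (6 * real n)) ^ 4"
  proof -
    have "sqrt (fact n) ^ 4 = (fact n)\<^sup>2"
      using power_mult[of "sqrt (fact n)" 2 2] by simp
    moreover have "exp (6 * real n) ^ 4 = exp (real (24 * n))"
      using exp_of_nat_mult[of 4 "6 * real n"] by simp
    ultimately show ?thesis by (simp add: power_mult_distrib)
  qed
  finally have "?m ^ Suc 3 \<le> (sqrt (fact n) * exp (6 * real n)) ^ Suc 3" by simp
  thus "?m \<le> sqrt (fact n) * exp (6 * real n)" by (rule power_le_imp_le_base) simp
qed

end
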